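(* Let $s\in(0,1)$, let $N>2s$ be an integer, and let $a,c,f:\mathbb{R}^N\to\mathbb{R}$ satisfy the following, for some $\sigma\in(0,1)$: $a\in C^{0,\sigma}_{loc}(\mathbb{R}^N)$ with $a(x)>0$ for all $x\in\mathbb{R}^N$; there exist $C_0>0$ and $\alpha>2s$ such that $a(x)\ge C_0(1+|x|^2)^{\alpha/2}$ for all $x\in\mathbb{R}^N$; and $c,f\in C^{0,\sigma}_{loc}(\mathbb{R}^N)\cap L^\infty(\mathbb{R}^N)$. Let $\gamma\in\mathbb{R}$ and suppose that $c\le 0$ in $\mathbb{R}^N$. Then there exists a unique solution $u$ (in the viscosity sense defined in the context) of the equation $$a(-\Delta)^s u-cu=f\quad\text{in }\mathbb{R}^N$$ such that $\lim_{|x|\to\infty}u(x)=\gamma$.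
   Context: The fractional Laplacian is $(-\Delta)^s u(x)=C_{N,s}\,\mathrm{P.V.}\int_{\mathbb{R}^N}\frac{u(x)-u(y)}{|x-y|^{N+2s}}\,dy$ with $C_{N,s}=\frac{2^{2s}s\,\Gamma((N+2s)/2)}{\pi^{N/2}\Gamma(1-s)}$, for functions that are sufficiently regular near $x$ and belong to $\mathcal{L}^s(\mathbb{R}^N):=\{u \text{ measurable}: \int_{\mathbb{R}^N}\frac{|u(x)|}{1+|x|^{N+2s}}dx<\infty\}$. Sub- and supersolutions below are understood to belong to $\mathcal{L}^s(\mathbb{R}^N)$, so that the expressions make sense. Subsolution: $u$ is a subsolution of $a(-\Delta)^su-cu=f$ in $\mathbb{R}^N$ if (i) $u$ is upper semicontinuous in $\mathbb{R}^N$; (ii) for any open bounded subset $U\subset\mathbb{R}^N$, any $x_0\in U$, and any test function $\varphi\in C^2(\mathbb{R}^N)$ such that $u(x_0)=\varphi(x_0)$ and $u(x_0)-\varphi(x_0)\ge u(x)-\varphi(x)$ for all $x\in U$, one has $$a(x_0)(-\Delta)^s\psi(x_0)-c(x_0)u(x_0)\le f(x_0),$$ where $\psi:=\varphi$ in $U$ and $\psi:=u$ in $\mathbb{R}^N\setminus U$. Supersolution: the same with "lower semicontinuous" and with both inequalities (in the touching condition and in the equation) reversed. A solution is a function that is both a subsolution and a supersolution. *)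

theory Defs
  imports "HOL-Analysis.Analysis"
begin

definition usc :: "('a::topological_space \<Rightarrow> real) \<Rightarrow> bool" where
  "usc u \<longleftrightarrow> (\<forall>x t. u x < t \<longrightarrow> (\<forall>\<^sub>F y in nhds x. u y < t))"

definition lsc :: "('a::topological_space \<Rightarrow> real) \<Rightarrow> bool" where
  "lsc u \<longleftrightarrow> (\<forall>x t. t < u x \<longrightarrow> (\<forall>\<^sub>F y in nhds x. t < u y))"

definition locally_holder :: "real \<Rightarrow> ('a::metric_space \<Rightarrow> real) \<Rightarrow> bool" where
  "locally_holder \<sigma> g \<longleftrightarrow>
     (\<forall>K. compact K \<longrightarrow> (\<exists>L. \<forall>x\<in>K. \<forall>y\<in>K. \<bar>g x - g y\<bar> \<le> L * dist x y powr \<sigma>))"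

definition L_infty :: "('a::euclidean_space \<Rightarrow> real) \<Rightarrow> bool" where
  "L_infty g \<longleftrightarrow> g \<in> borel_measurable lebesgue \<and> (\<exists>M. AE x in lebesgue. \<bar>g x\<bar> \<le> M)"

definition C2 :: "('a::real_normed_vector \<Rightarrow> real) \<Rightarrow> bool" where
  "C2 \<phi> \<longleftrightarrow>
     (\<exists>(D :: 'a \<Rightarrow> 'a \<Rightarrow>\<^sub>L real) (D2 :: 'a \<Rightarrow> 'a \<Rightarrow>\<^sub>L ('a \<Rightarrow>\<^sub>L real)).
        (\<forall>x. (\<phi> has_derivative blinfun_apply (D x)) (at x)) \<and>
        (\<forall>x. (D has_derivative blinfun_apply (D2 x)) (at x)) \<and>
        continuous_on UNIV D2)"

definition Ls_space :: "real \<Rightarrow> ('a::euclidean_space \<Rightarrow> real) set" where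
  "Ls_space s =
     {u. u \<in> borel_measurable lebesgue \<and>
         integrable lebesgue (\<lambda>x. \<bar>u x\<bar> / (1 + norm x powr (real DIM('a) + 2 * s)))}"

definition frac_lap_const :: "real \<Rightarrow> real \<Rightarrow> real" where
  "frac_lap_const N s =
     2 powr (2 * s) * s * Gamma ((N + 2 * s) / 2) / (pi powr (N / 2) * Gamma (1 - s))"

text \<open>The principal value is the limit of the integrals over the complements of balls around
  \<^term>\<open>x\<close>. As \<^const>\<open>Lim\<close> is total, the value is meaningful only where that limit exists, in
  particular for functions of the space \<^const>\<open>Ls_space\<close> that are twice continuously
  differentiable near \<^term>\<open>x\<close>; these are the only ones used below.\<close>

definition frac_laplacian :: "real \<Rightarrow> ('a::euclidean_space \<Rightarrow> real) \<Rightarrow> 'a \<Rightarrow> real" where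
  "frac_laplacian s u x =
     frac_lap_const (real DIM('a)) s *
     Lim (at_right 0) (\<lambda>\<epsilon>. set_lebesgue_integral lebesgue (- ball x \<epsilon>)
       (\<lambda>y. (u x - u y) / norm (x - y) powr (real DIM('a) + 2 * s)))"

definition viscosity_subsolution ::
  "real \<Rightarrow> ('a::euclidean_space \<Rightarrow> real) \<Rightarrow> ('a \<Rightarrow> real) \<Rightarrow> ('a \<Rightarrow> real) \<Rightarrow> ('a \<Rightarrow> real) \<Rightarrow> bool" where
  "viscosity_subsolution s a c f u \<longleftrightarrow>
     u \<in> Ls_space s \<and> usc u \<and>
     (\<forall>U x0 \<phi>. open U \<longrightarrow> bounded U \<longrightarrow> x0 \<in> U \<longrightarrow> C2 \<phi> \<longrightarrow> u x0 = \<phi> x0 \<longrightarrow>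
        (\<forall>x\<in>U. u x0 - \<phi> x0 \<ge> u x - \<phi> x) \<longrightarrow>
        a x0 * frac_laplacian s (\<lambda>x. if x \<in> U then \<phi> x else u x) x0 - c x0 * u x0 \<le> f x0)"

definition viscosity_supersolution ::
  "real \<Rightarrow> ('a::euclidean_space \<Rightarrow> real) \<Rightarrow> ('a \<Rightarrow> real) \<Rightarrow> ('a \<Rightarrow> real) \<Rightarrow> ('a \<Rightarrow> real) \<Rightarrow> bool" where
  "viscosity_supersolution s a c f u \<longleftrightarrow>
     u \<in> Ls_space s \<and> lsc u \<and>
     (\<forall>U x0 \<phi>. open U \<longrightarrow> bounded U \<longrightarrow> x0 \<in> U \<longrightarrow> C2 \<phi> \<longrightarrow> u x0 = \<phi> x0 \<longrightarrow>
        (\<forall>x\<in>U. u x0 - \<phi> x0 \<le> u x - \<phi> x) \<longrightarrow>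
        a x0 * frac_laplacian s (\<lambda>x. if x \<in> U then \<phi> x else u x) x0 - c x0 * u x0 \<ge> f x0)"

definition viscosity_solution ::
  "real \<Rightarrow> ('a::euclidean_space \<Rightarrow> real) \<Rightarrow> ('a \<Rightarrow> real) \<Rightarrow> ('a \<Rightarrow> real) \<Rightarrow> ('a \<Rightarrow> real) \<Rightarrow> bool" where
  "viscosity_solution s a c f u \<longleftrightarrow>
     viscosity_subsolution s a c f u \<and> viscosity_supersolution s a c f u"

end

theory Submission
  imports Defs
begin

text \<open>
  Writing \<open>heat t\<close> for the Gaussian semigroup, \<open>(-\<Delta>)\<^sup>s u (x)\<close> is, up to a positive constant, the limit as
  \<open>\<delta> \<rightarrow> 0\<close> of \<open>\<integral>\<^sub>t\<^sub>>\<^sub>\<delta> (u x - heat t u x) t powr (-1-s)\<close>, and \<open>pot s q x = \<integral> heat t q x t powr (s-1)\<close> is, up to a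
  constant, the Riesz potential of \<open>q\<close>. By the semigroup property, that the former operator inverts the latter is
  a statement on functions of one real variable: the Marchaud derivative inverts the Liouville integral, and it
  does so pointwise for merely continuous \<open>q\<close>. Thus it suffices to find \<open>w = \<gamma> + pot s q\<close> with \<open>q\<close> proportional
  to \<open>(f + c w) / a\<close>, an equation \<open>w + K w = h\<close> in the space of bounded continuous functions, which is solved by the
  method of continuity: as \<open>c \<le> 0\<close>, the maximum principle yields the a priori bound.
  Since \<open>pot s q\<close> solves the equation pointwise, comparison with touching functions makes \<open>w\<close> a viscosity solution.
  Any other viscosity solution is compared with the smooth functions \<open>heat \<epsilon> (w + \<eta> pot s q0)\<close>, which are
  admissible test functions and, for a positive \<open>q0\<close>, nearly strict supersolutions.
\<close>

section \<open>Integrability of powers and Gaussians\<close>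

text \<open>The obstacle is regularity: the potential of a continuous density need not be twice
  differentiable, so the principal value cannot be handled at it directly. The heat formulation asks
  only for the values of \<open>t \<mapsto> heat t w x\<close>. The principal value is computed only
  for functions that agree with a \<open>C2\<close> function near the point; there it and the heat
  formulation are positive multiples of one absolutely convergent integral of second differences.
  Only the signs of the constants in between matter, so none of them is evaluated. A single exponent
  \<beta> controls all decay. Division by \<open>a\<close> produces densities of order
  \<open>(1 + norm x) powr (- (2 * \<beta>))\<close>; by parabolic scaling their heat flow is of
  order \<open>t powr (- \<beta>)\<close>, which is integrable against \<open>t powr (s - 1)\<close>
  at infinity for \<beta> > s. The scaling bound integrates a singularity of order 2\<beta> over a
  ball, whence \<beta> < N / 2.\<close>

lemma nn_integral_has_integral_indicator:
  fixes f :: "'a::euclidean_space \<Rightarrow> real"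
  assumes "f \<in> borel_measurable borel" "S \<in> sets borel" "\<And>x. x \<in> S \<Longrightarrow> 0 \<le> f x"
    and "(f has_integral I) S"
  shows "(\<integral>\<^sup>+x. ennreal (f x) * indicator S x \<partial>lborel) = ennreal I"
proof -
  have "(\<integral>\<^sup>+x. ennreal (f x * indicator S x) \<partial>lborel) = ennreal I"
  proof (rule nn_integral_has_integral_lborel)
    show "(\<lambda>x. f x * indicator S x) \<in> borel_measurable borel"
      using assms by measurable
    show "0 \<le> f x * indicator S x" for x
      using assms by (auto simp: indicator_def)
    have "(\<lambda>x. f x * indicator S x) = (\<lambda>x. if x \<in> S then f x else 0)"
      by (auto simp: indicator_def)
    then show "((\<lambda>x. f x * indicator S x) has_integral I) UNIV"
      using assms(4) has_integral_restrict_UNIV by metis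
  qed
  moreover have "ennreal (f x * indicator S x) = ennreal (f x) * indicator S x" for x
    by (auto simp: indicator_def)
  ultimately show ?thesis by simp
qed

lemma nn_integral_powr_0_1:
  assumes "p > -1"
  shows "(\<integral>\<^sup>+t. ennreal (t powr p) * indicator {0..1} t \<partial>lborel) = ennreal (1 / (p + 1))"
  using has_integral_powr_from_0[OF assms, of 1]
  by (intro nn_integral_has_integral_indicator) auto

lemma nn_integral_powr_inf:
  assumes "p < -1" "a > 0"
  shows "(\<integral>\<^sup>+t. ennreal (t powr p) * indicator {a..} t \<partial>lborel) = ennreal (- (a powr (p + 1) / (p + 1)))"
  using has_integral_powr_to_inf[OF assms]
  by (intro nn_integral_has_integral_indicator) auto

text \<open>Tonelli step shared by the two layer-cake computations below: a radial function written
  as an integral over the radii \<open>t \<ge> norm z\<close> integrates to \<open>g\<close>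
  weighted by ball volumes.\<close>

lemma nn_integral_cball_swap:
  fixes g :: "real \<Rightarrow> ennreal"
  assumes [measurable]: "g \<in> borel_measurable borel"
  shows "(\<integral>\<^sup>+z. (\<integral>\<^sup>+t. g t * indicator (cball (0::'a::euclidean_space) t) z \<partial>lborel) \<partial>lborel)
    = (\<integral>\<^sup>+t. g t * emeasure lborel (cball (0::'a) t) \<partial>lborel)"
proof -
  have "indicator (cball (0::'a) t) z = (indicator {p. norm (snd p) \<le> fst p} (t, z) :: ennreal)" for t z
    by (auto simp: indicator_def)
  then have "(\<integral>\<^sup>+z. (\<integral>\<^sup>+t. g t * indicator (cball (0::'a) t) z \<partial>lborel) \<partial>lborel)
    = (\<integral>\<^sup>+z. (\<integral>\<^sup>+t. g t * indicator {p. norm (snd p) \<le> fst p} (t, z::'a) \<partial>lborel) \<partial>lborel)"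
    by simp
  also have "\<dots> = (\<integral>\<^sup>+t. (\<integral>\<^sup>+z. g t * indicator {p. norm (snd p) \<le> fst p} (t, z::'a) \<partial>lborel) \<partial>lborel)"
    by (subst lborel_pair.Fubini') auto
  also have "\<dots> = (\<integral>\<^sup>+t. g t * emeasure lborel (cball (0::'a) t) \<partial>lborel)"
  proof (intro nn_integral_cong)
    fix t
    have "(\<integral>\<^sup>+z. g t * indicator {p. norm (snd p) \<le> fst p} (t, z::'a) \<partial>lborel) = (\<integral>\<^sup>+z. g t * indicator (cball (0::'a) t) z \<partial>lborel)"
      by (intro nn_integral_cong) (auto simp: indicator_def)
    then show "(\<integral>\<^sup>+z. g t * indicator {p. norm (snd p) \<le> fst p} (t, z::'a) \<partial>lborel) = g t * emeasure lborel (cball (0::'a) t)"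
      by (subst (asm) nn_integral_cmult_indicator) (simp_all del: nn_integral_cmult_indicator)
  qed
  finally show ?thesis .
qed

text \<open>Layer cake: \<open>r powr (-b) = 1 + b \<integral>\<^sub>r\<^sup>1 t powr (-b-1) dt\<close> for \<open>0 < r < 1\<close>, and the balls of radius \<open>t\<close> have volume proportional to \<open>t\<^sup>N\<close>.\<close>

lemma integrable_norm_powr_ball:
  assumes b: "b < real DIM('a)"
  shows "integrable lborel (\<lambda>z::'a::euclidean_space. indicator (ball (0::'a) 1) z * norm z powr (- b))"
proof -
  define N where "N = real DIM('a)"
  \<comment> \<open>The layer-cake formula wants a positive exponent, while \<open>b\<close> may be
    zero or negative. Inside the unit ball a larger exponent only enlarges the integrand, and
    \<open>N / 2\<close> still lies below \<open>N\<close>.\<close>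
  define b' where "b' = max b (N / 2)"
  have N: "N > 0" unfolding N_def by simp
  have V: "unit_ball_vol N \<ge> 0" using N by (intro unit_ball_vol_nonneg) simp
  have b': "b' > 0" "b' < N" "b \<le> b'"
    using N b unfolding b'_def N_def by (auto simp: less_max_iff_disj)
  let ?I = "\<lambda>z. \<integral>\<^sup>+t. ennreal (b' * t powr (- b' - 1)) * indicator {0<..1} t * indicator (cball (0::'a) t) z \<partial>lborel"
  have pt: "ennreal (indicator (ball (0::'a) 1) z * norm z powr (- b)) \<le>
      indicator (ball (0::'a) 1) z + ?I z"
    (is "_ \<le> ?R") for z :: 'a
  proof (cases "z \<noteq> 0 \<and> norm z < 1")
    case False
    then show ?thesis by (auto simp: indicator_def)
  next
    case True
    let ?r = "norm z"
    have r: "0 < ?r" "?r < 1" using True by auto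
    have d: "((\<lambda>t. b' * t powr (- b' - 1)) has_integral (- (1 powr - b') - (- (?r powr - b')))) {?r..1}"
    proof (rule fundamental_theorem_of_calculus)
      fix t assume "t \<in> {?r..1}"
      then have "norm z \<le> t" by simp
      then have "t > 0" using r(1) by linarith
      then have "((\<lambda>t. - (t powr - b')) has_real_derivative b' * t powr (- b' - 1)) (at t within {?r..1})"
        by (auto intro!: derivative_eq_intros simp: powr_diff field_simps)
      then show "((\<lambda>t. - (t powr - b')) has_vector_derivative b' * t powr (- b' - 1)) (at t within {?r..1})"
        by (simp add: has_real_derivative_iff_has_vector_derivative)
    qed (use r in auto)
    have "(\<integral>\<^sup>+t. ennreal (b' * t powr (- b' - 1)) * indicator {?r..1} t \<partial>lborel) = ennreal (- (1 powr - b') - (- (?r powr - b')))"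
      by (rule nn_integral_has_integral_indicator[OF _ _ _ d]) (use b' in auto)
    also have "(\<integral>\<^sup>+t. ennreal (b' * t powr (- b' - 1)) * indicator {?r..1} t \<partial>lborel) =
      ?I z"
    proof (intro nn_integral_cong)
      fix t
      have "norm z \<le> t \<Longrightarrow> 0 < t" using r(1) by linarith
      then show "ennreal (b' * t powr (- b' - 1)) * indicator {?r..1} t =
        ennreal (b' * t powr (- b' - 1)) * indicator {0<..1} t * indicator (cball (0::'a) t) z"
        by (auto simp: indicator_def)
    qed
    finally have R: "?R = ennreal 1 + ennreal (?r powr - b' - 1)"
      using r by (simp add: indicator_def)
    have "?r powr - b' \<ge> 1 powr - b'" using r b' by (intro powr_mono2') auto
    then have "?R = ennreal (?r powr - b')"
      unfolding R by (subst ennreal_plus[symmetric]) auto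
    moreover have "?r powr - b \<le> ?r powr - b'"
      using r b' by (intro powr_mono') auto
    ultimately show ?thesis using r by (simp add: indicator_def ennreal_leI)
  qed
  have "(\<integral>\<^sup>+z. ?I z \<partial>lborel) = (\<integral>\<^sup>+t. ennreal (b' * t powr (- b' - 1)) * indicator {0<..1} t * emeasure lborel (cball (0::'a) t) \<partial>lborel)"
    by (rule nn_integral_cball_swap) measurable
  also have "\<dots> \<le> (\<integral>\<^sup>+t. ennreal (b' * unit_ball_vol N) * (ennreal (t powr (N - b' - 1)) * indicator {0..1} t) \<partial>lborel)"
  proof (intro nn_integral_mono)
    fix t :: real
    show "ennreal (b' * t powr (- b' - 1)) * indicator {0<..1} t * emeasure lborel (cball (0::'a) t)
      \<le> ennreal (b' * unit_ball_vol N) * (ennreal (t powr (N - b' - 1)) * indicator {0..1} t)"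
    proof (cases "0 < t \<and> t \<le> 1")
      case True
      then have e: "emeasure lborel (cball (0::'a) t) = ennreal (unit_ball_vol N * t powr N)"
        by (simp add: emeasure_cball N_def powr_realpow)
      have "t powr (- b' - 1) * t powr N = t powr (N - b' - 1)"
        using True by (simp add: powr_diff powr_minus powr_add field_simps)
      then show ?thesis
        using True b' V unfolding e
        by (simp add: indicator_def ennreal_mult[symmetric] mult.left_commute mult.assoc)
    qed (auto simp: indicator_def)
  qed
  also have "\<dots> = ennreal (b' * unit_ball_vol N) * ennreal (1 / (N - b' - 1 + 1))"
    using b' by (subst nn_integral_cmult) (auto simp: nn_integral_powr_0_1)
  also have "\<dots> < \<infinity>" by (simp add: ennreal_mult_less_top)
  finally have fin: "(\<integral>\<^sup>+z. ?I z \<partial>lborel) < \<infinity>" .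
  have "(\<integral>\<^sup>+z. ennreal (indicator (ball (0::'a) 1) z * norm z powr (- b)) \<partial>lborel) \<le>
    (\<integral>\<^sup>+z. indicator (ball (0::'a) 1) z + ?I z \<partial>lborel)"
    using pt by (intro nn_integral_mono) (auto simp: indicator_def)
  also have "\<dots> = emeasure lborel (ball (0::'a) 1) + (\<integral>\<^sup>+z. ?I z \<partial>lborel)"
    by (subst nn_integral_add) (auto simp: indicator_def intro!: borel_measurable_indicator)
  also have "\<dots> < \<infinity>" using fin by (simp add: emeasure_ball)
  finally show ?thesis
    by (intro integrableI_nonneg) (auto intro!: borel_measurable_times borel_measurable_indicator)
qed

text \<open>Here \<open>norm z powr (- b)\<close> is the integral of
  \<open>b * t powr (- b - 1)\<close> over \<open>t\<close> from \<open>norm z\<close> to infinity,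
  without a boundary term; against the ball volumes the exponent becomes
  \<open>N - b - 1 < -1\<close>.\<close>

lemma integrable_norm_powr_outside:
  assumes b: "b > real DIM('a)" and "r > 0"
  shows "integrable lborel (\<lambda>z::'a::euclidean_space. indicator (- ball 0 r) z * norm z powr (- b))"
proof -
  define N where "N = real DIM('a)"
  have N: "N > 0" unfolding N_def by simp
  have V: "unit_ball_vol N \<ge> 0" using N by (intro unit_ball_vol_nonneg) simp
  have b': "b > 0" "b > N"
    using N b unfolding N_def by auto
  let ?I = "\<lambda>z. \<integral>\<^sup>+t. ennreal (b * t powr (- b - 1)) * indicator {r..} t * indicator (cball (0::'a) t) z \<partial>lborel"
  have pt: "ennreal (indicator (- ball (0::'a) r) z * norm z powr (- b)) \<le>
      ?I z"
    (is "_ \<le> ?R") for z :: 'a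
  proof (cases "norm z \<ge> r")
    case False
    then show ?thesis by (auto simp: indicator_def)
  next
    case True
    let ?r = "norm z"
    have r: "0 < ?r" using True assms by linarith
    have "?I z
      = (\<integral>\<^sup>+t. ennreal b * (ennreal (t powr (- b - 1)) * indicator {?r..} t) \<partial>lborel)"
      using r True b' by (intro nn_integral_cong) (auto simp: indicator_def ennreal_mult)
    also have "\<dots> = ennreal b * ennreal (- (?r powr (- b - 1 + 1) / (- b - 1 + 1)))"
      using r b' by (subst nn_integral_cmult) (auto simp: nn_integral_powr_inf)
    also have "\<dots> = ennreal (?r powr - b)"
      using b' by (simp add: ennreal_mult[symmetric])
    finally show ?thesis by (simp add: indicator_def)
  qed
  have "(\<integral>\<^sup>+z. ?I z \<partial>lborel) = (\<integral>\<^sup>+t. ennreal (b * t powr (- b - 1)) * indicator {r..} t * emeasure lborel (cball (0::'a) t) \<partial>lborel)"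
    by (rule nn_integral_cball_swap) measurable
  also have "\<dots> = (\<integral>\<^sup>+t. ennreal (b * unit_ball_vol N) * (ennreal (t powr (N - b - 1)) * indicator {r..} t) \<partial>lborel)"
  proof (intro nn_integral_cong)
    fix t :: real
    show "ennreal (b * t powr (- b - 1)) * indicator {r..} t * emeasure lborel (cball (0::'a) t)
      = ennreal (b * unit_ball_vol N) * (ennreal (t powr (N - b - 1)) * indicator {r..} t)"
    proof (cases "r \<le> t")
      case True
      then have t: "t > 0" using assms by simp
      have e: "emeasure lborel (cball (0::'a) t) = ennreal (unit_ball_vol N * t powr N)"
        using t by (simp add: emeasure_cball N_def powr_realpow)
      have "t powr (- b - 1) * t powr N = t powr (N - b - 1)"
        using t by (simp add: powr_diff powr_minus powr_add field_simps)
      then show ?thesis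
        using True b' V unfolding e
        by (simp add: indicator_def ennreal_mult[symmetric] mult.left_commute mult.assoc)
    qed (auto simp: indicator_def)
  qed
  also have "\<dots> = ennreal (b * unit_ball_vol N) * ennreal (- (r powr (N - b - 1 + 1) / (N - b - 1 + 1)))"
    using b' assms by (subst nn_integral_cmult) (auto simp: nn_integral_powr_inf)
  also have "\<dots> < \<infinity>" by (simp add: ennreal_mult_less_top)
  finally have fin: "(\<integral>\<^sup>+z. ?I z \<partial>lborel) < \<infinity>" .
  have "(\<integral>\<^sup>+z. ennreal (indicator (- ball (0::'a) r) z * norm z powr (- b)) \<partial>lborel) \<le>
    (\<integral>\<^sup>+z. ?I z \<partial>lborel)"
    by (intro nn_integral_mono pt)
  also note fin
  finally show ?thesis
    by (intro integrableI_nonneg) auto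
qed

lemma power_over_fact_le_exp:
  fixes x :: real
  assumes "x \<ge> 0"
  shows "x ^ m / fact m \<le> exp x"
proof -
  have "(\<Sum>n\<in>{m}. x ^ n / fact n) \<le> (\<Sum>n. x ^ n / fact n)"
    using assms summable_exp[of x] by (intro sum_le_suminf) (auto simp: field_simps)
  then show ?thesis by (simp add: exp_def field_simps scaleR_conv_of_real)
qed

text \<open>The linear term in the exponent provides for the majorants that appear when Gaussian
  convolutions are differentiated.\<close>

lemma integrable_gauss_exp:
  fixes R e :: real
  assumes "e > 0"
  shows "integrable lborel (\<lambda>z::'a::euclidean_space. exp (R * norm z - e * (norm z)\<^sup>2))"
proof -
  define m where "m = DIM('a) + 1"
  \<comment> \<open>The maximum of \<open>(R + 1) * r - e * r\<^sup>2\<close> over \<open>r\<close>.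
    Completing the square thus leaves the factor \<open>exp (- r)\<close>, which beats every
    power.\<close>
  define K where "K = (R + 1)\<^sup>2 / (4 * e)"
  have K: "R * r - e * r\<^sup>2 \<le> K - r" for r
  proof -
    have "0 \<le> (2 * e * r - (R + 1))\<^sup>2" by simp
    then have "4 * e * ((R + 1) * r - e * r\<^sup>2) \<le> (R + 1)\<^sup>2"
      by (simp add: power2_eq_square algebra_simps)
    then show ?thesis
      using assms unfolding K_def by (simp add: field_simps)
  qed
  have m: "real m > DIM('a)" unfolding m_def by simp
  let ?g = "\<lambda>z::'a. exp K * indicator (ball (0::'a) 1) z + exp K * fact m * (indicator (- ball (0::'a) 1) z * norm z powr (- real m))"
  show ?thesis
  proof (rule Bochner_Integration.integrable_bound[where f = ?g])
    have "integrable lborel (\<lambda>z::'a. indicator (ball (0::'a) 1) z :: real)"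
      by (intro integrable_real_indicator) (auto simp: emeasure_ball)
    then show "integrable lborel ?g"
      using integrable_norm_powr_outside[OF m, of 1] by auto
    show "AE z in lborel. norm (exp (R * norm z - e * (norm z)\<^sup>2)) \<le> norm (?g z)" (is "AE z in _. ?P z")
    proof (intro always_eventually allI)
      fix z :: 'a
      have 1: "exp (R * norm z - e * (norm z)\<^sup>2) \<le> exp K * exp (- norm z)"
        using K[of "norm z"] by (simp add: exp_add[symmetric])
      show "?P z"
      proof (cases "norm z < 1")
        case True
        have "exp K * exp (- norm z) \<le> exp K" by simp
        then have "exp (R * norm z - e * (norm z)\<^sup>2) \<le> exp K" using 1 by linarith
        then show ?thesis using True by (simp add: indicator_def del: exp_le_cancel_iff)
      next
        case False
        then have z: "norm z \<ge> 1" by simp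
        have "norm z ^ m > 0" using z by (intro zero_less_power) linarith
        moreover have "norm z ^ m / fact m \<le> exp (norm z)"
          by (rule power_over_fact_le_exp) simp
        ultimately have "exp (- norm z) \<le> fact m * norm z powr (- real m)"
          using z powr_realpow[OF order_less_le_trans[OF zero_less_one z], of m]
          by (simp add: exp_minus powr_minus field_simps del: zero_less_norm_iff)
        then have "exp K * exp (- norm z) \<le> exp K * (fact m * norm z powr (- real m))"
          by simp
        with 1 have "exp (R * norm z - e * (norm z)\<^sup>2) \<le> exp K * (fact m * norm z powr (- real m))"
          by linarith
        then show ?thesis using z by (simp add: indicator_def mult.assoc)
      qed
    qed
  qed simp
qed

section \<open>The heat semigroup\<close>

lemma lborel_nn_integral_affine:
  fixes f :: "'a::euclidean_space \<Rightarrow> ennreal"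
  assumes [measurable]: "f \<in> borel_measurable borel" and c: "c \<noteq> 0"
  shows "(\<integral>\<^sup>+x. f x \<partial>lborel) = ennreal (\<bar>c\<bar> ^ DIM('a)) * (\<integral>\<^sup>+x. f (t + c *\<^sub>R x) \<partial>lborel)"
  by (subst lborel_affine[OF c, of t])
     (simp add: nn_integral_density nn_integral_distr nn_integral_cmult ennreal_power)

lemma lborel_integrable_affine:
  fixes f :: "'a::euclidean_space \<Rightarrow> real"
  assumes f: "integrable lborel f" and c: "c \<noteq> 0"
  shows "integrable lborel (\<lambda>x. f (t + c *\<^sub>R x))"
proof -
  have [measurable]: "f \<in> borel_measurable borel" using f by auto
  have "(\<integral>\<^sup>+x. ennreal (norm (f x)) \<partial>lborel) = \<bar>c\<bar> ^ DIM('a) * (\<integral>\<^sup>+x. ennreal (norm (f (t + c *\<^sub>R x))) \<partial>lborel)"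
    by (rule lborel_nn_integral_affine[of "\<lambda>x. ennreal (norm (f x))" c t, OF _ c]) measurable
  then have "\<bar>c\<bar> ^ DIM('a) * (\<integral>\<^sup>+x. ennreal (norm (f (t + c *\<^sub>R x))) \<partial>lborel) < \<infinity>"
    using f unfolding integrable_iff_bounded by simp
  then show ?thesis
    using c unfolding integrable_iff_bounded by (auto simp: ennreal_mult_less_top)
qed

text \<open>If \<open>f\<close> is not integrable, neither is the composed function, and both
  integrals are 0 by convention; the substitutions below thus carry no integrability
  condition.\<close>

lemma lborel_integral_affine:
  fixes f :: "'a::euclidean_space \<Rightarrow> real"
  assumes f[measurable]: "f \<in> borel_measurable borel" and c: "c \<noteq> 0"
  shows "(LBINT x. f x) = \<bar>c\<bar> ^ DIM('a) * (LBINT x. f (t + c *\<^sub>R x))"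
proof (cases "integrable lborel f")
  case True
  then show ?thesis
    using c by (subst lborel_affine[OF c, of t]) (simp add: integral_density integral_distr)
next
  case False
  have "\<not> integrable lborel (\<lambda>x. f (t + c *\<^sub>R x))"
  proof
    assume "integrable lborel (\<lambda>x. f (t + c *\<^sub>R x))"
    from lborel_integrable_affine[OF this, of "1 / c" "- (1 / c) *\<^sub>R t"]
    show False using False c by (simp add: scaleR_right_diff_distrib)
  qed
  with False show ?thesis by (simp add: not_integrable_integral_eq)
qed

text \<open>Normalised by its own mass instead of by \<open>pi powr (N / 2)\<close>, so that total
  mass 1 holds by construction, without evaluating the Gaussian integral.\<close>

definition gauss_kernel :: "'a::euclidean_space \<Rightarrow> real" where
  "gauss_kernel z = exp (- (norm z)\<^sup>2) / (LBINT y. exp (- (norm (y::'a))\<^sup>2))"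

lemma integrable_gauss: "integrable lborel (\<lambda>z::'a::euclidean_space. exp (- (norm z)\<^sup>2))"
  using integrable_gauss_exp[of 1 0, where 'a = 'a] by simp

lemma gauss_mass_pos: "(LBINT y. exp (- (norm (y::'a::euclidean_space))\<^sup>2)) > 0"
proof -
  have "(LBINT y. exp (- (norm (y::'a))\<^sup>2)) \<noteq> 0"
  proof
    assume "(LBINT y. exp (- (norm (y::'a))\<^sup>2)) = 0"
    then have "AE y::'a in lborel. exp (- (norm y)\<^sup>2) = (0::real)"
      using integrable_gauss by (subst (asm) integral_nonneg_eq_0_iff_AE) auto
    then show False by (simp add: AE_iff_measurable[OF _ refl])
  qed
  moreover have "(LBINT y. exp (- (norm (y::'a))\<^sup>2)) \<ge> 0" by simp
  ultimately show ?thesis by linarith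
qed

lemma gauss_kernel_measurable[measurable]: "gauss_kernel \<in> borel_measurable borel"
  unfolding gauss_kernel_def by measurable

lemma gauss_kernel_pos: "gauss_kernel (z::'a::euclidean_space) > 0"
  unfolding gauss_kernel_def using gauss_mass_pos[where 'a = 'a] by simp

lemma gauss_kernel_nonneg[simp]: "gauss_kernel z \<ge> 0"
  using gauss_kernel_pos[of z] by simp

lemma gauss_kernel_uminus[simp]: "gauss_kernel (- z) = gauss_kernel z"
  by (simp add: gauss_kernel_def)

lemma integrable_gauss_kernel[simp]: "integrable lborel (gauss_kernel :: 'a::euclidean_space \<Rightarrow> real)"
  unfolding gauss_kernel_def using integrable_gauss[where 'a = 'a] by simp

lemma integral_gauss_kernel[simp]: "(LBINT z. gauss_kernel (z::'a::euclidean_space)) = 1"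
  unfolding gauss_kernel_def using gauss_mass_pos[where 'a = 'a] by simp

text \<open>The bound holds at every point rather than almost everywhere, since the value
  \<open>\<psi> x\<close> itself is compared with averages of \<open>\<psi>\<close>.\<close>

definition bounded_borel :: "('a::euclidean_space \<Rightarrow> real) \<Rightarrow> bool" where
  "bounded_borel \<psi> \<longleftrightarrow> \<psi> \<in> borel_measurable borel \<and> (\<exists>M. \<forall>x. \<bar>\<psi> x\<bar> \<le> M)"

lemma bounded_borelI: "\<psi> \<in> borel_measurable borel \<Longrightarrow> (\<And>x. \<bar>\<psi> x\<bar> \<le> M) \<Longrightarrow> bounded_borel \<psi>"
  unfolding bounded_borel_def by blast

lemma bounded_borel_measurable: "bounded_borel \<psi> \<Longrightarrow> \<psi> \<in> borel_measurable borel"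
  unfolding bounded_borel_def by blast

lemma bounded_borelE:
  assumes "bounded_borel \<psi>"
  obtains M where "M \<ge> 0" "\<And>x. \<bar>\<psi> x\<bar> \<le> M"
proof -
  obtain M where M: "\<And>x. \<bar>\<psi> x\<bar> \<le> M" using assms unfolding bounded_borel_def by blast
  have "M \<ge> 0" using M[of 0] by linarith
  with M that show ?thesis by blast
qed

lemma bounded_borel_const[simp]: "bounded_borel (\<lambda>_. k)"
  by (intro bounded_borelI[of _ "\<bar>k\<bar>"]) auto

lemma bounded_borel_add:
  assumes "bounded_borel \<psi>" "bounded_borel \<xi>" shows "bounded_borel (\<lambda>x. \<psi> x + \<xi> x)"
proof -
  note [measurable] = assms[THEN bounded_borel_measurable]
  obtain M M' where "\<And>x. \<bar>\<psi> x\<bar> \<le> M" "\<And>x. \<bar>\<xi> x\<bar> \<le> M'" using assms by (metis bounded_borelE)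
  then show ?thesis
    by (intro bounded_borelI[of _ "M + M'"]) (measurable, metis abs_triangle_ineq add_mono order_trans)
qed

lemma bounded_borel_mult:
  assumes "bounded_borel \<psi>" "bounded_borel \<xi>" shows "bounded_borel (\<lambda>x. \<psi> x * \<xi> x)"
proof -
  note [measurable] = assms[THEN bounded_borel_measurable]
  obtain M M' where "M \<ge> 0" "\<And>x. \<bar>\<psi> x\<bar> \<le> M" "\<And>x. \<bar>\<xi> x\<bar> \<le> M'" using assms by (metis bounded_borelE)
  then show ?thesis
    by (intro bounded_borelI[of _ "M * M'"]) (measurable, simp add: abs_mult mult_mono)
qed

lemma bounded_borel_uminus: "bounded_borel \<psi> \<Longrightarrow> bounded_borel (\<lambda>x. - \<psi> x)"
  using bounded_borel_mult[of "\<lambda>_. -1" \<psi>] by simp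

lemma bounded_borel_diff:
  "bounded_borel \<psi> \<Longrightarrow> bounded_borel \<xi> \<Longrightarrow> bounded_borel (\<lambda>x. \<psi> x - \<xi> x)"
  using bounded_borel_add[of \<psi> "\<lambda>x. - \<xi> x"] bounded_borel_uminus[of \<xi>] by simp

text \<open>\<open>heat t\<close> is the classical heat semigroup at time \<open>t / 4\<close>.\<close>

definition heat :: "real \<Rightarrow> ('a::euclidean_space \<Rightarrow> real) \<Rightarrow> 'a \<Rightarrow> real" where
  "heat t \<psi> x = (LBINT z. gauss_kernel z * \<psi> (x + sqrt t *\<^sub>R z))"

lemma integrable_heat:
  assumes "bounded_borel \<psi>"
  shows "integrable lborel (\<lambda>z. gauss_kernel z * \<psi> (x + r *\<^sub>R z))"
proof -
  note [measurable] = bounded_borel_measurable[OF assms]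
  obtain M where M: "\<And>x. \<bar>\<psi> x\<bar> \<le> M" using assms by (metis bounded_borelE)
  show ?thesis
  proof (rule Bochner_Integration.integrable_bound)
    show "integrable lborel (\<lambda>z::'a. gauss_kernel z * M)" by simp
    show "AE z in lborel. norm (gauss_kernel z * \<psi> (x + r *\<^sub>R z)) \<le> norm (gauss_kernel z * M)"
      using M by (auto simp: abs_mult intro!: mult_left_mono order_trans[OF M])
  qed measurable
qed

lemma heat_0[simp]: "heat 0 \<psi> x = \<psi> x"
  by (simp add: heat_def)

lemma heat_const[simp]: "heat t (\<lambda>_. k) x = k"
  by (simp add: heat_def)

lemma heat_add:
  "bounded_borel \<psi> \<Longrightarrow> bounded_borel \<xi> \<Longrightarrow> heat t (\<lambda>x. \<psi> x + \<xi> x) x = heat t \<psi> x + heat t \<xi> x"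
  by (simp add: heat_def distrib_left integrable_heat)

lemma heat_cmult: "heat t (\<lambda>x. k * \<psi> x) x = k * heat t \<psi> x"
  by (simp add: heat_def mult.left_commute)

lemma heat_uminus: "heat t (\<lambda>x. - \<psi> x) x = - heat t \<psi> x"
  by (simp add: heat_def)

lemma heat_diff:
  "bounded_borel \<psi> \<Longrightarrow> bounded_borel \<xi> \<Longrightarrow> heat t (\<lambda>x. \<psi> x - \<xi> x) x = heat t \<psi> x - heat t \<xi> x"
  by (simp add: heat_def right_diff_distrib integrable_heat)

lemma heat_mono:
  assumes "bounded_borel \<psi>" "bounded_borel \<xi>" "\<And>x. \<psi> x \<le> \<xi> x"
  shows "heat t \<psi> x \<le> heat t \<xi> x"
  unfolding heat_def using assms
  by (intro integral_mono integrable_heat mult_left_mono) auto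

lemma heat_abs_le:
  assumes "bounded_borel \<psi>" "\<And>x. \<bar>\<psi> x\<bar> \<le> M"
  shows "\<bar>heat t \<psi> x\<bar> \<le> M"
proof -
  have "\<psi> y \<le> M" "- M \<le> \<psi> y" for y using assms(2)[of y] by linarith+
  then have "heat t \<psi> x \<le> heat t (\<lambda>_. M) x" "heat t (\<lambda>_. - M) x \<le> heat t \<psi> x"
    using assms by (intro heat_mono; simp)+
  then show ?thesis by simp
qed

lemma heat_measurable2:
  assumes [measurable]: "\<psi> \<in> borel_measurable borel"
  shows "(\<lambda>(t, x). heat t \<psi> x) \<in> borel_measurable (borel \<Otimes>\<^sub>M borel)"
  unfolding heat_def by measurable

lemma heat_measurable[measurable (raw)]:
  assumes [measurable]: "\<psi> \<in> borel_measurable borel" "f \<in> borel_measurable M" "g \<in> borel_measurable M"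
  shows "(\<lambda>w. heat (f w) \<psi> (g w)) \<in> borel_measurable M"
proof -
  have "(\<lambda>w. (f w, g w)) \<in> measurable M (borel \<Otimes>\<^sub>M borel)" by measurable
  from measurable_compose[OF this heat_measurable2[OF assms(1)]] show ?thesis by simp
qed

lemma bounded_borel_heat:
  assumes "bounded_borel \<psi>"
  shows "bounded_borel (heat t \<psi>)"
proof -
  note [measurable] = bounded_borel_measurable[OF assms]
  obtain M where M: "\<And>x. \<bar>\<psi> x\<bar> \<le> M" using assms by (metis bounded_borelE)
  show ?thesis
    using heat_abs_le[OF assms M] by (intro bounded_borelI[of _ M]) measurable
qed

text \<open>The time enters only through the argument of \<open>\<psi>\<close>, so dominated
  convergence sees no singularity at \<open>t0 = 0\<close>. The real \<open>sqrt\<close> is odd and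
  continuous on the whole line, hence negative times are covered too; this gives the continuity on
  \<open>UNIV\<close> that \<open>decaying\<close> asks for.\<close>

lemma heat_tendsto:
  assumes "bounded_borel \<psi>" "continuous_on UNIV \<psi>"
    and "t \<longlonglongrightarrow> t0" "x \<longlonglongrightarrow> x0"
  shows "(\<lambda>n. heat (t n) \<psi> (x n)) \<longlonglongrightarrow> heat t0 \<psi> x0"
proof -
  note [measurable] = bounded_borel_measurable[OF assms(1)]
  obtain M where M: "\<And>x. \<bar>\<psi> x\<bar> \<le> M" using assms by (metis bounded_borelE)
  show ?thesis
    unfolding heat_def
  proof (rule integral_dominated_convergence[where w = "\<lambda>z. gauss_kernel z * M"])
    show "AE z in lborel. (\<lambda>n. gauss_kernel z * \<psi> (x n + sqrt (t n) *\<^sub>R z)) \<longlonglongrightarrow> gauss_kernel z * \<psi> (x0 + sqrt t0 *\<^sub>R z)"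
    proof (intro always_eventually allI tendsto_mult tendsto_const)
      fix z
      have "(\<lambda>n. x n + sqrt (t n) *\<^sub>R z) \<longlonglongrightarrow> x0 + sqrt t0 *\<^sub>R z"
        using assms by (intro tendsto_intros)
      moreover have "isCont \<psi> (x0 + sqrt t0 *\<^sub>R z)"
        using assms(2) by (simp add: continuous_on_eq_continuous_at)
      ultimately show "(\<lambda>n. \<psi> (x n + sqrt (t n) *\<^sub>R z)) \<longlonglongrightarrow> \<psi> (x0 + sqrt t0 *\<^sub>R z)"
        using isCont_tendsto_compose by blast
    qed
    show "AE z in lborel. norm (gauss_kernel z * \<psi> (x n + sqrt (t n) *\<^sub>R z)) \<le> gauss_kernel z * M" for n
      using M by (auto simp: abs_mult intro!: mult_left_mono)
  qed auto
qed

text \<open>For fixed \<open>z\<close> the displacement \<open>sqrt (t n) *\<^sub>R z\<close>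
  converges, so the evaluation points still escape to infinity. The times vary with \<open>n\<close>
  because in the comparison proof each touching point comes with its own smoothing time.\<close>

lemma heat_tendsto_at_infinity:
  assumes "bounded_borel \<psi>" "(\<psi> \<longlongrightarrow> l) at_infinity"
    and "t \<longlonglongrightarrow> t0" "filterlim x at_infinity sequentially"
  shows "(\<lambda>n. heat (t n) \<psi> (x n)) \<longlonglongrightarrow> l"
proof -
  note [measurable] = bounded_borel_measurable[OF assms(1)]
  obtain M where M: "\<And>x. \<bar>\<psi> x\<bar> \<le> M" using assms by (metis bounded_borelE)
  have "(\<lambda>n. heat (t n) \<psi> (x n)) \<longlonglongrightarrow> (LBINT z. gauss_kernel (z::'a) * l)"
    unfolding heat_def
  proof (rule integral_dominated_convergence[where w = "\<lambda>z. gauss_kernel z * M"])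
    show "AE z in lborel. (\<lambda>n. gauss_kernel z * \<psi> (x n + sqrt (t n) *\<^sub>R z)) \<longlonglongrightarrow> gauss_kernel z * l"
    proof (intro always_eventually allI tendsto_mult tendsto_const)
      fix z :: 'a
      have "(\<lambda>n. sqrt (t n) *\<^sub>R z) \<longlonglongrightarrow> sqrt t0 *\<^sub>R z"
        by (intro tendsto_intros assms)
      then have "filterlim (\<lambda>n. sqrt (t n) *\<^sub>R z + x n) at_infinity sequentially"
        using assms(4) by (rule tendsto_add_filterlim_at_infinity)
      then show "(\<lambda>n. \<psi> (x n + sqrt (t n) *\<^sub>R z)) \<longlonglongrightarrow> l"
        using filterlim_compose[OF assms(2)] by (simp add: add.commute)
    qed
    show "AE z in lborel. norm (gauss_kernel z * \<psi> (x n + sqrt (t n) *\<^sub>R z)) \<le> gauss_kernel z * M" for n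
      using M by (auto simp: abs_mult intro!: mult_left_mono)
  qed auto
  then show ?thesis by simp
qed

section \<open>Density form of the heat flow, semigroup law and decay\<close>

definition heat_kernel :: "real \<Rightarrow> 'a::euclidean_space \<Rightarrow> real" where
  "heat_kernel t z = t powr (- real DIM('a) / 2) * gauss_kernel (z /\<^sub>R sqrt t)"

lemma heat_kernel_measurable[measurable]:
  "(\<lambda>(t, z). heat_kernel t (z::'a::euclidean_space)) \<in> borel_measurable (borel \<Otimes>\<^sub>M borel)"
  unfolding heat_kernel_def by measurable

lemma heat_kernel_nonneg[simp]: "heat_kernel t z \<ge> 0"
  unfolding heat_kernel_def by simp

lemma heat_kernel_uminus[simp]: "heat_kernel t (- z) = heat_kernel t z"
  unfolding heat_kernel_def by simp

lemma sqrt_power_DIM: "t > 0 \<Longrightarrow> sqrt t ^ n = t powr (real n / 2)"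
  by (simp add: powr_half_sqrt[symmetric] powr_powr powr_realpow[symmetric])

lemma heat_density:
  fixes \<psi> :: "'a::euclidean_space \<Rightarrow> real"
  assumes [measurable]: "\<psi> \<in> borel_measurable borel" and t: "t > 0"
  shows "heat t \<psi> x = (LBINT z. heat_kernel t z * \<psi> (x + z))"
proof -
  have "(LBINT z. heat_kernel t z * \<psi> (x + z)) =
    \<bar>sqrt t\<bar> ^ DIM('a) * (LBINT z. heat_kernel t (0 + sqrt t *\<^sub>R z) * \<psi> (x + (0 + sqrt t *\<^sub>R z)))"
    using t by (intro lborel_integral_affine) auto
  also have "\<dots> = \<bar>sqrt t\<bar> ^ DIM('a) * (LBINT z. t powr (- real DIM('a) / 2) * (gauss_kernel z * \<psi> (x + sqrt t *\<^sub>R z)))"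
    using t by (simp add: heat_kernel_def mult.assoc)
  also have "\<dots> = heat t \<psi> x"
    using t by (simp add: heat_def sqrt_power_DIM powr_minus field_simps)
  finally show ?thesis by simp
qed

lemma integrable_heat_kernel:
  assumes "t > 0" shows "integrable lborel (heat_kernel t :: 'a::euclidean_space \<Rightarrow> real)"
proof -
  have "integrable lborel (\<lambda>z::'a. gauss_kernel (0 + (1 / sqrt t) *\<^sub>R z))"
    using assms by (intro lborel_integrable_affine) auto
  then show ?thesis unfolding heat_kernel_def by (simp add: inverse_eq_divide)
qed

lemma integral_heat_kernel:
  assumes "t > 0" shows "(LBINT z. heat_kernel t (z::'a::euclidean_space)) = 1"
  using heat_density[OF _ assms, of "\<lambda>_. 1" "0::'a"] by simp

lemma heat_density_shift:
  fixes \<psi> :: "'a::euclidean_space \<Rightarrow> real"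
  assumes [measurable]: "\<psi> \<in> borel_measurable borel" and t: "t > 0"
  shows "heat t \<psi> x = (LBINT y. heat_kernel t (y - x) * \<psi> y)"
proof -
  have "(LBINT y. heat_kernel t (y - x) * \<psi> y) = \<bar>1\<bar> ^ DIM('a) * (LBINT z. heat_kernel t (x + 1 *\<^sub>R z - x) * \<psi> (x + 1 *\<^sub>R z))"
    by (intro lborel_integral_affine) auto
  then show ?thesis using heat_density[OF assms] by simp
qed

lemma heat_kernel_convolution:
  fixes y :: "'a::euclidean_space"
  assumes t: "t > 0" "\<tau> > 0"
  shows "(LBINT z. heat_kernel t z * heat_kernel \<tau> (y - z)) = heat_kernel (t + \<tau>) y"
proof -
  define G where "G = (LBINT y. exp (- (norm (y::'a))\<^sup>2))"
  have G: "G > 0" unfolding G_def by (rule gauss_mass_pos)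
  define n where "n = real DIM('a) / 2"
  \<comment> \<open>Completing the square in \<open>z\<close>: the product of the two Gaussians is a
    Gaussian in \<open>y\<close> at time \<open>t + \<tau>\<close> times a Gaussian in
    \<open>z\<close> centred at \<open>m\<close> at time \<open>c\<close>, and the mass of the
    latter does not depend on \<open>y\<close>.\<close>
  define m where "m = (t / (t + \<tau>)) *\<^sub>R y"
  define c where "c = t * \<tau> / (t + \<tau>)"
  have c: "c > 0" using t by (simp add: c_def)
  have K: "heat_kernel r z = r powr - n * exp (- (norm z)\<^sup>2 / r) / G" if "r > 0" for r and z :: 'a
    using that by (simp add: heat_kernel_def gauss_kernel_def n_def G_def power_divide power_mult_distrib field_simps)
  have sq: "(norm z)\<^sup>2 / t + (norm (y - z))\<^sup>2 / \<tau> = (norm y)\<^sup>2 / (t + \<tau>) + (norm (z - m))\<^sup>2 / c" for z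
  proof -
    define A B C where "A = y \<bullet> y" and "B = y \<bullet> z" and "C = z \<bullet> z"
    have 1: "(norm z)\<^sup>2 = C" "(norm y)\<^sup>2 = A" "(norm (y - z))\<^sup>2 = A - 2 * B + C"
      by (auto simp: A_def B_def C_def power2_norm_eq_inner inner_diff inner_commute algebra_simps)
    have 2: "(norm (z - m))\<^sup>2 = C - 2 * (t / (t + \<tau>)) * B + (t / (t + \<tau>))\<^sup>2 * A"
      unfolding power2_norm_eq_inner A_def B_def C_def m_def
      by (simp add: inner_diff inner_commute algebra_simps power2_eq_square)
    have "t + \<tau> \<noteq> 0" "t \<noteq> 0" "\<tau> \<noteq> 0" using t by auto
    then show ?thesis unfolding 1 2 c_def
      by (simp add: divide_simps power2_eq_square) (simp add: algebra_simps)
  qed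
  let ?D = "t powr - n * \<tau> powr - n / G\<^sup>2 * exp (- (norm y)\<^sup>2 / (t + \<tau>))"
  have "(LBINT z. heat_kernel t z * heat_kernel \<tau> (y - z)) = (LBINT z. ?D * exp (- (norm (z - m))\<^sup>2 / c))"
  proof (intro Bochner_Integration.integral_cong refl)
    fix z
    have "exp (- (norm z)\<^sup>2 / t) * exp (- (norm (y - z))\<^sup>2 / \<tau>) = exp (- (norm y)\<^sup>2 / (t + \<tau>)) * exp (- (norm (z - m))\<^sup>2 / c)"
      using sq[of z] by (simp add: exp_add[symmetric])
    then show "heat_kernel t z * heat_kernel \<tau> (y - z) = ?D * exp (- (norm (z - m))\<^sup>2 / c)"
      using t by (simp add: K power2_eq_square mult_ac)
  qed
  also have "\<dots> = ?D * (LBINT z. exp (- (norm (z - m))\<^sup>2 / c))"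
    by simp
  also have "(LBINT z. exp (- (norm (z - m))\<^sup>2 / c)) = \<bar>sqrt c\<bar> ^ DIM('a) * (LBINT z. exp (- (norm (m + sqrt c *\<^sub>R z - m))\<^sup>2 / c))"
    using c by (intro lborel_integral_affine) auto
  also have "\<dots> = c powr n * G"
    using c by (simp add: G_def power_mult_distrib sqrt_power_DIM n_def)
  also have "?D * (c powr n * G) = heat_kernel (t + \<tau>) y"
    using t G by (simp add: K c_def powr_mult powr_divide powr_minus field_simps power2_eq_square)
  finally show ?thesis .
qed

text \<open>Fubini moves the convolution onto the kernels; the bound on \<open>\<psi>\<close>
  supplies the integrability. Zero times are treated apart because \<open>heat_kernel\<close>
  represents \<open>heat\<close> only at positive times.\<close>

lemma heat_heat:
  fixes \<psi> :: "'a::euclidean_space \<Rightarrow> real"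
  assumes bb: "bounded_borel \<psi>" and t: "t \<ge> 0" "\<tau> \<ge> 0"
  shows "heat t (heat \<tau> \<psi>) x = heat (t + \<tau>) \<psi> x"
proof (cases "t = 0 \<or> \<tau> = 0")
  case True
  moreover have "heat 0 \<psi> = \<psi>" by (rule ext) simp
  ultimately show ?thesis by auto
next
  case False
  with t have t: "t > 0" "\<tau> > 0" by auto
  note [measurable] = bounded_borel_measurable[OF bb]
  obtain M where M: "\<And>x. \<bar>\<psi> x\<bar> \<le> M" "M \<ge> 0" using bb by (metis bounded_borelE)
  have sh: "integrable lborel (\<lambda>w::'a. heat_kernel \<tau> (w - z))" for z
    using lborel_integrable_affine[OF integrable_heat_kernel[OF t(2)], of 1 "- z"] by simp
  have sh1: "(LBINT w. heat_kernel \<tau> ((w::'a) - z)) = 1" for z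
    using heat_density_shift[OF _ t(2), of "\<lambda>_. 1" z] by simp
  let ?f = "\<lambda>z w. heat_kernel t z * (heat_kernel \<tau> (w - z) * \<psi> (x + w))"
  have m1: "(\<lambda>(z, w). ?f z w) \<in> borel_measurable (lborel \<Otimes>\<^sub>M lborel)"
    by measurable
  have i1: "integrable lborel (\<lambda>w. ?f z w)" for z
  proof (rule Bochner_Integration.integrable_bound)
    show "integrable lborel (\<lambda>w. heat_kernel t z * (heat_kernel \<tau> (w - z) * M))" using sh by auto
    show "AE w in lborel. norm (?f z w) \<le> norm (heat_kernel t z * (heat_kernel \<tau> (w - z) * M))"
      using M by (auto simp: abs_mult intro!: mult_left_mono)
  qed measurable
  have int: "integrable (lborel \<Otimes>\<^sub>M lborel) (\<lambda>(z, w). ?f z w)"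
  proof (rule lborel_pair.Fubini_integrable[OF m1])
    show "integrable lborel (\<lambda>z. LBINT w. norm (case (z, w) of (z, w) \<Rightarrow> ?f z w))"
    proof (rule Bochner_Integration.integrable_bound)
      show "integrable lborel (\<lambda>z::'a. heat_kernel t z * M)" using integrable_heat_kernel[OF t(1)] by auto
      show "AE z in lborel. norm (LBINT w. norm (case (z, w) of (z, w) \<Rightarrow> ?f z w)) \<le> norm (heat_kernel t z * M)" (is "AE z in _. ?P z")
      proof (intro always_eventually allI)
        fix z
        have "(LBINT w. norm (?f z w)) \<le> (LBINT w. heat_kernel t z * (heat_kernel \<tau> (w - z) * M))"
          using M sh i1[of z] by (intro integral_mono integrable_norm) (auto simp: abs_mult intro!: mult_left_mono)
        also have "\<dots> = heat_kernel t z * M" using sh1[of z] by simp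
        finally show "?P z"
          using M by simp
      qed
    qed measurable
  qed (use i1 in simp)
  have "heat t (heat \<tau> \<psi>) x = (LBINT z. heat_kernel t z * heat \<tau> \<psi> (x + z))"
    using t by (intro heat_density) auto
  also have "\<dots> = (LBINT z. (LBINT w. ?f z w))"
  proof (intro Bochner_Integration.integral_cong refl)
    fix z
    have "heat \<tau> \<psi> (x + z) = (LBINT w. heat_kernel \<tau> (w - (x + z)) * \<psi> w)"
      using t by (intro heat_density_shift) auto
    also have "\<dots> = \<bar>1\<bar> ^ DIM('a) * (LBINT w. heat_kernel \<tau> (x + 1 *\<^sub>R w - (x + z)) * \<psi> (x + 1 *\<^sub>R w))"
      by (intro lborel_integral_affine) auto
    finally show "heat_kernel t z * heat \<tau> \<psi> (x + z) = (LBINT w. ?f z w)"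
      by simp
  qed
  also have "\<dots> = (LBINT w. (LBINT z. ?f z w))"
    using lborel_pair.Fubini_integral[OF int] by simp
  also have "\<dots> = (LBINT w. (LBINT z. heat_kernel t z * heat_kernel \<tau> (w - z)) * \<psi> (x + w))"
    by (simp add: mult.assoc[symmetric])
  also have "\<dots> = (LBINT w. heat_kernel (t + \<tau>) w * \<psi> (x + w))"
    using t by (simp add: heat_kernel_convolution)
  also have "\<dots> = heat (t + \<tau>) \<psi> x"
    using t by (intro heat_density[symmetric]) auto
  finally show ?thesis .
qed

text \<open>Parabolic scaling: \<open>norm (x + sqrt t *\<^sub>R z)\<close> is \<open>sqrt t\<close>
  times the distance from \<open>z\<close> to \<open>- (x /\<^sub>R sqrt t)\<close>, which extracts
  the factor \<open>t powr (- \<beta>)\<close>. The Gaussian average of the remaining power is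
  bounded uniformly in that centre, because \<open>2 * \<beta> < N\<close> makes the singularity
  integrable.\<close>

lemma heat_decay:
  fixes \<beta> :: real
  assumes \<beta>: "0 \<le> \<beta>" "\<beta> < real DIM('a) / 2"
  shows "\<exists>C\<ge>0. \<forall>(\<psi>::'a::euclidean_space \<Rightarrow> real) M t x. bounded_borel \<psi> \<longrightarrow>
     (\<forall>y. \<bar>\<psi> y\<bar> \<le> M * (1 + norm y) powr (- (2 * \<beta>))) \<longrightarrow> t > 0 \<longrightarrow> \<bar>heat t \<psi> x\<bar> \<le> C * M * t powr (- \<beta>)"
proof -
  define G where "G = (LBINT y. exp (- (norm (y::'a))\<^sup>2))"
  have G: "G > 0" unfolding G_def by (rule gauss_mass_pos)
  let ?k = "\<lambda>z::'a. indicator (ball 0 1) z * norm z powr (- (2 * \<beta>))"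
  \<comment> \<open>The first summand covers the unit ball around the singularity, where the
    Gaussian kernel is at most \<open>1 / G\<close>; the summand 1 covers the complement, where the
    power is at most 1 and the kernel has mass at most 1.\<close>
  define C where "C = (LBINT z. ?k z) / G + 1"
  have ki: "integrable lborel ?k" using \<beta> by (intro integrable_norm_powr_ball) auto
  have C: "C \<ge> 0" unfolding C_def using G by (auto intro!: add_nonneg_nonneg divide_nonneg_pos)
  have "\<bar>heat t \<psi> x\<bar> \<le> C * M * t powr (- \<beta>)"
    if bb: "bounded_borel \<psi>" and dec: "\<And>y. \<bar>\<psi> y\<bar> \<le> M * (1 + norm y) powr (- (2 * \<beta>))" and t: "t > 0"
    for \<psi> :: "'a \<Rightarrow> real" and M t x
  proof -
    have "0 \<le> M * (1 + norm (0::'a)) powr (- (2 * \<beta>))" using dec[of 0] by (smt (verit))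
    then have M: "M \<ge> 0" by simp
    let ?x = "x /\<^sub>R sqrt t"
    have ks: "integrable lborel (\<lambda>z. ?k (?x + 1 *\<^sub>R z))" "(LBINT z. ?k (?x + 1 *\<^sub>R z)) = (LBINT z. ?k z)"
      using lborel_integrable_affine[OF ki, of 1 ?x] lborel_integral_affine[of ?k 1 ?x] ki by simp_all
    have "\<bar>heat t \<psi> x\<bar> \<le> (LBINT z. norm (gauss_kernel z * \<psi> (x + sqrt t *\<^sub>R z)))"
      unfolding heat_def using integral_norm_bound[of lborel "\<lambda>z. gauss_kernel z * \<psi> (x + sqrt t *\<^sub>R z)"] by simp
    also have "\<dots> \<le> (LBINT z. M * t powr (- \<beta>) * (?k (?x + 1 *\<^sub>R z) / G + gauss_kernel z))"
    proof (rule integral_mono_AE)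
      show "integrable lborel (\<lambda>z. norm (gauss_kernel z * \<psi> (x + sqrt t *\<^sub>R z)))"
        by (intro integrable_norm integrable_heat bb)
      show "integrable lborel (\<lambda>z. M * t powr (- \<beta>) * (?k (?x + 1 *\<^sub>R z) / G + gauss_kernel z))"
        using ks(1) by (intro integrable_mult_right Bochner_Integration.integrable_add integrable_divide) auto
      \<comment> \<open>At the excluded point the base of the singular power is 0, and
        \<open>powr\<close> returns 0 there, so the pointwise bound by that power would
        fail.\<close>
      have "AE z in lborel. z \<noteq> - ?x" by (rule AE_lborel_singleton)
      then show "AE z in lborel. norm (gauss_kernel z * \<psi> (x + sqrt t *\<^sub>R z)) \<le> M * t powr (- \<beta>) * (?k (?x + 1 *\<^sub>R z) / G + gauss_kernel z)"
      proof eventually_elim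
        fix z assume z: "z \<noteq> - ?x"
        let ?y = "?x + 1 *\<^sub>R z"
        have y0: "?y \<noteq> 0" using z by (simp add: eq_neg_iff_add_eq_0 add.commute)
        have "x + sqrt t *\<^sub>R z = sqrt t *\<^sub>R ?y" using t by (simp add: scaleR_add_right)
        then have ny: "norm (x + sqrt t *\<^sub>R z) = sqrt t * norm ?y" using t by simp
        have "(1 + norm (x + sqrt t *\<^sub>R z)) powr (- (2 * \<beta>)) \<le> (sqrt t * norm ?y) powr (- (2 * \<beta>))"
          unfolding ny using \<beta> t y0 by (intro powr_mono2') (auto simp del: scaleR_one)
        also have "\<dots> = t powr (- \<beta>) * norm ?y powr (- (2 * \<beta>))"
          using t by (simp add: powr_mult powr_half_sqrt[symmetric] powr_powr)
        finally have 1: "(1 + norm (x + sqrt t *\<^sub>R z)) powr (- (2 * \<beta>)) \<le> t powr (- \<beta>) * norm ?y powr (- (2 * \<beta>))" .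
        have gk: "gauss_kernel z \<le> 1 / G"
          unfolding gauss_kernel_def G_def[symmetric] using G by (intro divide_right_mono) auto
        have 2: "gauss_kernel z * norm ?y powr (- (2 * \<beta>)) \<le> ?k ?y / G + gauss_kernel z"
        proof (cases "norm ?y < 1")
          case True
          have "gauss_kernel z * norm ?y powr (- (2 * \<beta>)) \<le> 1 / G * norm ?y powr (- (2 * \<beta>))"
            using gk by (intro mult_right_mono) auto
          also have "\<dots> = ?k ?y / G" using True by (simp add: indicator_def)
          finally show ?thesis using gauss_kernel_nonneg[of z] by linarith
        next
          case False
          then have "norm ?y powr (- (2 * \<beta>)) \<le> 1 powr (- (2 * \<beta>))"
            using \<beta> by (intro powr_mono2') auto
          then have "gauss_kernel z * norm ?y powr (- (2 * \<beta>)) \<le> gauss_kernel z * 1"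
            by (intro mult_left_mono) auto
          moreover have "?k ?y / G \<ge> 0" using G by auto
          ultimately show ?thesis by linarith
        qed
        have "norm (gauss_kernel z * \<psi> (x + sqrt t *\<^sub>R z)) \<le> gauss_kernel z * (M * (1 + norm (x + sqrt t *\<^sub>R z)) powr (- (2 * \<beta>)))"
          using dec by (simp add: abs_mult mult_left_mono)
        also have "\<dots> \<le> gauss_kernel z * (M * (t powr (- \<beta>) * norm ?y powr (- (2 * \<beta>))))"
          using 1 M by (intro mult_left_mono) auto
        also have "\<dots> = M * t powr (- \<beta>) * (gauss_kernel z * norm ?y powr (- (2 * \<beta>)))"
          by (simp add: mult_ac)
        also have "\<dots> \<le> M * t powr (- \<beta>) * (?k ?y / G + gauss_kernel z)"
          using 2 M by (intro mult_left_mono) auto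
        finally show "norm (gauss_kernel z * \<psi> (x + sqrt t *\<^sub>R z)) \<le> M * t powr (- \<beta>) * (?k ?y / G + gauss_kernel z)" .
      qed
    qed
    also have "\<dots> = M * t powr (- \<beta>) * C"
    proof -
      have "(LBINT z. (?k (?x + 1 *\<^sub>R z) / G + gauss_kernel z)) = C"
        unfolding C_def using ks by (subst Bochner_Integration.integral_add) auto
      then show ?thesis by (subst integral_mult_right_zero) simp
    qed
    finally show ?thesis by (simp add: mult_ac)
  qed
  with C show ?thesis by blast
qed

section \<open>The Marchaud fractional derivative\<close>

lemma has_bochner_integral_indicator_of_has_integral:
  fixes f :: "'a::euclidean_space \<Rightarrow> real"
  assumes [measurable]: "f \<in> borel_measurable borel" "S \<in> sets borel"
    and nn: "\<And>x. x \<in> S \<Longrightarrow> 0 \<le> f x" and hi: "(f has_integral I) S"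
  shows "has_bochner_integral lborel (\<lambda>x. indicator S x * f x) I"
proof (rule has_bochner_integral_nn_integral)
  show "0 \<le> I" using has_integral_nonneg[OF hi nn] .
  have "(\<integral>\<^sup>+x. ennreal (indicator S x * f x) \<partial>lborel) = (\<integral>\<^sup>+x. ennreal (f x) * indicator S x \<partial>lborel)"
    by (intro nn_integral_cong) (auto simp: indicator_def)
  then show "(\<integral>\<^sup>+x. ennreal (indicator S x * f x) \<partial>lborel) = ennreal I"
    using nn_integral_has_integral_indicator[OF assms] by simp
qed (use nn in \<open>auto simp: indicator_def\<close>)

lemma has_bochner_integral_powr_0_1:
  assumes "p > -1"
  shows "has_bochner_integral lborel (\<lambda>t::real. indicator {0..1} t * t powr p) (1 / (p + 1))"
  using has_integral_powr_from_0[OF assms, of 1]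
  by (intro has_bochner_integral_indicator_of_has_integral) auto

lemma has_bochner_integral_powr_inf:
  assumes "p < -1" "a > 0"
  shows "has_bochner_integral lborel (\<lambda>t::real. indicator {a..} t * t powr p) (- (a powr (p + 1) / (p + 1)))"
  using has_integral_powr_to_inf[OF assms]
  by (intro has_bochner_integral_indicator_of_has_integral) auto

lemma integrable_min_powr:
  fixes s \<beta> :: real
  assumes "0 < s" "s < \<beta>"
  shows "integrable lborel (\<lambda>\<tau>::real. indicator {0<..} \<tau> * (min 1 (\<tau> powr - \<beta>) * \<tau> powr (s - 1)))"
proof (rule Bochner_Integration.integrable_bound)
  show "integrable lborel (\<lambda>\<tau>::real. indicator {0..1} \<tau> * \<tau> powr (s - 1) + indicator {1..} \<tau> * \<tau> powr (s - 1 - \<beta>))"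
    using has_bochner_integral_powr_0_1[of "s - 1"] has_bochner_integral_powr_inf[of "s - 1 - \<beta>" 1] assms
    by (intro Bochner_Integration.integrable_add) (auto simp: has_bochner_integral_iff)
  show "AE \<tau> in lborel. norm (indicator {0<..} \<tau> * (min 1 (\<tau> powr - \<beta>) * \<tau> powr (s - 1)))
    \<le> norm (indicator {0..1} \<tau> * \<tau> powr (s - 1) + indicator {1..} \<tau> * \<tau> powr (s - 1 - \<beta>) :: real)" (is "AE \<tau> in _. ?P \<tau>")
  proof (intro always_eventually allI)
    fix \<tau> :: real
    consider "\<tau> \<le> 0" | "0 < \<tau>" "\<tau> < 1" | "\<tau> \<ge> 1" by linarith
    then show "?P \<tau>"
    proof cases
      case 2
      have "min 1 (\<tau> powr - \<beta>) * \<tau> powr (s - 1) \<le> 1 * \<tau> powr (s - 1)"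
        by (intro mult_right_mono) auto
      with 2 show ?thesis by (simp add: abs_mult)
    next
      case 3
      have "min 1 (\<tau> powr - \<beta>) * \<tau> powr (s - 1) \<le> \<tau> powr - \<beta> * \<tau> powr (s - 1)"
        by (intro mult_right_mono) auto
      also have "\<dots> = \<tau> powr (s - 1 - \<beta>)" by (simp add: powr_add[symmetric])
      finally show ?thesis using 3 by (auto simp: abs_mult indicator_def)
    qed auto
  qed
qed measurable

text \<open>Truncating the Marchaud derivative of a fractional integral of \<open>F\<close> at \<open>\<delta>\<close> yields the average of
  \<open>F (\<delta> u)\<close> against this kernel.\<close>

definition marchaud_kernel :: "real \<Rightarrow> real \<Rightarrow> real" where
  "marchaud_kernel s u = indicator {0<..} u * ((u powr s - max (u - 1) 0 powr s) / (s * u))"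

definition marchaud_const :: "real \<Rightarrow> real" where
  "marchaud_const s = (LBINT u. marchaud_kernel s u)"

lemma marchaud_kernel_measurable[measurable]: "marchaud_kernel s \<in> borel_measurable borel"
  unfolding marchaud_kernel_def by measurable

lemma marchaud_kernel_nonneg:
  assumes "0 < s" shows "marchaud_kernel s u \<ge> 0"
proof (cases "u > 0")
  case True
  then have "max (u - 1) 0 powr s \<le> u powr s" using assms by (intro powr_mono2) auto
  with True assms show ?thesis by (auto simp: marchaud_kernel_def indicator_def)
qed (auto simp: marchaud_kernel_def)

text \<open>On the unit interval the kernel is \<open>u powr (s - 1) / s\<close>. For
  \<open>u \<ge> 1\<close> the two powers cancel to leading order: with \<open>r = 1 - 1 / u\<close>
  one has \<open>r \<le> r powr s\<close>, hence
  \<open>u powr s - (u - 1) powr s \<le> u powr (s - 1)\<close>, and the kernel is at most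
  \<open>u powr (s - 2) / s\<close>, integrable since \<open>s < 1\<close>.\<close>

lemma integrable_marchaud_kernel:
  assumes "0 < s" "s < 1" shows "integrable lborel (marchaud_kernel s)"
proof (rule Bochner_Integration.integrable_bound)
  show "integrable lborel (\<lambda>u::real. (1 / s) * (indicator {0..1} u * u powr (s - 1) + indicator {1..} u * u powr (s - 2)))"
    using has_bochner_integral_powr_0_1[of "s - 1"] has_bochner_integral_powr_inf[of "s - 2" 1] assms
    by (intro integrable_mult_right Bochner_Integration.integrable_add) (auto simp: has_bochner_integral_iff)
  show "AE u in lborel. norm (marchaud_kernel s u)
    \<le> norm ((1 / s) * (indicator {0..1} u * u powr (s - 1) + indicator {1..} u * u powr (s - 2)))" (is "AE u in _. ?P u")
  proof (intro always_eventually allI)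
    fix u :: real
    consider "u \<le> 0" | "0 < u" "u < 1" | "u \<ge> 1" by linarith
    then show "?P u"
    proof cases
      case 2
      then have "marchaud_kernel s u = (1 / s) * u powr (s - 1)"
        using assms by (simp add: marchaud_kernel_def powr_diff max_def)
      with 2 assms show ?thesis by simp
    next
      case 3
      define r where "r = 1 - 1 / u"
      have r: "0 \<le> r" "r \<le> 1" using 3 by (auto simp: r_def)
      have "r powr 1 \<le> r powr s" using r assms by (intro powr_mono') auto
      then have "u powr s * r \<le> u powr s * r powr s" using r by (intro mult_left_mono) auto
      also have "\<dots> = (u * r) powr s" using r 3 by (simp add: powr_mult)
      also have "u * r = u - 1" using 3 by (simp add: r_def field_simps)
      finally have "u powr s - max (u - 1) 0 powr s \<le> u powr s / u"
        using 3 by (simp add: r_def field_simps max_def)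
      then have "(u powr s - max (u - 1) 0 powr s) / (s * u) \<le> (u powr s / u) / (s * u)"
        using 3 assms by (intro divide_right_mono) auto
      also have "\<dots> = (1 / s) * u powr (s - 2)"
        using 3 by (simp add: powr_diff powr_numeral power2_eq_square)
      finally have "marchaud_kernel s u \<le> (1 / s) * u powr (s - 2)"
        using 3 by (simp add: marchaud_kernel_def)
      moreover have "u powr (s - 2) \<le> indicator {0..1} u * u powr (s - 1) + indicator {1..} u * u powr (s - 2)"
        using 3 by (simp add: indicator_def)
      then have "(1 / s) * u powr (s - 2) \<le> (1 / s) * (indicator {0..1} u * u powr (s - 1) + indicator {1..} u * u powr (s - 2))"
        using assms by (intro mult_left_mono) auto
      ultimately show ?thesis using marchaud_kernel_nonneg[of s u] assms by simp
    qed (auto simp: marchaud_kernel_def)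
  qed
qed measurable

lemma marchaud_const_pos:
  assumes "0 < s" "s < 1" shows "marchaud_const s > 0"
proof -
  have "marchaud_const s \<noteq> 0"
  proof
    assume "marchaud_const s = 0"
    then have "AE u in lborel. marchaud_kernel s u = 0"
      unfolding marchaud_const_def using integrable_marchaud_kernel[OF assms] marchaud_kernel_nonneg assms
      by (subst (asm) integral_nonneg_eq_0_iff_AE) auto
    then have "AE u in lborel. u \<notin> {0<..<1::real}"
      by eventually_elim (use assms in \<open>auto simp: marchaud_kernel_def max_def\<close>)
    then have "emeasure lborel {0<..<1::real} = 0"
    proof (subst (asm) AE_iff_measurable)
      show "{u \<in> space lborel. \<not> u \<notin> {0<..<1::real}} = {0<..<1}" by auto
    qed auto
    then show False by simp
  qed
  moreover have "marchaud_const s \<ge> 0"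
    unfolding marchaud_const_def using marchaud_kernel_nonneg assms by (intro Bochner_Integration.integral_nonneg) auto
  ultimately show ?thesis by linarith
qed

text \<open>The primitive is elementary: \<open>((\<tau> - t) / t) powr s\<close> has derivative
  \<open>- s * \<tau> * (\<tau> - t) powr (s - 1) * t powr (- 1 - s)\<close> in \<open>t\<close>.
  The \<open>max\<close> covers \<open>\<tau> \<le> \<delta>\<close>, where the interval is
  empty.\<close>

lemma has_bochner_integral_marchaud_inner:
  fixes s \<delta> \<tau> :: real
  assumes s: "0 < s" and \<delta>: "\<delta> > 0"
  shows "has_bochner_integral lborel (\<lambda>t. indicator {\<delta><..<\<tau>} t * ((\<tau> - t) powr (s - 1) * t powr (- 1 - s)))
     (max (\<tau> - \<delta>) 0 powr s / (s * \<tau> * \<delta> powr s))"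
proof (cases "\<tau> > \<delta>")
  case False
  then have "{\<delta><..<\<tau>} = {}" "max (\<tau> - \<delta>) 0 = 0" by auto
  then show ?thesis using s by (simp add: has_bochner_integral_zero)
next
  case True
  then have \<tau>: "\<tau> > 0" using \<delta> by simp
  let ?f = "\<lambda>t. (\<tau> - t) powr (s - 1) * t powr (- 1 - s)"
  define P where "P t = - (1 / (s * \<tau>)) * ((\<tau> - t) / t) powr s" for t
  \<comment> \<open>Differentiability is used in the interior only, since for \<open>s < 1\<close>
    the integrand blows up at \<open>t = \<tau>\<close>.\<close>
  have "(?f has_integral (P \<tau> - P \<delta>)) {\<delta>..\<tau>}"
  proof (rule fundamental_theorem_of_calculus_interior)
    show "continuous_on {\<delta>..\<tau>} P"
      unfolding P_def using \<delta> s by (intro continuous_intros continuous_on_powr') auto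
    fix t assume t: "t \<in> {\<delta><..<\<tau>}"
    then have t0: "t > 0" "\<tau> - t > 0" using \<delta> by auto
    have "(P has_real_derivative - (1 / (s * \<tau>)) * (s * ((\<tau> - t) / t) powr (s - 1) * ((- 1 * t - (\<tau> - t) * 1) / (t * t)))) (at t)"
      unfolding P_def using t0 by (auto intro!: derivative_eq_intros)
    also have "- (1 / (s * \<tau>)) * (s * ((\<tau> - t) / t) powr (s - 1) * ((- 1 * t - (\<tau> - t) * 1) / (t * t))) = ?f t"
    proof -
      have "t powr (- 1 - s) * (t powr (s - 1) * t powr 2) = 1"
        unfolding powr_add[symmetric] using t0 by simp
      then have "t powr (- 1 - s) = 1 / (t powr (s - 1) * (t * t))"
        using t0 by (simp add: field_simps powr_numeral power2_eq_square)
      then show ?thesis using t0 s \<tau> by (simp add: powr_divide divide_simps)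
    qed
    finally show "(P has_vector_derivative ?f t) (at t)"
      by (simp add: has_real_derivative_iff_has_vector_derivative)
  qed (use True in auto)
  moreover have "P \<tau> - P \<delta> = max (\<tau> - \<delta>) 0 powr s / (s * \<tau> * \<delta> powr s)"
    using True \<delta> s by (simp add: P_def powr_divide)
  ultimately have "(?f has_integral (max (\<tau> - \<delta>) 0 powr s / (s * \<tau> * \<delta> powr s))) {\<delta><..<\<tau>}"
    by (simp add: has_integral_Icc_iff_Ioo)
  then show ?thesis
    by (intro has_bochner_integral_indicator_of_has_integral) auto
qed

text \<open>The right-sided Liouville (Weyl) integral of order \<open>s\<close>, without its factor
  \<open>1 / Gamma s\<close>.\<close>

definition frac_int :: "real \<Rightarrow> (real \<Rightarrow> real) \<Rightarrow> real \<Rightarrow> real" where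
  "frac_int s F t = (LBINT \<tau>. indicator {0<..} \<tau> * (F (t + \<tau>) * \<tau> powr (s - 1)))"

text \<open>An abstraction of \<open>t \<mapsto> heat (e + t) q x\<close>. Boundedness makes
  \<open>F (t + \<tau>) * \<tau> powr (s - 1)\<close> integrable near \<open>\<tau> = 0\<close>,
  since \<open>s > 0\<close>; the decay makes it integrable at infinity, since
  \<open>\<beta> > s\<close>.\<close>

locale decaying =
  fixes s \<beta> M :: real and F :: "real \<Rightarrow> real"
  assumes s: "0 < s" "s < 1" and \<beta>: "s < \<beta>"
    and F_cont: "continuous_on UNIV F"
    and F_bound: "\<And>\<tau>. \<tau> \<ge> 0 \<Longrightarrow> \<bar>F \<tau>\<bar> \<le> M"
    and F_decay: "\<And>\<tau>. \<tau> > 0 \<Longrightarrow> \<bar>F \<tau>\<bar> \<le> M * \<tau> powr - \<beta>"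
begin

lemma F_measurable[measurable]: "F \<in> borel_measurable borel"
  using F_cont by (rule borel_measurable_continuous_onI)

lemma M_nonneg: "M \<ge> 0"
  using F_bound[of 0] by linarith

lemma F_min: "\<tau> > 0 \<Longrightarrow> \<bar>F \<tau>\<bar> \<le> M * min 1 (\<tau> powr - \<beta>)"
  using F_bound[of \<tau>] F_decay[of \<tau>] by (simp add: min_def)

lemma F_min': "\<tau> > 0 \<Longrightarrow> t \<ge> 0 \<Longrightarrow> \<bar>F (t + \<tau>)\<bar> \<le> M * min 1 (\<tau> powr - \<beta>)"
proof -
  assume a: "\<tau> > 0" "t \<ge> 0"
  have "(t + \<tau>) powr - \<beta> \<le> \<tau> powr - \<beta>" using a s \<beta> by (intro powr_mono2') auto
  then have "M * min 1 ((t + \<tau>) powr - \<beta>) \<le> M * min 1 (\<tau> powr - \<beta>)"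
    using M_nonneg by (intro mult_left_mono) auto
  then show ?thesis using F_min[of "t + \<tau>"] a by linarith
qed

lemma frac_int_integrand_le:
  assumes "t \<ge> 0"
  shows "\<bar>indicator {0<..} \<tau> * (F (t + \<tau>) * \<tau> powr (s - 1))\<bar>
    \<le> M * (indicator {0<..} \<tau> * (min 1 (\<tau> powr - \<beta>) * \<tau> powr (s - 1)))"
proof (cases "\<tau> > 0")
  case True
  then have "\<bar>F (t + \<tau>)\<bar> * \<tau> powr (s - 1) \<le> M * min 1 (\<tau> powr - \<beta>) * \<tau> powr (s - 1)"
    using F_min'[OF True assms] by (intro mult_right_mono) auto
  then show ?thesis using True by (simp add: abs_mult)
qed simp

lemma integrable_frac_int:
  assumes "t \<ge> 0"
  shows "integrable lborel (\<lambda>\<tau>. indicator {0<..} \<tau> * (F (t + \<tau>) * \<tau> powr (s - 1)))"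
proof (rule Bochner_Integration.integrable_bound)
  show "integrable lborel (\<lambda>\<tau>. M * (indicator {0<..} \<tau> * (min 1 (\<tau> powr - \<beta>) * \<tau> powr (s - 1))))"
    using integrable_min_powr[OF s(1) \<beta>] by simp
  show "AE \<tau> in lborel. norm (indicator {0<..} \<tau> * (F (t + \<tau>) * \<tau> powr (s - 1)))
    \<le> norm (M * (indicator {0<..} \<tau> * (min 1 (\<tau> powr - \<beta>) * \<tau> powr (s - 1))))"
    using order_trans[OF frac_int_integrand_le[OF assms] abs_ge_self] by simp
qed measurable

lemma frac_int_shift:
  assumes "t \<ge> 0"
  shows "frac_int s F t = (LBINT \<tau>. indicator {t<..} \<tau> * (F \<tau> * (\<tau> - t) powr (s - 1)))"
proof -
  have "(LBINT \<tau>. indicator {t<..} \<tau> * (F \<tau> * (\<tau> - t) powr (s - 1))) =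
    \<bar>1\<bar> * (LBINT \<tau>. indicator {t<..} (t + 1 * \<tau>) * (F (t + 1 * \<tau>) * (t + 1 * \<tau> - t) powr (s - 1)))"
    using lborel_integral_real_affine[of 1 "\<lambda>\<tau>. indicator {t<..} \<tau> * (F \<tau> * (\<tau> - t) powr (s - 1))" t] by simp
  also have "\<dots> = frac_int s F t"
    unfolding frac_int_def by (auto intro!: Bochner_Integration.integral_cong simp: indicator_def)
  finally show ?thesis by simp
qed

text \<open>The terms with \<open>frac_int s F 0\<close> and \<open>frac_int s F t\<close> are each
  of order \<open>\<delta> powr (- s)\<close>. Written as integrals of \<open>F\<close> against
  kernels, the second by Fubini, they differ by the dilated kernel
  \<open>marchaud_kernel s (\<tau> / \<delta>) / \<delta>\<close>; it remains to substitute
  \<open>\<tau> = \<delta> * u\<close>.\<close>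

lemma marchaud_truncated:
  assumes \<delta>: "\<delta> > 0"
  shows "integrable lborel (\<lambda>t. indicator {\<delta><..} t * ((frac_int s F 0 - frac_int s F t) * t powr (- 1 - s)))" (is ?I)
    and "(LBINT t. indicator {\<delta><..} t * ((frac_int s F 0 - frac_int s F t) * t powr (- 1 - s)))
       = (LBINT u. F (\<delta> * u) * marchaud_kernel s u)" (is ?E)
proof -
  let ?\<kappa> = "\<lambda>\<tau> t. indicator {\<delta><..<\<tau>} t * ((\<tau> - t) powr (s - 1) * t powr (- 1 - s))"
  let ?m = "\<lambda>\<tau>. max (\<tau> - \<delta>) 0 powr s / (s * \<tau> * \<delta> powr s)"
  note K = has_bochner_integral_marchaud_inner[OF s(1) \<delta>]
  have A: "has_bochner_integral lborel (\<lambda>t. indicator {\<delta><..} t * t powr (- 1 - s)) (\<delta> powr - s / s)"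
  proof -
    have "has_bochner_integral lborel (\<lambda>t. indicator {\<delta>..} t * t powr (- 1 - s)) (\<delta> powr - s / s)"
      using has_bochner_integral_powr_inf[of "- 1 - s" \<delta>] s \<delta> by simp
    moreover have "AE t in lborel. indicator {\<delta>..} t * t powr (- 1 - s) = indicator {\<delta><..} t * t powr (- 1 - s)"
      using AE_lborel_singleton[of \<delta>] by eventually_elim (auto simp: indicator_def)
    ultimately show ?thesis
      using has_bochner_integral_cong_AE[of "\<lambda>t. indicator {\<delta>..} t * t powr (- 1 - s)" lborel "\<lambda>t. indicator {\<delta><..} t * t powr (- 1 - s)"]
      by simp
  qed
  have m_nn: "0 \<le> ?m \<tau>" for \<tau>
    using s \<delta> by (cases "\<tau> > \<delta>") auto
  have m_le: "?m \<tau> \<le> indicator {0<..} \<tau> * (\<tau> powr (s - 1) / (s * \<delta> powr s))" for \<tau>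
  proof (cases "\<tau> > \<delta>")
    case True
    have "max (\<tau> - \<delta>) 0 powr s \<le> \<tau> powr s" using True \<delta> s by (intro powr_mono2) auto
    then have "?m \<tau> \<le> \<tau> powr s / (s * \<tau> * \<delta> powr s)" using True s \<delta> by (intro divide_right_mono) auto
    also have "\<dots> = \<tau> powr (s - 1) / (s * \<delta> powr s)" using True \<delta> by (simp add: powr_diff)
    finally show ?thesis using True \<delta> by simp
  next
    case False
    then have "max (\<tau> - \<delta>) 0 = 0" by simp
    then have m0: "?m \<tau> = 0" using s by simp
    show ?thesis unfolding m0 using s \<delta> by (simp add: indicator_def)
  qed
  have m_int: "integrable lborel (\<lambda>\<tau>. F \<tau> * ?m \<tau>)" and m_int': "integrable lborel (\<lambda>\<tau>. \<bar>F \<tau>\<bar> * ?m \<tau>)"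
  proof -
    show *: "integrable lborel (\<lambda>\<tau>. F \<tau> * ?m \<tau>)"
    proof (rule Bochner_Integration.integrable_bound)
      show "integrable lborel (\<lambda>\<tau>. (indicator {0<..} \<tau> * (F (0 + \<tau>) * \<tau> powr (s - 1))) / (s * \<delta> powr s))"
        using integrable_frac_int[of 0] by (intro integrable_divide) auto
      show "AE \<tau> in lborel. norm (F \<tau> * ?m \<tau>) \<le> norm (indicator {0<..} \<tau> * (F (0 + \<tau>) * \<tau> powr (s - 1)) / (s * \<delta> powr s))" (is "AE \<tau> in _. ?P \<tau>")
      proof (intro always_eventually allI)
        fix \<tau> :: real
        have "\<bar>F \<tau>\<bar> * ?m \<tau> \<le> \<bar>F \<tau>\<bar> * (indicator {0<..} \<tau> * (\<tau> powr (s - 1) / (s * \<delta> powr s)))"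
          by (intro mult_left_mono m_le) auto
        also have "\<dots> = norm (indicator {0<..} \<tau> * (F (0 + \<tau>) * \<tau> powr (s - 1)) / (s * \<delta> powr s))"
          using s \<delta> by (simp add: abs_mult indicator_def)
        finally show "?P \<tau>"
          using m_nn[of \<tau>] by (simp only: abs_mult real_norm_def abs_of_nonneg[OF m_nn])
      qed
    qed measurable
    show "integrable lborel (\<lambda>\<tau>. \<bar>F \<tau>\<bar> * ?m \<tau>)"
      using integrable_norm[OF *] by (simp only: abs_mult real_norm_def abs_of_nonneg[OF m_nn])
  qed
  have \<kappa>_nn: "?\<kappa> \<tau> t \<ge> 0" for \<tau> t by (auto simp: indicator_def)
  have fm: "(\<lambda>(\<tau>, t). F \<tau> * ?\<kappa> \<tau> t) \<in> borel_measurable (lborel \<Otimes>\<^sub>M lborel)"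
  proof -
    have "(\<lambda>(\<tau>, t). F \<tau> * ((if \<delta> < t \<and> t < \<tau> then 1 else 0) * ((\<tau> - t) powr (s - 1) * t powr (- 1 - s)))) \<in> borel_measurable (lborel \<Otimes>\<^sub>M lborel)"
      by measurable
    moreover have "(\<lambda>(\<tau>, t). F \<tau> * ?\<kappa> \<tau> t) = (\<lambda>(\<tau>, t). F \<tau> * ((if \<delta> < t \<and> t < \<tau> then 1 else 0) * ((\<tau> - t) powr (s - 1) * t powr (- 1 - s))))"
      by (auto simp: fun_eq_iff indicator_def)
    ultimately show ?thesis by simp
  qed
  have int: "integrable (lborel \<Otimes>\<^sub>M lborel) (\<lambda>(\<tau>, t). F \<tau> * ?\<kappa> \<tau> t)"
  proof (rule lborel_pair.Fubini_integrable[OF fm])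
    have "(LBINT t. norm (F \<tau> * ?\<kappa> \<tau> t)) = \<bar>F \<tau>\<bar> * ?m \<tau>" for \<tau>
    proof -
      have "(LBINT t. norm (F \<tau> * ?\<kappa> \<tau> t)) = (LBINT t. \<bar>F \<tau>\<bar> * ?\<kappa> \<tau> t)"
        using \<kappa>_nn by (intro Bochner_Integration.integral_cong) (auto simp: abs_mult)
      then show ?thesis using K[of \<tau>] by (simp add: has_bochner_integral_iff)
    qed
    then show "integrable lborel (\<lambda>\<tau>. LBINT t. norm (case (\<tau>, t) of (\<tau>, t) \<Rightarrow> F \<tau> * ?\<kappa> \<tau> t))"
      using m_int' by simp
    show "AE \<tau> in lborel. integrable lborel (\<lambda>t. case (\<tau>, t) of (\<tau>, t) \<Rightarrow> F \<tau> * ?\<kappa> \<tau> t)"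
      using K by (auto simp: has_bochner_integral_iff)
  qed
  have inner: "(LBINT \<tau>. F \<tau> * ?\<kappa> \<tau> t) = indicator {\<delta><..} t * (frac_int s F t * t powr (- 1 - s))" for t
  proof (cases "t > \<delta>")
    case True
    have "(LBINT \<tau>. F \<tau> * ?\<kappa> \<tau> t) = (LBINT \<tau>. (indicator {t<..} \<tau> * (F \<tau> * (\<tau> - t) powr (s - 1))) * t powr (- 1 - s))"
      using True by (intro Bochner_Integration.integral_cong) (auto simp: indicator_def)
    also have "\<dots> = frac_int s F t * t powr (- 1 - s)"
      using True \<delta> by (subst integral_mult_left_zero) (simp add: frac_int_shift)
    finally show ?thesis using True by simp
  qed simp
  have Bint: "integrable lborel (\<lambda>t. indicator {\<delta><..} t * (frac_int s F t * t powr (- 1 - s)))"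
    using lborel_pair.integrable_snd[OF int] inner by simp
  have B: "(LBINT t. indicator {\<delta><..} t * (frac_int s F t * t powr (- 1 - s))) = (LBINT \<tau>. F \<tau> * ?m \<tau>)"
    using lborel_pair.Fubini_integral[OF int] inner K by (simp add: has_bochner_integral_iff)
  have A': "has_bochner_integral lborel (\<lambda>t. indicator {\<delta><..} t * (frac_int s F 0 * t powr (- 1 - s))) (frac_int s F 0 * (\<delta> powr - s / s))"
    unfolding mult.left_commute[of "indicator _ _" "frac_int s F 0"] using A by (intro has_bochner_integral_mult_right)
  then have Aint: "integrable lborel (\<lambda>t. indicator {\<delta><..} t * (frac_int s F 0 * t powr (- 1 - s)))"
    by (simp add: has_bochner_integral_iff)
  have eq: "indicator {\<delta><..} t * ((frac_int s F 0 - frac_int s F t) * t powr (- 1 - s)) =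
    indicator {\<delta><..} t * (frac_int s F 0 * t powr (- 1 - s)) - indicator {\<delta><..} t * (frac_int s F t * t powr (- 1 - s))" for t
    by (simp add: algebra_simps)
  show ?I unfolding eq using Aint Bint by (rule Bochner_Integration.integrable_diff)
  have "(LBINT t. indicator {\<delta><..} t * ((frac_int s F 0 - frac_int s F t) * t powr (- 1 - s)))
    = frac_int s F 0 * (\<delta> powr - s / s) - (LBINT \<tau>. F \<tau> * ?m \<tau>)"
    unfolding eq using Aint Bint B A'
    by (subst Bochner_Integration.integral_diff) (auto simp: has_bochner_integral_iff)
  also have "frac_int s F 0 * (\<delta> powr - s / s) = (LBINT \<tau>. (indicator {0<..} \<tau> * (F (0 + \<tau>) * \<tau> powr (s - 1))) * (\<delta> powr - s / s))"
    unfolding frac_int_def by (subst integral_mult_left_zero) simp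
  also have "\<dots> - (LBINT \<tau>. F \<tau> * ?m \<tau>) =
    (LBINT \<tau>. (indicator {0<..} \<tau> * (F (0 + \<tau>) * \<tau> powr (s - 1))) * (\<delta> powr - s / s) - F \<tau> * ?m \<tau>)"
    using m_int integrable_frac_int[of 0] by (subst Bochner_Integration.integral_diff) auto
  also have "\<dots> = (LBINT \<tau>. F \<tau> * (marchaud_kernel s (\<tau> / \<delta>) / \<delta>))"
  proof (intro Bochner_Integration.integral_cong refl)
    fix \<tau> :: real
    show "(indicator {0<..} \<tau> * (F (0 + \<tau>) * \<tau> powr (s - 1))) * (\<delta> powr - s / s) - F \<tau> * ?m \<tau> = F \<tau> * (marchaud_kernel s (\<tau> / \<delta>) / \<delta>)"
    proof (cases "\<tau> > 0")
      case True
      have mx: "max (\<tau> / \<delta> - 1) 0 = max (\<tau> - \<delta>) 0 / \<delta>"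
        using \<delta> by (auto simp: max_def field_simps)
      have "marchaud_kernel s (\<tau> / \<delta>) = (\<tau> powr s / \<delta> powr s - max (\<tau> - \<delta>) 0 powr s / \<delta> powr s) / (s * (\<tau> / \<delta>))"
        using True \<delta> unfolding marchaud_kernel_def mx by (simp add: powr_divide)
      then have e: "marchaud_kernel s (\<tau> / \<delta>) / \<delta> = \<tau> powr (s - 1) * (\<delta> powr - s / s) - ?m \<tau>"
        using True \<delta> s by (simp add: powr_diff powr_minus field_simps)
      show ?thesis unfolding e using True by (simp add: right_diff_distrib)
    next
      case False
      then have "?m \<tau> = 0" "marchaud_kernel s (\<tau> / \<delta>) = 0" using s \<delta> by (auto simp: max_def marchaud_kernel_def divide_simps)
      then show ?thesis using False by simp
    qed
  qed
  also have "\<dots> = \<bar>\<delta>\<bar> * (LBINT u. F (0 + \<delta> * u) * (marchaud_kernel s ((0 + \<delta> * u) / \<delta>) / \<delta>))"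
    using lborel_integral_real_affine[of \<delta> "\<lambda>\<tau>. F \<tau> * (marchaud_kernel s (\<tau> / \<delta>) / \<delta>)" 0] \<delta> by simp
  also have "\<dots> = (LBINT u. F (\<delta> * u) * marchaud_kernel s u)"
    using \<delta> by simp
  finally show ?E .
qed

text \<open>An approximate-identity argument: the kernel is integrable with mass
  \<open>marchaud_const s\<close>, and \<open>F (\<delta> * u)\<close> is bounded and tends to
  \<open>F 0\<close>. No difference quotient of \<open>F\<close> is left, hence no smoothness is
  asked of it.\<close>

theorem marchaud_limit:
  "((\<lambda>\<delta>. LBINT t. indicator {\<delta><..} t * ((frac_int s F 0 - frac_int s F t) * t powr (- 1 - s)))
      \<longlongrightarrow> marchaud_const s * F 0) (at_right 0)"
proof (rule tendsto_at_right_sequentially[of _ 1])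
  fix S :: "nat \<Rightarrow> real" assume S: "\<And>n. 0 < S n" "S \<longlonglongrightarrow> 0"
  have "(\<lambda>n. LBINT u. F (S n * u) * marchaud_kernel s u) \<longlonglongrightarrow> (LBINT u. F 0 * marchaud_kernel s u)"
  proof (rule integral_dominated_convergence[where w = "\<lambda>u. M * marchaud_kernel s u"])
    show "integrable lborel (\<lambda>u. M * marchaud_kernel s u)" using integrable_marchaud_kernel[OF s] by simp
    show "AE u in lborel. (\<lambda>n. F (S n * u) * marchaud_kernel s u) \<longlonglongrightarrow> F 0 * marchaud_kernel s u"
    proof (intro always_eventually allI tendsto_mult tendsto_const)
      fix u
      have "(\<lambda>n. S n * u) \<longlonglongrightarrow> 0 * u" using S by (intro tendsto_intros)
      moreover have "isCont F 0" using F_cont by (simp add: continuous_on_eq_continuous_at)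
      ultimately show "(\<lambda>n. F (S n * u)) \<longlonglongrightarrow> F 0" using isCont_tendsto_compose[of 0 F "\<lambda>n. S n * u"] by simp
    qed
    fix n
    show "AE u in lborel. norm (F (S n * u) * marchaud_kernel s u) \<le> M * marchaud_kernel s u" (is "AE u in _. ?P u")
    proof (intro always_eventually allI)
      fix u
      show "?P u"
      proof (cases "u > 0")
        case True
        then have "S n * u \<ge> 0" using S(1)[of n] by simp
        then show ?thesis using F_bound marchaud_kernel_nonneg[OF s(1), of u]
          by (simp add: abs_mult mult_right_mono)
      qed (simp add: marchaud_kernel_def)
    qed
  qed auto
  then show "(\<lambda>n. LBINT t. indicator {S n<..} t * ((frac_int s F 0 - frac_int s F t) * t powr (- 1 - s)))
      \<longlonglongrightarrow> marchaud_const s * F 0"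
    unfolding marchaud_truncated(2)[OF S(1)] by (simp add: marchaud_const_def mult.commute)
qed simp

end

section \<open>Potentials\<close>

text \<open>Makes dominated convergence, a statement on sequences, available for limits at
  infinity.\<close>

lemma tendsto_at_infinity_sequentially:
  fixes f :: "'a::real_normed_vector \<Rightarrow> 'b::metric_space"
  assumes "\<And>X. filterlim X at_infinity sequentially \<Longrightarrow> (\<lambda>n. f (X n)) \<longlonglongrightarrow> l"
  shows "(f \<longlongrightarrow> l) at_infinity"
proof (rule ccontr)
  assume "\<not> (f \<longlongrightarrow> l) at_infinity"
  then obtain e where e: "e > 0" "\<not> eventually (\<lambda>x. dist (f x) l < e) at_infinity"
    unfolding tendsto_iff by blast
  then have "\<forall>n::nat. \<exists>x. norm x \<ge> real n \<and> \<not> dist (f x) l < e"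
    unfolding eventually_at_infinity by blast
  then obtain X where X: "\<And>n::nat. norm (X n) \<ge> real n" "\<And>n. \<not> dist (f (X n)) l < e" by metis
  have "filterlim (\<lambda>n. norm (X n)) at_top sequentially"
    by (rule filterlim_at_top_mono[OF filterlim_real_sequentially]) (use X in auto)
  then have "filterlim X at_infinity sequentially"
    by (simp add: filterlim_at_infinity_conv_norm_at_top)
  from assms[OF this] have "eventually (\<lambda>n. dist (f (X n)) l < e) sequentially"
    using e unfolding tendsto_iff by blast
  then show False using X(2) by (auto simp: eventually_sequentially)
qed

lemma continuous_on_UNIV_sequentially:
  fixes f :: "'a::metric_space \<Rightarrow> 'b::topological_space"
  assumes "\<And>X x. X \<longlonglongrightarrow> x \<Longrightarrow> (\<lambda>n. f (X n)) \<longlonglongrightarrow> f x"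
  shows "continuous_on UNIV f"
  using assms by (auto intro!: continuous_at_imp_continuous_on simp: continuous_at_sequentially comp_def)

text \<open>Balakrishnan's formula for the fractional Laplacian, without its constant. A relation
  rather than a value given by \<open>Lim\<close>, so that it includes the existence of the limit;
  it can hold at points where \<open>\<psi>\<close> is not twice differentiable.\<close>

definition hlap :: "real \<Rightarrow> ('a::euclidean_space \<Rightarrow> real) \<Rightarrow> 'a \<Rightarrow> real \<Rightarrow> bool" where
  "hlap s \<psi> x l \<longleftrightarrow>
     ((\<lambda>\<delta>. LBINT t. indicator {\<delta><..} t * ((\<psi> x - heat t \<psi> x) * t powr (- 1 - s))) \<longlongrightarrow> l) (at_right 0)"

definition pot :: "real \<Rightarrow> ('a::euclidean_space \<Rightarrow> real) \<Rightarrow> 'a \<Rightarrow> real" where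
  "pot s q x = frac_int s (\<lambda>t. heat t q x) 0"

text \<open>The exponent is \<open>2 * \<beta>\<close> because space scales like the square root of
  time: this is the decay that \<open>heat_decay\<close> turns into
  \<open>t powr (- \<beta>)\<close>.\<close>

definition fast_decay :: "real \<Rightarrow> ('a::real_normed_vector \<Rightarrow> real) \<Rightarrow> real \<Rightarrow> bool" where
  "fast_decay \<beta> q M \<longleftrightarrow> continuous_on UNIV q \<and> (\<forall>x. \<bar>q x\<bar> \<le> M * (1 + norm x) powr (- (2 * \<beta>)))"

lemma fast_decay_add:
  assumes "fast_decay \<beta> q M" "fast_decay \<beta> q' M'"
  shows "fast_decay \<beta> (\<lambda>x. q x + q' x) (M + M')"
  unfolding fast_decay_def
proof (intro conjI allI)
  show "continuous_on UNIV (\<lambda>x. q x + q' x)"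
    using assms unfolding fast_decay_def by (auto intro: continuous_intros)
  fix x
  have "\<bar>q x\<bar> \<le> M * (1 + norm x) powr (- (2 * \<beta>))" "\<bar>q' x\<bar> \<le> M' * (1 + norm x) powr (- (2 * \<beta>))"
    using assms unfolding fast_decay_def by auto
  then show "\<bar>q x + q' x\<bar> \<le> (M + M') * (1 + norm x) powr (- (2 * \<beta>))"
    unfolding distrib_right by linarith
qed

lemma fast_decay_mult:
  assumes "fast_decay \<beta> q M" "continuous_on UNIV g" "\<And>x. \<bar>g x\<bar> \<le> K"
  shows "fast_decay \<beta> (\<lambda>x. g x * q x) (K * M)"
  unfolding fast_decay_def
proof (intro conjI allI)
  show "continuous_on UNIV (\<lambda>x. g x * q x)"
    using assms unfolding fast_decay_def by (auto intro: continuous_intros)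
  fix x
  have "K \<ge> 0" using assms(3)[of x] by linarith
  then have "\<bar>g x\<bar> * \<bar>q x\<bar> \<le> K * (M * (1 + norm x) powr (- (2 * \<beta>)))"
    using assms unfolding fast_decay_def by (intro mult_mono) auto
  then show "\<bar>g x * q x\<bar> \<le> K * M * (1 + norm x) powr (- (2 * \<beta>))"
    by (simp add: abs_mult mult.assoc)
qed

lemma fast_decay_cmult: "fast_decay \<beta> q M \<Longrightarrow> fast_decay \<beta> (\<lambda>x. k * q x) (\<bar>k\<bar> * M)"
  by (rule fast_decay_mult) auto

lemma fast_decay_uminus: "fast_decay \<beta> q M \<Longrightarrow> fast_decay \<beta> (\<lambda>x. - q x) M"
  unfolding fast_decay_def by (auto intro: continuous_intros)

lemma heat_continuous:
  assumes "bounded_borel \<psi>" "continuous_on UNIV \<psi>"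
  shows "continuous_on UNIV (heat t \<psi>)"
  by (rule continuous_on_UNIV_sequentially) (intro heat_tendsto assms tendsto_const)

lemma integral_swap_dominated:
  fixes f :: "'a::euclidean_space \<Rightarrow> 'b::euclidean_space \<Rightarrow> real"
  assumes m: "(\<lambda>(x, y). f x y) \<in> borel_measurable (borel \<Otimes>\<^sub>M borel)"
    and g: "integrable lborel g" and h: "integrable lborel h"
    and le: "\<And>x y. \<bar>f x y\<bar> \<le> g x * h y"
  shows "(LBINT x. (LBINT y. f x y)) = (LBINT y. (LBINT x. f x y))"
proof -
  have [measurable]: "g \<in> borel_measurable borel" "h \<in> borel_measurable borel" using g h by auto
  have m': "(\<lambda>(x, y). f x y) \<in> borel_measurable (lborel \<Otimes>\<^sub>M lborel)"
    using m by (simp cong: measurable_cong_sets sets_pair_measure_cong)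
  have gh: "integrable (lborel \<Otimes>\<^sub>M lborel) (\<lambda>(x, y). g x * h y)"
    using g h by (intro lborel_pair.Fubini_integrable) (auto simp: abs_mult split_beta')
  have "integrable (lborel \<Otimes>\<^sub>M lborel) (\<lambda>(x, y). f x y)"
    using le by (intro Bochner_Integration.integrable_bound[OF gh m']) (auto intro: order_trans[OF le abs_ge_self])
  from lborel_pair.Fubini_integral[OF this] show ?thesis by simp
qed

locale riesz =
  fixes s \<beta> :: real and TYP :: "'a::euclidean_space itself"
  assumes s: "0 < s" "s < 1" and \<beta>: "s < \<beta>" "\<beta> < real DIM('a) / 2"
begin

lemma fast_decay_nonneg:
  assumes "fast_decay \<beta> (q :: 'a \<Rightarrow> real) M" shows "M \<ge> 0"
proof -
  have "\<bar>q 0\<bar> \<le> M * (1 + norm (0::'a)) powr (- (2 * \<beta>))" using assms unfolding fast_decay_def by blast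
  then show ?thesis by simp
qed

lemma fast_decay_le:
  assumes "fast_decay \<beta> (q :: 'a \<Rightarrow> real) M" shows "\<bar>q x\<bar> \<le> M"
proof -
  have "(1 + norm x) powr (- (2 * \<beta>)) \<le> 1 powr (- (2 * \<beta>))" using \<beta> s by (intro powr_mono2') auto
  then have "M * (1 + norm x) powr (- (2 * \<beta>)) \<le> M * 1"
    using fast_decay_nonneg[OF assms] by (intro mult_left_mono) auto
  moreover have "\<bar>q x\<bar> \<le> M * (1 + norm x) powr (- (2 * \<beta>))" using assms unfolding fast_decay_def by blast
  ultimately show ?thesis by linarith
qed

lemma fast_decay_bounded:
  assumes "fast_decay \<beta> (q :: 'a \<Rightarrow> real) M" shows "bounded_borel q"
  using fast_decay_le[OF assms] assms unfolding fast_decay_def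
  by (intro bounded_borelI[of q M] borel_measurable_continuous_onI) auto

lemma fast_decay_tendsto:
  assumes "fast_decay \<beta> (q :: 'a \<Rightarrow> real) M" shows "(q \<longlongrightarrow> 0) at_infinity"
proof (rule Lim_null_comparison)
  show "\<forall>\<^sub>F x in at_infinity. norm (q x) \<le> M * (1 + norm x) powr (- (2 * \<beta>))"
    using assms unfolding fast_decay_def by auto
  have "filterlim (\<lambda>x::'a. 1 + norm x) at_top at_infinity"
    by (intro filterlim_tendsto_add_at_top[OF tendsto_const] filterlim_norm_at_top)
  then have "((\<lambda>x::'a. (1 + norm x) powr (- (2 * \<beta>))) \<longlongrightarrow> 0) at_infinity"
    using \<beta> s by (intro tendsto_neg_powr) auto
  then show "((\<lambda>x::'a. M * (1 + norm x) powr (- (2 * \<beta>))) \<longlongrightarrow> 0) at_infinity"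
    by (rule tendsto_mult_right_zero)
qed

text \<open>Chosen once for all \<open>q\<close>, \<open>M\<close>, \<open>e\<close> and
  \<open>x\<close>. The uniformity makes the later bounds linear in \<open>M\<close>, so that
  \<open>pot s\<close> gives rise to a bounded operator, and lets one majorant serve along a
  sequence of points.\<close>

definition decay_const :: real where
  "decay_const = (SOME C. C \<ge> 0 \<and> (\<forall>(q::'a \<Rightarrow> real) M e x. fast_decay \<beta> q M \<longrightarrow> e \<ge> 0 \<longrightarrow>
     decaying s \<beta> (C * M) (\<lambda>t. heat (e + t) q x)))"

lemma decay_const:
  shows decay_const_nonneg: "decay_const \<ge> 0"
    and decaying_heat: "\<And>(q::'a \<Rightarrow> real) M e x. fast_decay \<beta> q M \<Longrightarrow> e \<ge> 0 \<Longrightarrow>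
      decaying s \<beta> (decay_const * M) (\<lambda>t. heat (e + t) q x)"
proof -
  obtain C where C: "C \<ge> 0" "\<And>(\<psi>::'a \<Rightarrow> real) M t x. bounded_borel \<psi> \<Longrightarrow>
     (\<And>y. \<bar>\<psi> y\<bar> \<le> M * (1 + norm y) powr (- (2 * \<beta>))) \<Longrightarrow> t > 0 \<Longrightarrow> \<bar>heat t \<psi> x\<bar> \<le> C * M * t powr (- \<beta>)"
    using heat_decay[where 'a = 'a and \<beta> = \<beta>] \<beta> s by force
  \<comment> \<open>\<open>C\<close> gives the decay in time; the added 1 accounts for the bound by
    \<open>M\<close> valid at all times, so that one constant serves both.\<close>
  have "decaying s \<beta> ((C + 1) * M) (\<lambda>t. heat (e + t) q x)" if q: "fast_decay \<beta> q M" and e: "e \<ge> 0" for q :: "'a \<Rightarrow> real" and M e x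
  proof
    have M: "M \<ge> 0" using fast_decay_nonneg[OF q] .
    note bb = fast_decay_bounded[OF q]
    have qc: "continuous_on UNIV q" using q unfolding fast_decay_def by blast
    show "continuous_on UNIV (\<lambda>t. heat (e + t) q x)"
      by (rule continuous_on_UNIV_sequentially) (intro heat_tendsto bb qc tendsto_intros)
    have 0: "\<bar>heat t q x\<bar> \<le> M" for t using fast_decay_le[OF q] by (intro heat_abs_le bb)
    show "\<bar>heat (e + t) q x\<bar> \<le> (C + 1) * M" for t
    proof -
      have "0 \<le> C * M" using C M by simp
      then show ?thesis using 0[of "e + t"] unfolding distrib_right by linarith
    qed
    fix t :: real assume t: "t > 0"
    have "\<bar>heat (e + t) q x\<bar> \<le> C * M * (e + t) powr (- \<beta>)"
      using q t e unfolding fast_decay_def by (intro C bb) auto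
    also have "\<dots> \<le> (C + 1) * M * t powr (- \<beta>)"
      using t e \<beta> s C M by (intro mult_mono powr_mono2') auto
    finally show "\<bar>heat (e + t) q x\<bar> \<le> (C + 1) * M * t powr - \<beta>" .
  qed (use s \<beta> in auto)
  then have "C + 1 \<ge> 0 \<and> (\<forall>(q::'a \<Rightarrow> real) M e x. fast_decay \<beta> q M \<longrightarrow> e \<ge> 0 \<longrightarrow>
     decaying s \<beta> ((C + 1) * M) (\<lambda>t. heat (e + t) q x))" using C by simp
  then have "decay_const \<ge> 0 \<and> (\<forall>(q::'a \<Rightarrow> real) M e x. fast_decay \<beta> q M \<longrightarrow> e \<ge> 0 \<longrightarrow>
     decaying s \<beta> (decay_const * M) (\<lambda>t. heat (e + t) q x))"
    unfolding decay_const_def by (rule someI)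
  then show "decay_const \<ge> 0" "\<And>(q::'a \<Rightarrow> real) M e x. fast_decay \<beta> q M \<Longrightarrow> e \<ge> 0 \<Longrightarrow>
      decaying s \<beta> (decay_const * M) (\<lambda>t. heat (e + t) q x)" by blast+
qed

abbreviation weight :: "real \<Rightarrow> real" where
  "weight \<tau> \<equiv> indicator {0<..} \<tau> * (min 1 (\<tau> powr - \<beta>) * \<tau> powr (s - 1))"

lemma integrable_weight: "integrable lborel weight"
  using integrable_min_powr[OF s(1) \<beta>(1)] .

lemma pot_integrand_le:
  assumes "fast_decay \<beta> (q::'a \<Rightarrow> real) M" "t \<ge> 0"
  shows "\<bar>indicator {0<..} \<tau> * (heat (t + \<tau>) q x * \<tau> powr (s - 1))\<bar> \<le> decay_const * M * weight \<tau>"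
  using decaying.frac_int_integrand_le[OF decaying_heat[OF assms], of 0 \<tau> x] by simp

lemma integrable_pot:
  assumes "fast_decay \<beta> (q::'a \<Rightarrow> real) M" "t \<ge> 0"
  shows "integrable lborel (\<lambda>\<tau>. indicator {0<..} \<tau> * (heat (t + \<tau>) q x * \<tau> powr (s - 1)))"
  using decaying.integrable_frac_int[OF decaying_heat[OF assms], of 0 x] by simp

definition pot_const :: real where
  "pot_const = decay_const * (LBINT \<tau>. weight \<tau>)"

lemma pot_const_nonneg: "pot_const \<ge> 0"
  unfolding pot_const_def by (intro mult_nonneg_nonneg decay_const_nonneg Bochner_Integration.integral_nonneg) auto

lemma pot_bound:
  assumes "fast_decay \<beta> (q::'a \<Rightarrow> real) M"
  shows "\<bar>pot s q x\<bar> \<le> pot_const * M"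
proof -
  have "\<bar>pot s q x\<bar> \<le> (LBINT \<tau>. \<bar>indicator {0<..} \<tau> * (heat (0 + \<tau>) q x * \<tau> powr (s - 1))\<bar>)"
    unfolding pot_def frac_int_def by (rule integral_abs_bound)
  also have "\<dots> \<le> (LBINT \<tau>. decay_const * M * weight \<tau>)"
    using integrable_weight integrable_pot[OF assms, of 0 x] by (intro integral_mono pot_integrand_le assms) auto
  also have "\<dots> = pot_const * M"
    by (subst integral_mult_right_zero) (simp add: pot_const_def)
  finally show ?thesis .
qed

text \<open>The majorant does not depend on the point. Used with
  \<open>l \<tau> = heat \<tau> q x\<close> for continuity and with \<open>l = 0\<close> for the
  limit at infinity.\<close>

lemma pot_tendsto_aux:
  assumes q: "fast_decay \<beta> (q::'a \<Rightarrow> real) M" and "\<And>\<tau>. \<tau> > 0 \<Longrightarrow> (\<lambda>n. heat \<tau> q (X n)) \<longlonglongrightarrow> l \<tau>"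
    and [measurable]: "l \<in> borel_measurable borel"
  shows "(\<lambda>n. pot s q (X n)) \<longlonglongrightarrow> (LBINT \<tau>. indicator {0<..} \<tau> * (l \<tau> * \<tau> powr (s - 1)))"
proof -
  note [measurable] = bounded_borel_measurable[OF fast_decay_bounded[OF q]]
  show ?thesis
    unfolding pot_def frac_int_def
  proof (rule integral_dominated_convergence[where w = "\<lambda>\<tau>. decay_const * M * weight \<tau>"])
    show "AE \<tau> in lborel. (\<lambda>n. indicator {0<..} \<tau> * (heat (0 + \<tau>) q (X n) * \<tau> powr (s - 1)))
      \<longlonglongrightarrow> indicator {0<..} \<tau> * (l \<tau> * \<tau> powr (s - 1))" (is "AE \<tau> in _. ?P \<tau>")
    proof (intro always_eventually allI)
      fix \<tau> :: real
      show "?P \<tau>"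
        using assms(2)[of \<tau>] by (cases "\<tau> > 0") (auto intro!: tendsto_intros)
    qed
    show "AE \<tau> in lborel. norm (indicator {0<..} \<tau> * (heat (0 + \<tau>) q (X n) * \<tau> powr (s - 1))) \<le> decay_const * M * weight \<tau>" for n
      using pot_integrand_le[OF q, of 0] by simp
  qed (use integrable_weight in auto)
qed

lemma pot_continuous:
  assumes q: "fast_decay \<beta> (q::'a \<Rightarrow> real) M"
  shows "continuous_on UNIV (pot s q)"
proof (rule continuous_on_UNIV_sequentially)
  fix X :: "nat \<Rightarrow> 'a" and x assume X: "X \<longlonglongrightarrow> x"
  note [measurable] = bounded_borel_measurable[OF fast_decay_bounded[OF q]]
  have "(\<lambda>n. heat \<tau> q (X n)) \<longlonglongrightarrow> heat \<tau> q x" for \<tau>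
    using q unfolding fast_decay_def by (intro heat_tendsto fast_decay_bounded[OF q] X) auto
  from pot_tendsto_aux[OF q this] show "(\<lambda>n. pot s q (X n)) \<longlonglongrightarrow> pot s q x"
    unfolding pot_def frac_int_def by simp
qed

lemma pot_tendsto:
  assumes q: "fast_decay \<beta> (q::'a \<Rightarrow> real) M"
  shows "(pot s q \<longlongrightarrow> 0) at_infinity"
proof (rule tendsto_at_infinity_sequentially)
  fix X :: "nat \<Rightarrow> 'a" assume X: "filterlim X at_infinity sequentially"
  have "(\<lambda>n. heat \<tau> q (X n)) \<longlonglongrightarrow> 0" for \<tau>
    by (rule heat_tendsto_at_infinity[OF fast_decay_bounded[OF q] fast_decay_tendsto[OF q] tendsto_const X])
  from pot_tendsto_aux[OF q this] show "(\<lambda>n. pot s q (X n)) \<longlonglongrightarrow> 0" by simp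
qed

lemma pot_bounded_borel:
  assumes q: "fast_decay \<beta> (q::'a \<Rightarrow> real) M" shows "bounded_borel (pot s q)"
  using pot_bound[OF q] pot_continuous[OF q]
  by (intro bounded_borelI borel_measurable_continuous_onI)

lemma pot_add:
  assumes q: "fast_decay \<beta> (q::'a \<Rightarrow> real) M" and q': "fast_decay \<beta> q' M'"
  shows "pot s (\<lambda>x. q x + q' x) x = pot s q x + pot s q' x"
proof -
  have "pot s (\<lambda>x. q x + q' x) x = (LBINT \<tau>. indicator {0<..} \<tau> * (heat (0 + \<tau>) q x * \<tau> powr (s - 1))
      + indicator {0<..} \<tau> * (heat (0 + \<tau>) q' x * \<tau> powr (s - 1)))"
    unfolding pot_def frac_int_def heat_add[OF fast_decay_bounded[OF q] fast_decay_bounded[OF q']]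
    by (simp add: algebra_simps)
  also have "\<dots> = pot s q x + pot s q' x"
    unfolding pot_def frac_int_def
    by (intro Bochner_Integration.integral_add integrable_pot[OF q] integrable_pot[OF q'] order_refl)
  finally show ?thesis .
qed

lemma pot_cmult: "pot s (\<lambda>x. k * q x) x = k * pot s q x"
proof -
  have "pot s (\<lambda>x. k * q x) x = (LBINT \<tau>. k * (indicator {0<..} \<tau> * (heat (0 + \<tau>) q x * \<tau> powr (s - 1))))"
    unfolding pot_def frac_int_def heat_cmult by (simp add: algebra_simps)
  then show ?thesis unfolding pot_def frac_int_def by simp
qed

lemma pot_uminus: "pot s (\<lambda>x. - q x) x = - pot s q x"
  using pot_cmult[of "-1" q x] by simp

text \<open>By Fubini and the semigroup law, the heat flow of a potential is a time shift inside the
  Liouville integral.\<close>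

lemma heat_pot:
  assumes q: "fast_decay \<beta> (q::'a \<Rightarrow> real) M" and t: "t \<ge> 0"
  shows "heat t (pot s q) x = frac_int s (\<lambda>\<tau>. heat \<tau> q x) t"
proof -
  note [measurable] = bounded_borel_measurable[OF fast_decay_bounded[OF q]]
  let ?f = "\<lambda>z \<tau>. gauss_kernel z * (indicator {0<..} \<tau> * (heat (0 + \<tau>) q (x + sqrt t *\<^sub>R z) * \<tau> powr (s - 1)))"
  have "heat t (pot s q) x = (LBINT z. (LBINT \<tau>. ?f z \<tau>))"
    unfolding heat_def[of t "pot s q"] pot_def frac_int_def by simp
  also have "\<dots> = (LBINT \<tau>. (LBINT z. ?f z \<tau>))"
  proof (rule integral_swap_dominated)
    show "(\<lambda>(z, \<tau>). ?f z \<tau>) \<in> borel_measurable (borel \<Otimes>\<^sub>M borel)" by measurable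
    show "\<bar>?f z \<tau>\<bar> \<le> gauss_kernel z * (decay_const * M * weight \<tau>)" for z \<tau>
      using pot_integrand_le[OF q, of 0 \<tau> "x + sqrt t *\<^sub>R z"]
      unfolding abs_mult[of "gauss_kernel z"] by (intro mult_mono) auto
  qed (use integrable_weight in auto)
  also have "\<dots> = (LBINT \<tau>. indicator {0<..} \<tau> * (heat t (heat \<tau> q) x * \<tau> powr (s - 1)))"
  proof (intro Bochner_Integration.integral_cong refl)
    fix \<tau> :: real
    have "(LBINT z. ?f z \<tau>) = (LBINT z. (indicator {0<..} \<tau> * \<tau> powr (s - 1)) * (gauss_kernel z * heat \<tau> q (x + sqrt t *\<^sub>R z)))"
      by (simp add: mult_ac)
    also have "\<dots> = (indicator {0<..} \<tau> * \<tau> powr (s - 1)) * heat t (heat \<tau> q) x"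
      unfolding heat_def[of t "heat \<tau> q"] by (rule integral_mult_right_zero)
    finally show "(LBINT z. ?f z \<tau>) = indicator {0<..} \<tau> * (heat t (heat \<tau> q) x * \<tau> powr (s - 1))"
      by (simp add: mult_ac)
  qed
  also have "\<dots> = frac_int s (\<lambda>\<tau>. heat \<tau> q x) t"
    unfolding frac_int_def using heat_heat[OF fast_decay_bounded[OF q] t]
    by (intro Bochner_Integration.integral_cong refl) (auto simp: indicator_def)
  finally show ?thesis .
qed

text \<open>With \<open>F t = heat (e + t) q x\<close>, the heat flow started at
  \<open>heat e (pot s q)\<close> is \<open>frac_int s F\<close>, so the claim is
  \<open>marchaud_limit\<close>; the flow preserves the constant \<open>\<gamma>\<close>, which
  cancels. The case \<open>e > 0\<close> serves the smoothed barriers, \<open>e = 0\<close> the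
  potential itself.\<close>

theorem hlap_heat_pot:
  assumes q: "fast_decay \<beta> (q::'a \<Rightarrow> real) M" and e: "e \<ge> 0"
  shows "hlap s (heat e (\<lambda>x. \<gamma> + pot s q x)) x (marchaud_const s * heat e q x)"
proof -
  note bb = pot_bounded_borel[OF q]
  interpret decaying s \<beta> "decay_const * M" "\<lambda>t. heat (e + t) q x"
    by (rule decaying_heat[OF q e])
  have eq: "heat e (\<lambda>x. \<gamma> + pot s q x) = (\<lambda>x. \<gamma> + heat e (pot s q) x)"
    by (rule ext) (simp add: heat_add bb)
  have J: "heat t (heat e (pot s q)) x = frac_int s (\<lambda>t. heat (e + t) q x) t" if "t \<ge> 0" for t
  proof -
    have "heat t (heat e (pot s q)) x = heat (e + t) (pot s q) x"
      using heat_heat[OF bb that e] by (simp add: add.commute)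
    also have "\<dots> = frac_int s (\<lambda>\<tau>. heat \<tau> q x) (e + t)" using that e by (intro heat_pot[OF q]) auto
    also have "\<dots> = frac_int s (\<lambda>t. heat (e + t) q x) t" by (simp add: frac_int_def add.assoc)
    finally show ?thesis .
  qed
  let ?J = "\<lambda>t. (frac_int s (\<lambda>t. heat (e + t) q x) 0 - frac_int s (\<lambda>t. heat (e + t) q x) t) * t powr (- 1 - s)"
  let ?H = "\<lambda>t. (heat e (\<lambda>x. \<gamma> + pot s q x) x - heat t (heat e (\<lambda>x. \<gamma> + pot s q x)) x) * t powr (- 1 - s)"
  have "((\<lambda>\<delta>. LBINT t. indicator {\<delta><..} t * ?J t)
      \<longlongrightarrow> marchaud_const s * heat (e + 0) q x) (at_right 0)"
    by (rule marchaud_limit)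
  moreover have "\<forall>\<^sub>F \<delta> in at_right 0.
    (LBINT t. indicator {\<delta><..} t * ?J t)
    = (LBINT t. indicator {\<delta><..} t * ?H t)"
    using eventually_at_right_less
  proof eventually_elim
    fix \<delta> :: real assume \<delta>: "\<delta> > 0"
    show "(LBINT t. indicator {\<delta><..} t * ?J t)
    = (LBINT t. indicator {\<delta><..} t * ?H t)"
    proof (intro Bochner_Integration.integral_cong refl)
      fix t :: real
      show "indicator {\<delta><..} t * ?J t
        = indicator {\<delta><..} t * ?H t"
        using J[of 0] J[of t] \<delta> unfolding eq
        by (cases "t > \<delta>") (auto simp: heat_add bounded_borel_heat[OF bb])
    qed
  qed
  ultimately show ?thesis
    unfolding hlap_def by (simp add: filterlim_cong[OF refl refl])
qed

lemma hlap_pot: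
  assumes q: "fast_decay \<beta> (q::'a \<Rightarrow> real) M"
  shows "hlap s (\<lambda>x. \<gamma> + pot s q x) x (marchaud_const s * q x)"
proof -
  have "heat 0 (\<lambda>x. \<gamma> + pot s q x) = (\<lambda>x. \<gamma> + pot s q x)" by (rule ext) simp
  then show ?thesis using hlap_heat_pot[OF q, of 0 \<gamma> x] by simp
qed

end

section \<open>Comparison and sign change for \<open>hlap\<close>\<close>

lemma integrable_hlap:
  assumes bb: "bounded_borel \<psi>" and s: "s > 0" and \<delta>: "\<delta> > 0"
  shows "integrable lborel (\<lambda>t. indicator {\<delta><..} t * ((\<psi> x - heat t \<psi> x) * t powr (- 1 - s)))"
proof -
  note [measurable] = bounded_borel_measurable[OF bb]
  obtain M where M: "M \<ge> 0" "\<And>x. \<bar>\<psi> x\<bar> \<le> M" using bb by (metis bounded_borelE)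
  show ?thesis
  proof (rule Bochner_Integration.integrable_bound)
    show "integrable lborel (\<lambda>t. 2 * M * (indicator {\<delta>..} t * t powr (- 1 - s)))"
      using has_bochner_integral_powr_inf[of "- 1 - s" \<delta>] s \<delta> by (intro integrable_mult_right) (auto simp: has_bochner_integral_iff)
    show "AE t in lborel. norm (indicator {\<delta><..} t * ((\<psi> x - heat t \<psi> x) * t powr (- 1 - s)))
      \<le> norm (2 * M * (indicator {\<delta>..} t * t powr (- 1 - s)))" (is "AE t in _. ?P t")
    proof (intro always_eventually allI)
      fix t :: real
      have "\<bar>\<psi> x - heat t \<psi> x\<bar> \<le> 2 * M"
        using M(2)[of x] heat_abs_le[OF bb M(2), of t x] by linarith
      then have "\<bar>\<psi> x - heat t \<psi> x\<bar> * t powr (- 1 - s) \<le> 2 * M * t powr (- 1 - s)"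
        by (intro mult_right_mono) auto
      then show "?P t"
        using M(1) by (auto simp: abs_mult indicator_def)
    qed
  qed measurable
qed

text \<open>\<open>heat\<close> preserves order and constants, so the inequality between increments
  from \<open>x\<close> passes to
  \<open>\<psi> x - heat t \<psi> x \<le> \<xi> x - heat t \<xi> x\<close> for every
  \<open>t\<close>. No smoothness is involved, and the values at \<open>x\<close> may
  differ.\<close>

lemma hlap_mono:
  assumes "bounded_borel \<psi>" "bounded_borel \<xi>" and s: "s > 0"
    and le: "\<And>y. \<xi> y - \<xi> x \<le> \<psi> y - \<psi> x"
    and l: "hlap s \<psi> x l" and l': "hlap s \<xi> x l'"
  shows "l \<le> l'"
proof (rule tendsto_le[OF _ l'[unfolded hlap_def] l[unfolded hlap_def]])
  show "\<forall>\<^sub>F \<delta> in at_right 0. (LBINT t. indicator {\<delta><..} t * ((\<psi> x - heat t \<psi> x) * t powr (- 1 - s)))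
    \<le> (LBINT t. indicator {\<delta><..} t * ((\<xi> x - heat t \<xi> x) * t powr (- 1 - s)))"
    using eventually_at_right_less
  proof eventually_elim
    fix \<delta> :: real assume \<delta>: "\<delta> > 0"
    have "\<psi> x - heat t \<psi> x \<le> \<xi> x - heat t \<xi> x" for t
    proof -
      have "heat t (\<lambda>y. \<xi> y - \<xi> x) x \<le> heat t (\<lambda>y. \<psi> y - \<psi> x) x"
        using assms by (intro heat_mono bounded_borel_diff) auto
      then show ?thesis using assms by (simp add: heat_diff)
    qed
    then show "(LBINT t. indicator {\<delta><..} t * ((\<psi> x - heat t \<psi> x) * t powr (- 1 - s)))
      \<le> (LBINT t. indicator {\<delta><..} t * ((\<xi> x - heat t \<xi> x) * t powr (- 1 - s)))"
      using assms \<delta> by (intro integral_mono integrable_hlap mult_left_mono mult_right_mono) auto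
  qed
qed simp

lemma hlap_uminus:
  assumes "hlap s \<psi> x l" shows "hlap s (\<lambda>x. - \<psi> x) x (- l)"
proof -
  have "indicator {\<delta><..} t * ((- \<psi> x - heat t (\<lambda>x. - \<psi> x) x) * t powr (- 1 - s)) =
    - (indicator {\<delta><..} t * ((\<psi> x - heat t \<psi> x) * t powr (- 1 - s)))" for \<delta> t :: real
    by (simp add: heat_uminus algebra_simps)
  then show ?thesis using tendsto_minus[OF assms[unfolded hlap_def]] unfolding hlap_def by simp
qed

lemma hlap_at_max:
  assumes "bounded_borel \<psi>" "s > 0" "\<And>y. \<psi> y \<le> \<psi> x" "hlap s \<psi> x l"
  shows "0 \<le> l"
  using assms(3) by (intro hlap_mono[OF _ assms(1,2) _ _ assms(4), of "\<lambda>_. 0"]) (auto simp: hlap_def)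

section \<open>The fractional Laplacian in terms of the heat semigroup\<close>

text \<open>Equal to \<open>Gamma (N / 2 + s)\<close>, as replacing \<open>t\<close> by
  \<open>1 / t\<close> shows; the arguments below use that it is finite and positive.\<close>

definition kernel_mass :: "real \<Rightarrow> real \<Rightarrow> real" where
  "kernel_mass N s = (LBINT t. indicator {0<..} t * (t powr (- N / 2 - 1 - s) * exp (- 1 / t)))"

lemma integrable_kernel_mass:
  assumes "N \<ge> 0" "s > 0"
  shows "integrable lborel (\<lambda>t::real. indicator {0<..} t * (t powr (- N / 2 - 1 - s) * exp (- 1 / t)))"
proof -
  \<comment> \<open>With this \<open>m\<close> the bound of \<open>exp (- 1 / t)\<close> by
    \<open>fact m * t powr m\<close> outweighs the singular power and leaves a bounded integrand on
    the unit interval.\<close>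
  obtain m :: nat where m: "real m \<ge> N / 2 + 1 + s" using real_arch_simple by blast
  show ?thesis
  proof (rule Bochner_Integration.integrable_bound)
    show "integrable lborel (\<lambda>t::real. fact m * (indicator {0..1} t * t powr 0) + indicator {1..} t * t powr (- N / 2 - 1 - s))"
      using has_bochner_integral_powr_0_1[of 0] has_bochner_integral_powr_inf[of "- N / 2 - 1 - s" 1] assms
      by (intro Bochner_Integration.integrable_add integrable_mult_right) (auto simp: has_bochner_integral_iff)
    show "AE t in lborel. norm (indicator {0<..} t * (t powr (- N / 2 - 1 - s) * exp (- 1 / t)))
      \<le> norm (fact m * (indicator {0..1} t * t powr 0) + indicator {1..} t * t powr (- N / 2 - 1 - s) :: real)" (is "AE t in _. ?P t")
    proof (intro always_eventually allI)
      fix t :: real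
      consider "t \<le> 0" | "0 < t" "t \<le> 1" | "t > 1" by linarith
      then show "?P t"
      proof cases
        case 2
        have "(1 / t) ^ m / fact m \<le> exp (1 / t)" using 2 by (intro power_over_fact_le_exp) auto
        then have "exp (- 1 / t) \<le> fact m * t powr (real m)"
          using 2 by (simp add: exp_minus powr_realpow power_divide field_simps)
        then have "t powr (- N / 2 - 1 - s) * exp (- 1 / t) \<le> t powr (- N / 2 - 1 - s) * (fact m * t powr (real m))"
          by (intro mult_left_mono) auto
        also have "\<dots> = fact m * t powr (real m - (N / 2 + 1 + s))"
          by (simp add: powr_add[symmetric] algebra_simps)
        also have "\<dots> \<le> fact m * 1"
          using 2 m by (intro mult_left_mono powr_le1) auto
        finally show ?thesis using 2 by (auto simp: indicator_def)
      next
        case 3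
        have "t powr (- N / 2 - 1 - s) * exp (- 1 / t) \<le> t powr (- N / 2 - 1 - s) * 1"
          using 3 by (intro mult_left_mono) auto
        then show ?thesis using 3 by (auto simp: indicator_def)
      qed auto
    qed
  qed measurable
qed

lemma kernel_mass_pos:
  assumes "N \<ge> 0" "s > 0" shows "kernel_mass N s > 0"
proof -
  have "kernel_mass N s \<noteq> 0"
  proof
    assume "kernel_mass N s = 0"
    then have "AE t in lborel. indicator {0<..} t * (t powr (- N / 2 - 1 - s) * exp (- 1 / t)) = (0::real)"
      unfolding kernel_mass_def using integrable_kernel_mass[OF assms]
      by (subst (asm) integral_nonneg_eq_0_iff_AE) auto
    then have "AE t in lborel. t \<notin> {0<..<1::real}"
      by eventually_elim auto
    then have "emeasure lborel {0<..<1::real} = 0"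
    proof (subst (asm) AE_iff_measurable)
      show "{u \<in> space lborel. \<not> u \<notin> {0<..<1::real}} = {0<..<1}" by auto
    qed auto
    then show False by simp
  qed
  moreover have "kernel_mass N s \<ge> 0"
    unfolding kernel_mass_def by (intro Bochner_Integration.integral_nonneg) auto
  ultimately show ?thesis by linarith
qed

definition levy_const :: "'a::euclidean_space itself \<Rightarrow> real \<Rightarrow> real" where
  "levy_const _ s = kernel_mass (real DIM('a)) s / (LBINT y. exp (- (norm (y::'a))\<^sup>2))"

lemma levy_const_pos: "s > 0 \<Longrightarrow> levy_const TYPE('a::euclidean_space) s > 0"
  unfolding levy_const_def by (intro divide_pos_pos kernel_mass_pos gauss_mass_pos) auto

text \<open>Subordination: the time integral of the heat kernel against \<open>t powr (-1-s)\<close> is the kernel of the fractional Laplacian.\<close>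

lemma has_bochner_integral_subordination:
  fixes z :: "'a::euclidean_space"
  assumes z: "z \<noteq> 0" and s: "s > 0"
  shows "has_bochner_integral lborel (\<lambda>t. indicator {0<..} t * (heat_kernel t z * t powr (- 1 - s)))
     (levy_const TYPE('a) s * norm z powr (- (real DIM('a) + 2 * s)))"
proof -
  define N where "N = real DIM('a)"
  define G where "G = (LBINT y. exp (- (norm (y::'a))\<^sup>2))"
  have G: "G > 0" unfolding G_def by (rule gauss_mass_pos)
  \<comment> \<open>The substitution \<open>t = c * u\<close> removes \<open>z\<close> from the
    Gaussian; the power of \<open>c\<close> that comes out is the kernel of the fractional
    Laplacian.\<close>
  define c where "c = (norm z)\<^sup>2"
  have c: "c > 0" using z by (simp add: c_def)
  let ?f = "\<lambda>t. indicator {0<..} t * (heat_kernel t z * t powr (- 1 - s))"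
  let ?k = "\<lambda>t. indicator {0<..} t * (t powr (- N / 2 - 1 - s) * exp (- 1 / t)) :: real"
  have sc: "?f (0 + c * u) = c powr (- N / 2 - 1 - s) / G * ?k u" for u
  proof (cases "u > 0")
    case True
    have "exp (- (norm (z /\<^sub>R sqrt (c * u)))\<^sup>2) = exp (- 1 / u)"
      using True c by (simp add: power_mult_distrib power_divide c_def divide_simps)
    then have hk: "heat_kernel (c * u) z = (c * u) powr (- N / 2) * (exp (- 1 / u) / G)"
      unfolding heat_kernel_def gauss_kernel_def G_def N_def by simp
    have "(c * u) powr (- N / 2) * (c * u) powr (- 1 - s) = (c * u) powr (- N / 2 - 1 - s)"
      unfolding powr_add[symmetric] by (rule arg_cong[where f = "\<lambda>e. (c * u) powr e"]) simp
    also have "\<dots> = c powr (- N / 2 - 1 - s) * u powr (- N / 2 - 1 - s)"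
      using True c by (simp add: powr_mult)
    finally have e: "(c * u) powr (- N / 2) * (c * u) powr (- 1 - s) = c powr (- N / 2 - 1 - s) * u powr (- N / 2 - 1 - s)" .
    have "heat_kernel (c * u) z * (c * u) powr (- 1 - s) = ((c * u) powr (- N / 2) * (c * u) powr (- 1 - s)) * (exp (- 1 / u) / G)"
      unfolding hk by (simp add: mult_ac)
    also have "\<dots> = c powr (- N / 2 - 1 - s) / G * (u powr (- N / 2 - 1 - s) * exp (- 1 / u))"
      unfolding e by (simp add: mult_ac)
    finally show ?thesis using True c by simp
  next
    case False
    then show ?thesis using c by (simp add: zero_less_mult_iff)
  qed
  have i: "integrable lborel (\<lambda>u. ?f (0 + c * u))"
    unfolding sc using integrable_kernel_mass[of N s] s by (intro integrable_mult_right) (auto simp: N_def)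
  then have 1: "integrable lborel ?f"
    using lborel_integrable_real_affine_iff[of c ?f 0] c by simp
  have "(LBINT t. ?f t) = \<bar>c\<bar> * (LBINT u. ?f (0 + c * u))"
    using lborel_integral_real_affine[of c ?f 0] c by simp
  also have "\<dots> = c * (c powr (- N / 2 - 1 - s) / G * kernel_mass N s)"
    unfolding sc kernel_mass_def using c by (subst integral_mult_right_zero) simp
  also have "c * (c powr (- N / 2 - 1 - s) / G * kernel_mass N s) = (c powr 1 * c powr (- N / 2 - 1 - s)) * (kernel_mass N s / G)"
    using c by simp
  also have "c powr 1 * c powr (- N / 2 - 1 - s) = norm z powr (- (N + 2 * s))"
  proof -
    have "c = norm z powr 2" using z by (simp add: c_def powr_numeral)
    then have e: "c powr (- N / 2 - s) = norm z powr (2 * (- N / 2 - s))" by (simp only: powr_powr)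
    have "c powr 1 * c powr (- N / 2 - 1 - s) = c powr (- N / 2 - s)"
      unfolding powr_add[symmetric] by simp
    then show ?thesis unfolding e by (simp add: algebra_simps)
  qed
  finally have 2: "(LBINT t. ?f t) = norm z powr (- (N + 2 * s)) * (kernel_mass N s / G)" .
  show ?thesis
    using 1 2 by (simp add: has_bochner_integral_iff levy_const_def N_def G_def mult.commute)
qed

text \<open>Minus one half of the second central difference. Replacing
  \<open>\<psi> x - \<psi> (x + z)\<close> by its even part in \<open>z\<close> turns the principal
  value into an absolutely convergent integral.\<close>

definition sym_diff2 :: "('a::real_vector \<Rightarrow> real) \<Rightarrow> 'a \<Rightarrow> 'a \<Rightarrow> real" where
  "sym_diff2 \<psi> x z = \<psi> x - (\<psi> (x + z) + \<psi> (x - z)) / 2"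

text \<open>The linear terms at \<open>z\<close> and \<open>- z\<close> cancel. Each first-order
  remainder is quadratic by the mean value inequality for \<open>\<phi>\<close> minus its
  linearisation, since near \<open>x\<close> the norm of \<open>D y - D x\<close> is at most a
  multiple of \<open>norm (y - x)\<close>.\<close>

lemma sym_diff2_C2_le:
  fixes \<phi> :: "'a::euclidean_space \<Rightarrow> real"
  assumes "C2 \<phi>"
  obtains C r where "r > 0" "C \<ge> 0" "\<And>z. norm z < r \<Longrightarrow> \<bar>sym_diff2 \<phi> x z\<bar> \<le> C * (norm z)\<^sup>2"
proof -
  obtain D :: "'a \<Rightarrow> 'a \<Rightarrow>\<^sub>L real" and D2 where D: "\<And>x. (\<phi> has_derivative blinfun_apply (D x)) (at x)"
    and D2: "\<And>x. (D has_derivative blinfun_apply (D2 x)) (at x)"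
    using assms unfolding C2_def by blast
  obtain d where d: "d > 0" "\<And>y. norm (y - x) < d \<Longrightarrow> norm (D y - D x - D2 x (y - x)) \<le> 1 * norm (y - x)"
    using D2[of x] unfolding has_derivative_at_alt by (metis zero_less_one)
  \<comment> \<open>The 1 is the tolerance with which the differentiability of \<open>D\<close> at
    \<open>x\<close> was used above.\<close>
  define M where "M = 1 + norm (D2 x)"
  have M: "norm (D y - D x) \<le> M * norm (y - x)" if "norm (y - x) < d" for y
  proof -
    have "norm (D y - D x) \<le> norm (D y - D x - D2 x (y - x)) + norm (D2 x (y - x))"
      using norm_triangle_ineq[of "D y - D x - D2 x (y - x)" "D2 x (y - x)"] by simp
    also have "\<dots> \<le> 1 * norm (y - x) + norm (D2 x) * norm (y - x)"
      using d(2)[OF that] norm_blinfun by (intro add_mono) auto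
    finally show ?thesis by (simp add: M_def algebra_simps)
  qed
  have T: "\<bar>\<phi> (x + z) - \<phi> x - D x z\<bar> \<le> M * (norm z)\<^sup>2" if z: "norm z < d" for z
  proof -
    let ?g = "\<lambda>y. \<phi> y - D x (y - x)"
    have "norm (?g (x + z) - ?g x) \<le> M * norm z * norm ((x + z) - x)"
    proof (rule differentiable_bound[where S = "cball x (norm z)" and f' = "\<lambda>y h. D y h - D x h"])
      show "(?g has_derivative (\<lambda>h. D y h - D x h)) (at y within cball x (norm z))" for y
        by (auto intro!: derivative_eq_intros has_derivative_at_withinI[OF D] simp: blinfun.bilinear_simps)
      fix y assume "y \<in> cball x (norm z)"
      then have y: "norm (y - x) \<le> norm z" by (simp add: dist_norm norm_minus_commute)
      have "onorm (\<lambda>h. D y h - D x h) = norm (D y - D x)"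
        by (simp add: norm_blinfun.rep_eq minus_blinfun.rep_eq)
      also have "\<dots> \<le> M * norm (y - x)" using M y z by simp
      also have "\<dots> \<le> M * norm z" using y by (intro mult_left_mono) (auto simp: M_def)
      finally show "onorm (\<lambda>h. D y h - D x h) \<le> M * norm z" .
    qed (auto simp: dist_norm)
    then show ?thesis by (simp add: power2_eq_square blinfun.bilinear_simps mult.assoc)
  qed
  show ?thesis
  proof (rule that[of d M])
    fix z :: 'a assume z: "norm z < d"
    have "sym_diff2 \<phi> x z = - ((\<phi> (x + z) - \<phi> x - D x z) + (\<phi> (x + - z) - \<phi> x - D x (- z))) / 2"
      by (simp add: sym_diff2_def blinfun.bilinear_simps field_simps)
    moreover have "\<bar>\<phi> (x + - z) - \<phi> x - D x (- z)\<bar> \<le> M * (norm z)\<^sup>2" using T[of "- z"] z by simp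
    moreover have "\<bar>- (a + b) / 2\<bar> \<le> m" if "\<bar>a\<bar> \<le> m" "\<bar>b\<bar> \<le> m" for a b m :: real
      using that by (simp add: abs_le_iff field_simps)
    ultimately show "\<bar>sym_diff2 \<phi> x z\<bar> \<le> M * (norm z)\<^sup>2" using T[OF z] by metis
  qed (use d in \<open>auto simp: M_def\<close>)
qed

text \<open>The heat kernel is even and has mass 1.\<close>

lemma heat_sym_diff2:
  fixes \<psi> :: "'a::euclidean_space \<Rightarrow> real"
  assumes bb: "bounded_borel \<psi>" and t: "t > 0"
  shows "\<psi> x - heat t \<psi> x = (LBINT z. heat_kernel t z * sym_diff2 \<psi> x z)"
proof -
  note [measurable] = bounded_borel_measurable[OF bb]
  obtain M where M: "M \<ge> 0" "\<And>x. \<bar>\<psi> x\<bar> \<le> M" using bb by (metis bounded_borelE)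
  have i: "integrable lborel (\<lambda>z. heat_kernel t z * \<psi> (x + z))" (is "integrable _ ?p")
  proof (rule Bochner_Integration.integrable_bound)
    show "integrable lborel (\<lambda>z::'a. heat_kernel t z * M)" using integrable_heat_kernel[OF t, where 'a = 'a] by simp
    show "AE z in lborel. norm (heat_kernel t z * \<psi> (x + z)) \<le> norm (heat_kernel t z * M)"
      using M by (auto simp: abs_mult intro!: mult_left_mono)
  qed measurable
  have i': "integrable lborel (\<lambda>z. heat_kernel t z * \<psi> (x - z))"
    using lborel_integrable_affine[OF i, of "-1" 0] by simp
  have r: "(LBINT z. heat_kernel t z * \<psi> (x - z)) = heat t \<psi> x"
    using lborel_integral_affine[of ?p "-1" 0] heat_density[OF _ t, of \<psi> x] by simp
  have "(LBINT z. heat_kernel t z * sym_diff2 \<psi> x z) =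
    (LBINT z. heat_kernel t z * \<psi> x - (heat_kernel t z * \<psi> (x + z) + heat_kernel t z * \<psi> (x - z)) / 2)"
    by (simp add: sym_diff2_def algebra_simps add_divide_distrib)
  also have "\<dots> = \<psi> x - (heat t \<psi> x + heat t \<psi> x) / 2"
    using i i' r integrable_heat_kernel[OF t, where 'a = 'a] heat_density[OF _ t, of \<psi> x]
    by (subst Bochner_Integration.integral_diff) (auto simp: integral_heat_kernel[OF t])
  finally show ?thesis by simp
qed

text \<open>Twice differentiability is replaced by the quadratic bound near 0 that follows from it;
  this is what glued functions, smooth only around \<open>x\<close>, provide.\<close>

context
  fixes \<psi> :: "'a::euclidean_space \<Rightarrow> real" and x :: 'a and s C r :: real
  assumes bb: "bounded_borel \<psi>" and s: "0 < s" "s < 1"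
    and r: "r > 0" and C: "C \<ge> 0" "\<And>z. norm z < r \<Longrightarrow> \<bar>sym_diff2 \<psi> x z\<bar> \<le> C * (norm z)\<^sup>2"
begin

private definition pv :: real where
  "pv = (LBINT z. sym_diff2 \<psi> x z * norm z powr (- (real DIM('a) + 2 * s)))"

private lemma sym_diff2_measurable[measurable]: "sym_diff2 \<psi> x \<in> borel_measurable borel"
proof -
  note [measurable] = bounded_borel_measurable[OF bb]
  show ?thesis unfolding sym_diff2_def by measurable
qed

private lemma sym_diff2_bounded: obtains M where "M \<ge> 0" "\<And>z. \<bar>sym_diff2 \<psi> x z\<bar> \<le> M"
proof -
  obtain M where M: "M \<ge> 0" "\<And>x. \<bar>\<psi> x\<bar> \<le> M" using bb by (metis bounded_borelE)
  have "\<bar>sym_diff2 \<psi> x z\<bar> \<le> 2 * M" for z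
    unfolding sym_diff2_def using M(2)[of x] M(2)[of "x + z"] M(2)[of "x - z"] M(1)
    by (simp add: abs_le_iff field_simps)
  with M(1) that[of "2 * M"] show ?thesis by simp
qed

text \<open>Near 0 the integrand is of order \<open>norm z powr (2 - N - 2 * s)\<close>, integrable
  because \<open>s < 1\<close>; far out the second difference is bounded and \<open>s > 0\<close>
  suffices.\<close>

private lemma integrable_pv: "integrable lborel (\<lambda>z. sym_diff2 \<psi> x z * norm z powr (- (real DIM('a) + 2 * s)))"
proof -
  obtain M where M: "M \<ge> 0" "\<And>z. \<bar>sym_diff2 \<psi> x z\<bar> \<le> M" by (rule sym_diff2_bounded) blast
  define N where "N = real DIM('a)"
  \<comment> \<open>The quadratic bound is known for \<open>norm z < r\<close> only; beyond that
    radius, inside the unit ball, it follows from boundedness at the price of the factor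
    \<open>1 / (min r 1)\<^sup>2\<close>.\<close>
  define K where "K = max C (M / (min r 1)\<^sup>2)"
  define K' where "K' = max K M"
  have rr: "min r 1 > 0" using r by simp
  show ?thesis
  proof (rule Bochner_Integration.integrable_bound)
    show "integrable lborel (\<lambda>z::'a. K' * (indicator (ball 0 1) z * norm z powr (- (N + 2 * s - 2)) + indicator (- ball 0 1) z * norm z powr (- (N + 2 * s))))"
      using s unfolding N_def
      by (intro integrable_mult_right Bochner_Integration.integrable_add integrable_norm_powr_ball integrable_norm_powr_outside) auto
    show "AE z in lborel. norm (sym_diff2 \<psi> x z * norm z powr (- (real DIM('a) + 2 * s)))
      \<le> norm (K' * (indicator (ball 0 1) z * norm z powr (- (N + 2 * s - 2)) + indicator (- ball 0 1) z * norm z powr (- (N + 2 * s))))" (is "AE z in _. ?P z")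
    proof (intro always_eventually allI)
      fix z :: 'a
      have K': "K' \<ge> 0" "K' \<ge> M" "K' \<ge> K" using M by (auto simp: K'_def)
      consider "z = 0" | "z \<noteq> 0" "norm z < 1" | "norm z \<ge> 1" by linarith
      then show "?P z"
      proof cases
        case 2
        have "\<bar>sym_diff2 \<psi> x z\<bar> \<le> K * (norm z)\<^sup>2"
        proof (cases "norm z < r")
          case True
          have "C * (norm z)\<^sup>2 \<le> K * (norm z)\<^sup>2" by (intro mult_right_mono) (auto simp: K_def)
          then show ?thesis using C(2)[OF True] by linarith
        next
          case False
          have "(min r 1)\<^sup>2 \<le> (norm z)\<^sup>2" using False rr by (intro power_mono) auto
          then have "M / (min r 1)\<^sup>2 * (min r 1)\<^sup>2 \<le> K * (norm z)\<^sup>2"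
            using M by (intro mult_mono) (auto simp: K_def le_max_iff_disj)
          then show ?thesis using M(2)[of z] rr by simp
        qed
        also have "\<dots> \<le> K' * (norm z)\<^sup>2" using K' by (intro mult_right_mono) auto
        also have "(norm z)\<^sup>2 = norm z powr 2" using 2 by (simp add: powr_numeral)
        finally have "\<bar>sym_diff2 \<psi> x z\<bar> * norm z powr (- (N + 2 * s)) \<le> K' * norm z powr 2 * norm z powr (- (N + 2 * s))"
          by (intro mult_right_mono) auto
        also have "\<dots> = K' * norm z powr (- (N + 2 * s - 2))"
          unfolding mult.assoc powr_add[symmetric] by (simp add: algebra_simps)
        finally show ?thesis using 2 K' by (simp add: abs_mult N_def)
      next
        case 3
        have "\<bar>sym_diff2 \<psi> x z\<bar> * norm z powr (- (N + 2 * s)) \<le> K' * norm z powr (- (N + 2 * s))"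
          using M(2)[of z] K' by (intro mult_right_mono) auto
        then show ?thesis using 3 K' by (simp add: abs_mult N_def)
      qed simp
    qed
  qed measurable
qed

text \<open>Fubini turns the truncated time integral into one of \<open>sym_diff2 \<psi> x\<close>
  against \<open>k \<delta>\<close>, the subordination integral cut off at \<open>\<delta>\<close>.
  This stays below the full kernel and tends to it, so \<open>integrable_pv\<close> supplies the
  majorant for the limit.\<close>

private lemma hlap_pv: "hlap s \<psi> x (levy_const TYPE('a) s * pv)"
proof -
  note [measurable] = bounded_borel_measurable[OF bb]
  obtain M where M: "M \<ge> 0" "\<And>z. \<bar>sym_diff2 \<psi> x z\<bar> \<le> M" by (rule sym_diff2_bounded) blast
  let ?N = "real DIM('a)"
  define k where "k \<delta> z = (LBINT t. indicator {\<delta><..} t * (heat_kernel t z * t powr (- 1 - s)))" for \<delta> and z :: 'a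
  have km[measurable]: "k \<delta> \<in> borel_measurable borel" for \<delta>
    unfolding k_def by measurable
  note sub = has_bochner_integral_subordination[OF _ s(1), where 'a = 'a]
  have k_le: "\<bar>k \<delta> z\<bar> \<le> levy_const TYPE('a) s * norm z powr (- (?N + 2 * s))" if "z \<noteq> 0" "\<delta> > 0" for \<delta> z
  proof -
    have si: "integrable lborel (\<lambda>t. indicator {0<..} t * (heat_kernel t z * t powr (- 1 - s)))"
      using sub[OF that(1)] by (simp add: has_bochner_integral_iff)
    have "\<bar>k \<delta> z\<bar> \<le> (LBINT t. \<bar>indicator {\<delta><..} t * (heat_kernel t z * t powr (- 1 - s))\<bar>)"
      unfolding k_def by (rule integral_abs_bound)
    also have "\<dots> \<le> (LBINT t. indicator {0<..} t * (heat_kernel t z * t powr (- 1 - s)))"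
      using that by (intro integral_mono' si) (auto simp: indicator_def)
    also have "\<dots> = levy_const TYPE('a) s * norm z powr (- (?N + 2 * s))"
      using sub[OF that(1)] by (simp add: has_bochner_integral_iff)
    finally show ?thesis .
  qed
  have swap: "(LBINT t. indicator {\<delta><..} t * ((\<psi> x - heat t \<psi> x) * t powr (- 1 - s))) = (LBINT z. sym_diff2 \<psi> x z * k \<delta> z)"
    if \<delta>: "\<delta> > 0" for \<delta>
  proof -
    let ?f = "\<lambda>t z. indicator {\<delta><..} t * (heat_kernel t z * sym_diff2 \<psi> x z * t powr (- 1 - s))"
    have "(LBINT t. indicator {\<delta><..} t * ((\<psi> x - heat t \<psi> x) * t powr (- 1 - s))) = (LBINT t. (LBINT z. ?f t z))"
    proof (intro Bochner_Integration.integral_cong refl)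
      fix t :: real
      show "indicator {\<delta><..} t * ((\<psi> x - heat t \<psi> x) * t powr (- 1 - s)) = (LBINT z. ?f t z)"
      proof (cases "t > \<delta>")
        case True
        then show ?thesis using heat_sym_diff2[OF bb, of t x] \<delta> by simp
      qed simp
    qed
    also have "\<dots> = (LBINT z. (LBINT t. ?f t z))"
    proof -
      have fm: "(\<lambda>(t, z). ?f t z) \<in> borel_measurable (lborel \<Otimes>\<^sub>M lborel)" by measurable
      have pi: "integrable lborel (\<lambda>t. indicator {\<delta>..} t * t powr (- 1 - s))"
        using has_bochner_integral_powr_inf[of "- 1 - s" \<delta>] s \<delta> by (auto simp: has_bochner_integral_iff)
      have zi: "integrable lborel (\<lambda>z. ?f t z)" for t
      proof (cases "t > \<delta>")
        case True
        then have t: "t > 0" using \<delta> by simp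
        show ?thesis
        proof (rule Bochner_Integration.integrable_bound)
          show "integrable lborel (\<lambda>z::'a. heat_kernel t z * (M * t powr (- 1 - s)))"
            using integrable_heat_kernel[OF t, where 'a = 'a] by simp
          show "AE z in lborel. norm (?f t z) \<le> norm (heat_kernel t z * (M * t powr (- 1 - s)))"
            using M True by (auto simp: abs_mult mult.assoc intro!: mult_left_mono mult_right_mono)
        qed measurable
      qed simp
      have "integrable (lborel \<Otimes>\<^sub>M lborel) (\<lambda>(t, z). ?f t z)"
      proof (rule lborel_pair.Fubini_integrable[OF fm])
        show "integrable lborel (\<lambda>t. LBINT z. norm (case (t, z) of (t, z) \<Rightarrow> ?f t z))"
        proof (rule Bochner_Integration.integrable_bound)
          show "integrable lborel (\<lambda>t. M * (indicator {\<delta>..} t * t powr (- 1 - s)))" using pi by simp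
          show "AE t in lborel. norm (LBINT z. norm (case (t, z) of (t, z) \<Rightarrow> ?f t z)) \<le> norm (M * (indicator {\<delta>..} t * t powr (- 1 - s)))" (is "AE t in _. ?P t")
          proof (intro always_eventually allI)
            fix t :: real
            show "?P t"
            proof (cases "t > \<delta>")
              case True
              then have t: "t > 0" using \<delta> by simp
              have "(LBINT z. norm (?f t z)) \<le> (LBINT z. heat_kernel t (z::'a) * (M * t powr (- 1 - s)))"
                using integrable_heat_kernel[OF t, where 'a = 'a] zi[of t] M True
                by (intro integral_mono integrable_norm) (auto simp: abs_mult mult.assoc intro!: mult_left_mono mult_right_mono)
              also have "\<dots> = M * t powr (- 1 - s)" by (simp add: integral_heat_kernel[OF t])
              finally show ?thesis using True M by simp
            qed simp
          qed
        qed measurable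
      qed (use zi in simp)
      from lborel_pair.Fubini_integral[OF this] show ?thesis by simp
    qed
    also have "\<dots> = (LBINT z. sym_diff2 \<psi> x z * k \<delta> z)"
    proof (intro Bochner_Integration.integral_cong refl)
      fix z
      have "(LBINT t. ?f t z) = (LBINT t. sym_diff2 \<psi> x z * (indicator {\<delta><..} t * (heat_kernel t z * t powr (- 1 - s))))"
        by (simp add: mult_ac)
      then show "(LBINT t. ?f t z) = sym_diff2 \<psi> x z * k \<delta> z"
        unfolding k_def by simp
    qed
    finally show ?thesis .
  qed
  have "((\<lambda>\<delta>. LBINT t. indicator {\<delta><..} t * ((\<psi> x - heat t \<psi> x) * t powr (- 1 - s))) \<longlongrightarrow> levy_const TYPE('a) s * pv) (at_right 0)"
  proof (rule tendsto_at_right_sequentially[of _ 1])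
    fix S :: "nat \<Rightarrow> real" assume S: "\<And>n. 0 < S n" "S \<longlonglongrightarrow> 0"
    have "(\<lambda>n. LBINT z. sym_diff2 \<psi> x z * k (S n) z) \<longlonglongrightarrow>
      (LBINT z. sym_diff2 \<psi> x z * (levy_const TYPE('a) s * norm z powr (- (?N + 2 * s))))"
    proof (rule integral_dominated_convergence[where w = "\<lambda>z. levy_const TYPE('a) s * norm (sym_diff2 \<psi> x z * norm z powr (- (?N + 2 * s)))"])
      show "integrable lborel (\<lambda>z. levy_const TYPE('a) s * norm (sym_diff2 \<psi> x z * norm z powr (- (?N + 2 * s))))"
        using integrable_norm[OF integrable_pv] by (intro integrable_mult_right) auto
      show "AE z in lborel. norm (sym_diff2 \<psi> x z * k (S n) z) \<le> levy_const TYPE('a) s * norm (sym_diff2 \<psi> x z * norm z powr (- (?N + 2 * s)))" for n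
        using AE_lborel_singleton[of 0]
      proof eventually_elim
        fix z :: 'a assume "z \<noteq> 0"
        then have "\<bar>sym_diff2 \<psi> x z\<bar> * \<bar>k (S n) z\<bar> \<le> \<bar>sym_diff2 \<psi> x z\<bar> * (levy_const TYPE('a) s * norm z powr (- (?N + 2 * s)))"
          using S by (intro mult_left_mono k_le) auto
        then show "norm (sym_diff2 \<psi> x z * k (S n) z) \<le> levy_const TYPE('a) s * norm (sym_diff2 \<psi> x z * norm z powr (- (?N + 2 * s)))"
          by (simp add: abs_mult mult_ac)
      qed
      show "AE z in lborel. (\<lambda>n. sym_diff2 \<psi> x z * k (S n) z) \<longlonglongrightarrow> sym_diff2 \<psi> x z * (levy_const TYPE('a) s * norm z powr (- (?N + 2 * s)))"
        using AE_lborel_singleton[of 0]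
      proof eventually_elim
        fix z :: 'a assume z: "z \<noteq> 0"
        have "(\<lambda>n. k (S n) z) \<longlonglongrightarrow> (LBINT t. indicator {0<..} t * (heat_kernel t z * t powr (- 1 - s)))"
          unfolding k_def
        proof (rule integral_dominated_convergence[where w = "\<lambda>t. indicator {0<..} t * (heat_kernel t z * t powr (- 1 - s))"])
          show "integrable lborel (\<lambda>t. indicator {0<..} t * (heat_kernel t z * t powr (- 1 - s)))"
            using sub[OF z] by (simp add: has_bochner_integral_iff)
          show "AE t in lborel. norm (indicator {S n<..} t * (heat_kernel t z * t powr (- 1 - s))) \<le> indicator {0<..} t * (heat_kernel t z * t powr (- 1 - s))" for n
            using S(1)[of n] by (auto simp: indicator_def)
          show "AE t in lborel. (\<lambda>n. indicator {S n<..} t * (heat_kernel t z * t powr (- 1 - s))) \<longlonglongrightarrow> indicator {0<..} t * (heat_kernel t z * t powr (- 1 - s))" (is "AE t in _. ?P t")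
          proof (intro always_eventually allI)
            fix t :: real
            show "?P t"
            proof (cases "t > 0")
              case True
              then have "\<forall>\<^sub>F n in sequentially. S n < t" using S(2) by (auto simp: order_tendsto_iff)
              then have "\<forall>\<^sub>F n in sequentially. indicator {0<..} t * (heat_kernel t z * t powr (- 1 - s)) = indicator {S n<..} t * (heat_kernel t z * t powr (- 1 - s))"
                by eventually_elim (use True in auto)
              then show ?thesis by (rule Lim_transform_eventually[OF tendsto_const])
            next
              case False
              then have "\<not> S n < t" for n using S(1)[of n] by linarith
              then show ?thesis using False by simp
            qed
          qed
        qed measurable
        then show "(\<lambda>n. sym_diff2 \<psi> x z * k (S n) z) \<longlonglongrightarrow> sym_diff2 \<psi> x z * (levy_const TYPE('a) s * norm z powr (- (?N + 2 * s)))"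
          using sub[OF z] by (intro tendsto_mult tendsto_const) (simp add: has_bochner_integral_iff)
      qed
    qed measurable
    also have "(LBINT z. sym_diff2 \<psi> x z * (levy_const TYPE('a) s * norm z powr (- (?N + 2 * s)))) = levy_const TYPE('a) s * pv"
      unfolding pv_def by (subst mult.left_commute) (rule integral_mult_right_zero)
    finally show "(\<lambda>n. LBINT t. indicator {S n<..} t * ((\<psi> x - heat t \<psi> x) * t powr (- 1 - s))) \<longlonglongrightarrow> levy_const TYPE('a) s * pv"
      unfolding swap[OF S(1)] .
  qed simp
  then show ?thesis unfolding hlap_def .
qed

text \<open>The complement of a ball around \<open>x\<close> is symmetric under reflection in
  \<open>x\<close>, so averaging over \<open>z\<close> and \<open>- z\<close> replaces the first
  difference by the second. Dominated convergence then shows that the limit behind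
  \<open>Lim\<close> exists.\<close>

private lemma frac_laplacian_pv: "frac_laplacian s \<psi> x = frac_lap_const (real DIM('a)) s * pv"
proof -
  note [measurable] = bounded_borel_measurable[OF bb]
  obtain M where M: "M \<ge> 0" "\<And>x. \<bar>\<psi> x\<bar> \<le> M" using bb by (metis bounded_borelE)
  define p where "p = real DIM('a) + 2 * s"
  let ?I = "\<lambda>\<epsilon>. set_lebesgue_integral lebesgue (- ball x \<epsilon>) (\<lambda>y. (\<psi> x - \<psi> y) / norm (x - y) powr p)"
  have I: "?I \<epsilon> = (LBINT z. indicator (- ball 0 \<epsilon>) z * (sym_diff2 \<psi> x z * norm z powr - p))" if \<epsilon>: "\<epsilon> > 0" for \<epsilon>
  proof -
    let ?h = "\<lambda>z. indicator (- ball 0 \<epsilon>) z * ((\<psi> x - \<psi> (x + z)) * norm z powr - p)"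
    have "?I \<epsilon> = (LBINT y. indicator (- ball x \<epsilon>) y * ((\<psi> x - \<psi> y) / norm (x - y) powr p))"
      unfolding set_lebesgue_integral_def by (subst integral_completion) (auto intro!: borel_measurable_times borel_measurable_indicator)
    also have "\<dots> = \<bar>1\<bar> ^ DIM('a) * (LBINT z. indicator (- ball x \<epsilon>) (x + 1 *\<^sub>R z) * ((\<psi> x - \<psi> (x + 1 *\<^sub>R z)) / norm (x - (x + 1 *\<^sub>R z)) powr p))"
      by (intro lborel_integral_affine) (auto intro!: borel_measurable_times borel_measurable_indicator)
    also have "\<dots> = (LBINT z. ?h z)"
      by (auto intro!: Bochner_Integration.integral_cong simp: indicator_def dist_norm powr_minus divide_inverse)
    finally have 1: "?I \<epsilon> = (LBINT z. ?h z)" .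
    have hi: "integrable lborel ?h"
    proof (rule Bochner_Integration.integrable_bound)
      show "integrable lborel (\<lambda>z::'a. 2 * M * (indicator (- ball 0 \<epsilon>) z * norm z powr - p))"
        using \<epsilon> s by (intro integrable_mult_right integrable_norm_powr_outside) (auto simp: p_def)
      show "AE z in lborel. norm (?h z) \<le> norm (2 * M * (indicator (- ball 0 \<epsilon>) z * norm z powr - p))" (is "AE z in _. ?P z")
      proof (intro always_eventually allI)
        fix z
        have "\<bar>\<psi> x - \<psi> (x + z)\<bar> \<le> 2 * M" using M(2)[of x] M(2)[of "x + z"] by linarith
        then have "\<bar>\<psi> x - \<psi> (x + z)\<bar> * norm z powr - p \<le> 2 * M * norm z powr - p" by (intro mult_right_mono) auto
        then show "?P z"
          using M(1) by (auto simp: abs_mult indicator_def)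
      qed
    qed (auto intro!: borel_measurable_times borel_measurable_indicator)
    have h': "integrable lborel (\<lambda>z. ?h (0 + (-1) *\<^sub>R z))" "(LBINT z. ?h z) = \<bar>-1\<bar> ^ DIM('a) * (LBINT z. ?h (0 + (-1) *\<^sub>R z))"
      using hi by (intro lborel_integrable_affine lborel_integral_affine; auto)+
    have "(LBINT z. indicator (- ball 0 \<epsilon>) z * (sym_diff2 \<psi> x z * norm z powr - p)) = (LBINT z. (?h z + ?h (0 + (-1) *\<^sub>R z)) / 2)"
      by (auto intro!: Bochner_Integration.integral_cong simp: sym_diff2_def indicator_def field_simps)
    also have "\<dots> = (LBINT z. ?h z + ?h (0 + (-1) *\<^sub>R z)) / 2" by simp
    also have "\<dots> = ((LBINT z. ?h z) + (LBINT z. ?h (0 + (-1) *\<^sub>R z))) / 2"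
      by (subst Bochner_Integration.integral_add[OF hi h'(1)]) (rule refl)
    also have "\<dots> = (LBINT z. ?h z)" using h'(2) by simp
    finally show ?thesis using 1 by simp
  qed
  have "(?I \<longlongrightarrow> pv) (at_right 0)"
  proof (rule tendsto_at_right_sequentially[of _ 1])
    fix S :: "nat \<Rightarrow> real" assume S: "\<And>n. 0 < S n" "S \<longlonglongrightarrow> 0"
    have "(\<lambda>n. LBINT z. indicator (- ball 0 (S n)) z * (sym_diff2 \<psi> x z * norm z powr - p)) \<longlonglongrightarrow> (LBINT z. sym_diff2 \<psi> x z * norm z powr - p)"
    proof (rule integral_dominated_convergence[where w = "\<lambda>z. norm (sym_diff2 \<psi> x z * norm z powr - p)"])
      show "integrable lborel (\<lambda>z. norm (sym_diff2 \<psi> x z * norm z powr - p))"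
        using integrable_norm[OF integrable_pv] unfolding p_def by simp
      show "AE z in lborel. norm (indicator (- ball 0 (S n)) z * (sym_diff2 \<psi> x z * norm z powr - p)) \<le> norm (sym_diff2 \<psi> x z * norm z powr - p)" for n
        by (auto simp: indicator_def)
      show "AE z in lborel. (\<lambda>n. indicator (- ball 0 (S n)) z * (sym_diff2 \<psi> x z * norm z powr - p)) \<longlonglongrightarrow> sym_diff2 \<psi> x z * norm z powr - p"
        using AE_lborel_singleton[of 0]
      proof eventually_elim
        fix z :: 'a assume z: "z \<noteq> 0"
        have "\<forall>\<^sub>F n in sequentially. S n < norm z" using S(2) z by (auto simp: order_tendsto_iff)
        then have "\<forall>\<^sub>F n in sequentially. sym_diff2 \<psi> x z * norm z powr - p = indicator (- ball 0 (S n)) z * (sym_diff2 \<psi> x z * norm z powr - p)"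
          by eventually_elim auto
        then show "(\<lambda>n. indicator (- ball 0 (S n)) z * (sym_diff2 \<psi> x z * norm z powr - p)) \<longlonglongrightarrow> sym_diff2 \<psi> x z * norm z powr - p"
          by (rule Lim_transform_eventually[OF tendsto_const])
      qed
    qed (auto intro!: borel_measurable_times borel_measurable_indicator)
    then show "(\<lambda>n. ?I (S n)) \<longlonglongrightarrow> pv"
      unfolding I[OF S(1)] unfolding pv_def p_def .
  qed simp
  then have "Lim (at_right 0) ?I = pv" by (intro tendsto_Lim) auto
  then show ?thesis unfolding frac_laplacian_def p_def by simp
qed

lemma frac_laplacian_hlap_aux:
  "hlap s \<psi> x (frac_laplacian s \<psi> x / (frac_lap_const (real DIM('a)) s / levy_const TYPE('a) s))"
proof -
  have "frac_lap_const (real DIM('a)) s > 0"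
    unfolding frac_lap_const_def using s by (intro divide_pos_pos mult_pos_pos Gamma_real_pos) auto
  then have "frac_laplacian s \<psi> x / (frac_lap_const (real DIM('a)) s / levy_const TYPE('a) s) = levy_const TYPE('a) s * pv"
    using levy_const_pos[OF s(1), where 'a = 'a] unfolding frac_laplacian_pv by simp
  then show ?thesis using hlap_pv by simp
qed

end

text \<open>Its value is \<open>4 powr s * s / Gamma (1 - s)\<close>, the 4 coming from the time
  scale of \<open>heat\<close>; what counts is its sign.\<close>

definition lap_ratio :: "'a::euclidean_space itself \<Rightarrow> real \<Rightarrow> real" where
  "lap_ratio _ s = frac_lap_const (real DIM('a)) s / levy_const TYPE('a) s"

lemma lap_ratio_pos:
  assumes "0 < s" "s < 1" shows "lap_ratio TYPE('a::euclidean_space) s > 0"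
  unfolding lap_ratio_def frac_lap_const_def
  using assms by (intro divide_pos_pos mult_pos_pos Gamma_real_pos levy_const_pos) auto

theorem frac_laplacian_hlap:
  fixes \<psi> :: "'a::euclidean_space \<Rightarrow> real"
  assumes bb: "bounded_borel \<psi>" and s: "0 < s" "s < 1"
    and \<phi>: "C2 \<phi>" "open U" "x \<in> U" "\<And>y. y \<in> U \<Longrightarrow> \<psi> y = \<phi> y"
  shows "hlap s \<psi> x (frac_laplacian s \<psi> x / lap_ratio TYPE('a) s)"
proof -
  obtain C r where r: "r > 0" "C \<ge> 0" "\<And>z. norm z < r \<Longrightarrow> \<bar>sym_diff2 \<phi> x z\<bar> \<le> C * (norm z)\<^sup>2"
    using sym_diff2_C2_le[OF \<phi>(1)] by metis
  obtain r' where r': "r' > 0" "ball x r' \<subseteq> U" using \<phi> openE by blast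
  have "\<bar>sym_diff2 \<psi> x z\<bar> \<le> C * (norm z)\<^sup>2" if "norm z < min r r'" for z
  proof -
    have "x + z \<in> U" "x - z \<in> U" using that r' by (auto simp: dist_norm subset_eq)
    then have "sym_diff2 \<psi> x z = sym_diff2 \<phi> x z" using \<phi> by (simp add: sym_diff2_def)
    then show ?thesis using r(3)[of z] that by simp
  qed
  then show ?thesis
    unfolding lap_ratio_def using r r' by (intro frac_laplacian_hlap_aux[OF bb s, of "min r r'" C]) auto
qed

section \<open>Solvability of the linear equation\<close>

text \<open>Method of continuity: the solvability of \<open>u + t K u = h\<close> propagates from \<open>t = 0\<close> to \<open>t = 1\<close> in
  steps whose length depends only on the a priori bound.\<close>

lemma method_of_continuity:
  fixes K :: "'b::{real_normed_vector, complete_space} \<Rightarrow> 'b"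
  assumes K: "bounded_linear K"
    and apriori: "\<And>t u. 0 \<le> t \<Longrightarrow> t \<le> 1 \<Longrightarrow> norm u \<le> C * norm (u + t *\<^sub>R K u)"
  shows "\<exists>u. u + K u = h"
proof -
  interpret K: bounded_linear K by (rule K)
  obtain L where L: "L > 0" "\<And>x. norm (K x) \<le> norm x * L" using K.pos_bounded by blast
  \<comment> \<open>The maximum with 1 is positive whatever the sign of \<open>C\<close>.\<close>
  define C' where "C' = max C 1"
  have C': "C' > 0" unfolding C'_def by simp
  have apriori': "norm u \<le> C' * norm (u + t *\<^sub>R K u)" if "0 \<le> t" "t \<le> 1" for t u
    using apriori[OF that, of u] mult_right_mono[OF max.cobounded1 norm_ge_zero, of C "u + t *\<^sub>R K u" 1]
    unfolding C'_def by linarith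
  \<comment> \<open>Steps of length \<open>1 / n\<close> give the fixed-point map below the
    contraction factor \<open>C' * L / n < 1\<close>.\<close>
  obtain n :: nat where n: "C' * L < real n" using reals_Archimedean2 by blast
  have n0: "real n > 0" using n C' L by (meson less_trans mult_pos_pos)
  have "\<forall>h. \<exists>u. u + (real k / real n) *\<^sub>R K u = h" if "k \<le> n" for k
    using that
  proof (induction k)
    case 0
    then show ?case by auto
  next
    case (Suc k)
    let ?t = "real k / real n"
    have t: "0 \<le> ?t" "?t \<le> 1" using Suc.prems n0 by auto
    obtain S where S: "\<And>h. S h + ?t *\<^sub>R K (S h) = h" using Suc by (metis Suc_leD)
    have Sl: "norm (S h - S h') \<le> C' * norm (h - h')" for h h'
    proof -
      have "(S h - S h') + ?t *\<^sub>R K (S h - S h') = h - h'"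
        using S[of h] S[of h'] by (simp add: K.diff scaleR_diff_right algebra_simps)
      then show ?thesis using apriori'[OF t, of "S h - S h'"] by simp
    qed
    show ?case
    proof
      fix h
      \<comment> \<open>Solving at parameter \<open>?t + 1 / n\<close> is a fixed-point problem for
        the solution operator \<open>S\<close> at \<open>?t\<close>, with the extra term moved to
        the right-hand side. \<open>S\<close> is Lipschitz by the a priori bound applied to
        differences.\<close>
      let ?\<Phi> = "\<lambda>u. S (h - (1 / real n) *\<^sub>R K u)"
      have "\<exists>!u. ?\<Phi> u = u"
      proof (rule banach_fix_type)
        show "0 \<le> C' * L / real n" "C' * L / real n < 1" using C' L n n0 by auto
        show "\<forall>u v. dist (?\<Phi> u) (?\<Phi> v) \<le> C' * L / real n * dist u v"
        proof (intro allI)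
          fix u v
          have "dist (?\<Phi> u) (?\<Phi> v) \<le> C' * norm ((1 / real n) *\<^sub>R K (v - u))"
            using Sl[of "h - (1 / real n) *\<^sub>R K u" "h - (1 / real n) *\<^sub>R K v"]
            by (simp add: dist_norm K.diff scaleR_diff_right)
          also have "\<dots> \<le> C' * ((1 / real n) * (norm (v - u) * L))"
            using L(2)[of "v - u"] n0 C' by (auto intro!: mult_left_mono divide_right_mono)
          finally show "dist (?\<Phi> u) (?\<Phi> v) \<le> C' * L / real n * dist u v"
            by (simp add: dist_norm norm_minus_commute mult_ac)
        qed
      qed
      then obtain u where u: "?\<Phi> u = u" by blast
      have "u + ?t *\<^sub>R K u = h - (1 / real n) *\<^sub>R K u"
        using S[of "h - (1 / real n) *\<^sub>R K u"] unfolding u .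
      moreover have "(real (Suc k) / real n) *\<^sub>R K u = ?t *\<^sub>R K u + (1 / real n) *\<^sub>R K u"
        by (simp add: scaleR_left_distrib[symmetric] add_divide_distrib)
      ultimately have "u + (real (Suc k) / real n) *\<^sub>R K u = h" by (simp add: algebra_simps)
      then show "\<exists>u. u + (real (Suc k) / real n) *\<^sub>R K u = h" by blast
    qed
  qed
  from this[of n] n0 show ?thesis by simp
qed

section \<open>Maximum principle and a priori bound for potentials\<close>

lemma attains_max_at_infinity:
  fixes f :: "'a::euclidean_space \<Rightarrow> real"
  assumes f: "continuous_on UNIV f" "(f \<longlongrightarrow> l) at_infinity" and x1: "f x1 > l"
  obtains x where "\<And>y. f y \<le> f x"
proof -
  have "\<forall>\<^sub>F y in at_infinity. f y < f x1" using f(2) x1 by (simp add: order_tendsto_iff)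
  then obtain R where R: "\<And>y. norm y \<ge> R \<Longrightarrow> f y < f x1" unfolding eventually_at_infinity by blast
  have x1R: "x1 \<in> cball 0 R" using R[of x1] by (cases "norm x1 \<ge> R") auto
  then obtain x where x: "x \<in> cball 0 R" "\<And>y. y \<in> cball 0 R \<Longrightarrow> f y \<le> f x"
    using continuous_attains_sup[of "cball 0 R" f] f(1) continuous_on_subset by (metis compact_cball empty_iff subset_UNIV)
  have "f y \<le> f x" for y
  proof (cases "norm y \<le> R")
    case False
    then have "f y < f x1" by (intro R) auto
    also have "\<dots> \<le> f x" by (rule x(2)[OF x1R])
    finally show ?thesis by simp
  qed (use x in simp)
  then show ?thesis by (rule that)
qed

context riesz
begin

text \<open>The extremal profile of \<open>fast_decay\<close> with constant 1: positive everywhere,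
  with a bounded potential that vanishes at infinity.\<close>

definition q0 :: "'a \<Rightarrow> real" where "q0 x = (1 + norm x) powr (- (2 * \<beta>))"

lemma q0_pos: "q0 x > 0"
  unfolding q0_def by (simp add: add_nonneg_eq_0_iff)

lemma q0_fast_decay: "fast_decay \<beta> q0 1"
  unfolding fast_decay_def
proof (intro conjI allI)
  have *: "1 + norm x \<noteq> 0" for x :: 'a using norm_ge_zero[of x] by linarith
  show "continuous_on UNIV q0"
    unfolding q0_def[abs_def] by (intro continuous_intros ballI *)
  show "\<bar>q0 x\<bar> \<le> 1 * (1 + norm x) powr (- (2 * \<beta>))" for x unfolding q0_def by simp
qed

text \<open>Subtracting a small multiple of \<open>pot s q0\<close> makes the maximum principle strict.\<close>

lemma potential_max_principle:
  fixes q :: "'a \<Rightarrow> real"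
  assumes q: "fast_decay \<beta> q M" and H: "H \<ge> 0"
    and le: "\<And>x. pot s q x > H \<Longrightarrow> q x \<le> 0"
  shows "pot s q x \<le> H"
proof (rule ccontr)
  assume "\<not> pot s q x \<le> H"
  then have x1: "pot s q x > H" by simp
  define P where "P = pot_const + 1"
  have P: "P > 0" "\<bar>pot s q0 y\<bar> \<le> P" for y
    using pot_bound[OF q0_fast_decay, of y] pot_const_nonneg by (auto simp: P_def)
  \<comment> \<open>The perturbation moves potentials by at most a quarter of the excess
    \<open>pot s q x - H\<close>: at \<open>x\<close> more than half of the excess survives, and at
    the new maximum point \<open>x'\<close> the unperturbed potential still exceeds
    \<open>H\<close>.\<close>
  define \<eta> where "\<eta> = (pot s q x - H) / (4 * P)"
  have \<eta>: "\<eta> > 0" using x1 P by (simp add: \<eta>_def)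
  have \<eta>P: "\<bar>\<eta> * pot s q0 y\<bar> \<le> (pot s q x - H) / 4" for y
  proof -
    have "\<bar>\<eta> * pot s q0 y\<bar> \<le> \<eta> * P" using \<eta> P by (simp add: abs_mult)
    also have "\<eta> * P = (pot s q x - H) / 4" using P by (simp add: \<eta>_def)
    finally show ?thesis .
  qed
  have \<eta>P1: "\<eta> * pot s q0 y \<le> (pot s q x - H) / 4" and \<eta>P2: "- (\<eta> * pot s q0 y) \<le> (pot s q x - H) / 4" for y
    using \<eta>P[of y] by (auto simp only: abs_le_iff)
  let ?q = "\<lambda>x. q x + (- \<eta>) * q0 x"
  note d1 = fast_decay_cmult[OF q0_fast_decay, of "- \<eta>"]
  note d = fast_decay_add[OF q d1]
  have w: "pot s ?q y = pot s q y - \<eta> * pot s q0 y" for y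
    using pot_add[OF q d1, of y] pot_cmult[of "- \<eta>" q0 y] by simp
  have w1: "pot s ?q x > H + (pot s q x - H) / 2" unfolding w using \<eta>P1[of x] x1 by (simp add: field_simps)
  moreover have "0 < H + (pot s q x - H) / 2" using H x1 by (simp add: field_simps)
  ultimately have "pot s ?q x > 0" by (rule order.strict_trans[rotated])
  \<comment> \<open>A positive value together with the limit 0 at infinity forces the maximum to be
    attained.\<close>
  then obtain x' where x': "\<And>y. pot s ?q y \<le> pot s ?q x'"
    using attains_max_at_infinity[OF pot_continuous[OF d] pot_tendsto[OF d]] by metis
  have "0 \<le> marchaud_const s * ?q x'"
    using hlap_pot[OF d, of 0 x'] x' by (intro hlap_at_max[OF pot_bounded_borel[OF d] s(1)]) simp_all
  then have "?q x' \<ge> 0" using marchaud_const_pos[OF s] by (simp add: zero_le_mult_iff)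
  then have "q x' > 0" using q0_pos[of x'] \<eta> by (smt (verit) mult_pos_pos mult_minus_left)
  moreover have "pot s q x' > H"
    using x'[of x] w1 \<eta>P2[of x'] x1 unfolding w[of x'] by (simp add: field_simps)
  ultimately show False using le by fastforce
qed

text \<open>Where \<open>- t\<close> times the potential of \<open>b * u\<close> exceeds
  \<open>H\<close>, the hypothesis \<open>h\<close> forces \<open>u \<ge> 0\<close>, so the density
  \<open>- t * b * u\<close> is nonpositive there and the maximum principle yields the bound
  \<open>H\<close>. The reflected argument gives the other side, and \<open>u\<close> is bounded by
  \<open>H + H\<close>. The factor 2 is the same for all \<open>t\<close>, as the continuation
  requires.\<close>

lemma schroedinger_apriori:
  fixes b u :: "'a \<Rightarrow> real"
  assumes b: "fast_decay \<beta> b Mb" "\<And>x. b x \<ge> 0" and u: "continuous_on UNIV u" "\<And>x. \<bar>u x\<bar> \<le> Mu"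
    and t: "t \<ge> 0" and h: "\<And>x. \<bar>u x + t * pot s (\<lambda>x. b x * u x) x\<bar> \<le> H"
  shows "\<bar>u x\<bar> \<le> 2 * H"
proof -
  have H: "H \<ge> 0" using h[of 0] by linarith
  have bu: "fast_decay \<beta> (\<lambda>x. b x * u x) (Mu * Mb)"
    using fast_decay_mult[OF b(1) u] by (simp add: mult.commute)
  note d = fast_decay_cmult[OF bu]
  have p: "pot s (\<lambda>x. k * (b x * u x)) x = k * pot s (\<lambda>x. b x * u x) x" for k x by (rule pot_cmult)
  have 1: "- (t * pot s (\<lambda>x. b x * u x) x) \<le> H" for x
  proof -
    have "pot s (\<lambda>x. (- t) * (b x * u x)) x \<le> H"
    proof (rule potential_max_principle[OF d H])
      fix x assume "H < pot s (\<lambda>x. (- t) * (b x * u x)) x"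
      then have "u x \<ge> 0" using h[of x] unfolding p by simp
      then show "(- t) * (b x * u x) \<le> 0" using b(2)[of x] t by simp
    qed
    then show ?thesis using p[of "- t" x] by simp
  qed
  have 2: "t * pot s (\<lambda>x. b x * u x) x \<le> H" for x
  proof -
    have "pot s (\<lambda>x. t * (b x * u x)) x \<le> H"
    proof (rule potential_max_principle[OF d H])
      fix x assume "H < pot s (\<lambda>x. t * (b x * u x)) x"
      then have "u x \<le> 0" using h[of x] unfolding p by simp
      then show "t * (b x * u x) \<le> 0" using b(2)[of x] t by (simp add: mult_nonneg_nonpos)
    qed
    then show ?thesis by (simp only: p)
  qed
  show ?thesis using 1[of x] 2[of x] h[of x] by (simp add: abs_le_iff)
qed

text \<open>The equation is read as \<open>w + pot s (b w) = \<gamma> + pot s g\<close>.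
  Multiplication by \<open>b\<close> sends bounded continuous functions to functions of fast decay,
  which makes \<open>K\<close> a bounded operator. The value at infinity is built in, because
  potentials vanish there.\<close>

theorem schroedinger_solvable:
  fixes b g :: "'a \<Rightarrow> real"
  assumes b: "fast_decay \<beta> b Mb" "\<And>x. b x \<ge> 0" and g: "fast_decay \<beta> g Mg"
  obtains w M Mq where "continuous_on UNIV w" "\<And>x. \<bar>w x\<bar> \<le> M" "fast_decay \<beta> (\<lambda>x. g x - b x * w x) Mq"
    "\<And>x. w x = \<gamma> + pot s (\<lambda>x. g x - b x * w x) x"
proof -
  have bd: "\<bar>apply_bcontfun u x\<bar> \<le> norm u" for u :: "'a \<Rightarrow>\<^sub>C real" and x
    using norm_bounded[of u x] by simp
  have dec: "fast_decay \<beta> (\<lambda>x. b x * apply_bcontfun u x) (norm u * Mb)" for u :: "'a \<Rightarrow>\<^sub>C real"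
    using fast_decay_mult[OF b(1) _ bd, of u] by (simp add: mult.commute)
  have inb: "pot s q \<in> bcontfun" if "fast_decay \<beta> q M" for q :: "'a \<Rightarrow> real" and M
    unfolding bcontfun_def using pot_continuous[OF that] pot_bound[OF that]
    by (auto intro!: boundedI[of _ "pot_const * M"])
  define K :: "('a \<Rightarrow>\<^sub>C real) \<Rightarrow> ('a \<Rightarrow>\<^sub>C real)" where "K u = Bcontfun (pot s (\<lambda>x. b x * apply_bcontfun u x))" for u
  have K: "apply_bcontfun (K u) x = pot s (\<lambda>x. b x * apply_bcontfun u x) x" for u x
    unfolding K_def by (simp add: Bcontfun_inverse[OF inb[OF dec]])
  have "bounded_linear K"
  proof (rule bounded_linear_intro[where K = "pot_const * Mb"])
    show "K (u + v) = K u + K v" for u v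
      using pot_add[OF dec[of u] dec[of v]] by (intro bcontfun_eqI) (simp add: K plus_bcontfun.rep_eq distrib_left)
    show "K (r *\<^sub>R u) = r *\<^sub>R K u" for r u
      by (intro bcontfun_eqI) (simp add: K scaleR_bcontfun.rep_eq pot_cmult[symmetric] mult.left_commute)
    show "norm (K u) \<le> norm u * (pot_const * Mb)" for u
      using pot_bound[OF dec[of u]] by (intro norm_bound) (simp add: K mult_ac)
  qed
  moreover have "norm u \<le> 2 * norm (u + t *\<^sub>R K u)" if "0 \<le> t" for t u
  proof (rule norm_bound)
    fix x
    show "norm (apply_bcontfun u x) \<le> 2 * norm (u + t *\<^sub>R K u)"
      unfolding real_norm_def
    proof (rule schroedinger_apriori[OF b _ bd that])
      show "\<bar>apply_bcontfun u x + t * pot s (\<lambda>x. b x * apply_bcontfun u x) x\<bar> \<le> norm (u + t *\<^sub>R K u)" for x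
        using bd[of "u + t *\<^sub>R K u" x] by (simp add: K plus_bcontfun.rep_eq scaleR_bcontfun.rep_eq)
    qed simp
  qed
  ultimately obtain u where u: "u + K u = const_bcontfun \<gamma> + Bcontfun (pot s g)"
    using method_of_continuity[of K 2] by blast
  let ?u = "apply_bcontfun u"
  note d = fast_decay_uminus[OF dec[of u]]
  have ux: "?u x + pot s (\<lambda>x. b x * ?u x) x = \<gamma> + pot s g x" for x
    using arg_cong[OF u, of "\<lambda>f. apply_bcontfun f x"]
    by (simp add: plus_bcontfun.rep_eq K const_bcontfun.rep_eq Bcontfun_inverse[OF inb[OF g]])
  have "?u x = \<gamma> + pot s (\<lambda>x. g x + - (b x * ?u x)) x" for x
    unfolding pot_add[OF g d, of x] pot_uminus using ux[of x] by (simp add: algebra_simps)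
  then have 1: "?u x = \<gamma> + pot s (\<lambda>x. g x - b x * ?u x) x" for x
    unfolding diff_conv_add_uminus .
  have 2: "fast_decay \<beta> (\<lambda>x. g x - b x * ?u x) (Mg + norm u * Mb)"
    using fast_decay_add[OF g d] by simp
  show ?thesis by (rule that[OF _ bd 2 1]) simp
qed

end

section \<open>Smoothness of caloric functions\<close>

text \<open>\<open>C2\<close> asks for derivatives with values in spaces of bounded linear maps. In
  finite dimension these are assembled from partial derivatives along the basis, so that only
  derivatives of real-valued functions remain to be computed.\<close>

lemma C2I:
  fixes \<phi> :: "'a::euclidean_space \<Rightarrow> real"
  assumes 1: "\<And>x. (\<phi> has_derivative \<phi>' x) (at x)"
    and 2: "\<And>b x. b \<in> Basis \<Longrightarrow> ((\<lambda>x. \<phi>' x b) has_derivative \<phi>'' b x) (at x)"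
    and 3: "\<And>b c. b \<in> Basis \<Longrightarrow> c \<in> Basis \<Longrightarrow> continuous_on UNIV (\<lambda>x. \<phi>'' b x c)"
  shows "C2 \<phi>"
proof -
  have lin: "f h = (\<Sum>b\<in>Basis. (h \<bullet> b) *\<^sub>R f b)" if "linear f" for f :: "'a \<Rightarrow> real" and h
    using linear_sum[OF that, of "\<lambda>b. (h \<bullet> b) *\<^sub>R b" Basis] by (simp add: euclidean_representation linear_cmul[OF that])
  define D :: "'a \<Rightarrow> 'a \<Rightarrow>\<^sub>L real" where "D x = (\<Sum>b\<in>Basis. \<phi>' x b *\<^sub>R blinfun_inner_left b)" for x
  define D2 :: "'a \<Rightarrow> 'a \<Rightarrow>\<^sub>L ('a \<Rightarrow>\<^sub>L real)" where
    "D2 x = (\<Sum>b\<in>Basis. \<Sum>c\<in>Basis. \<phi>'' b x c *\<^sub>R Blinfun (\<lambda>h. (h \<bullet> c) *\<^sub>R blinfun_inner_left b))" for x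
  have bl: "bounded_linear (\<lambda>h::'a. (h \<bullet> c) *\<^sub>R (blinfun_inner_left b :: 'a \<Rightarrow>\<^sub>L real))" for b c
    by (intro bounded_linear_scaleR_left[THEN bounded_linear_compose] bounded_linear_inner_left)
  have "blinfun_apply (D x) = \<phi>' x" for x
  proof
    fix h
    show "blinfun_apply (D x) h = \<phi>' x h"
      unfolding lin[OF has_derivative_linear[OF 1], of x h]
      by (simp add: D_def blinfun.sum_left blinfun.scaleR_left mult.commute)
  qed
  then have "(\<phi> has_derivative blinfun_apply (D x)) (at x)" for x using 1 by simp
  moreover have "(D has_derivative blinfun_apply (D2 x)) (at x)" for x
  proof -
    have "((\<lambda>x. \<Sum>b\<in>Basis. \<phi>' x b *\<^sub>R (blinfun_inner_left b :: 'a \<Rightarrow>\<^sub>L real)) has_derivative (\<lambda>h. \<Sum>b\<in>Basis. \<phi>'' b x h *\<^sub>R blinfun_inner_left b)) (at x)"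
      by (intro has_derivative_sum has_derivative_scaleR_left 2)
    moreover have "(\<lambda>h. \<Sum>b\<in>Basis. \<phi>'' b x h *\<^sub>R (blinfun_inner_left b :: 'a \<Rightarrow>\<^sub>L real)) = blinfun_apply (D2 x)"
    proof
      fix h
      have "(\<Sum>b\<in>Basis. \<phi>'' b x h *\<^sub>R (blinfun_inner_left b :: 'a \<Rightarrow>\<^sub>L real)) =
        (\<Sum>b\<in>Basis. (\<Sum>c\<in>Basis. (h \<bullet> c) *\<^sub>R \<phi>'' b x c) *\<^sub>R blinfun_inner_left b)"
        by (intro sum.cong refl) (metis lin[OF has_derivative_linear[OF 2]])
      also have "\<dots> = blinfun_apply (D2 x) h"
        by (simp add: D2_def blinfun.sum_left blinfun.scaleR_left bounded_linear_Blinfun_apply[OF bl] scaleR_sum_left mult.commute)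
      finally show "(\<Sum>b\<in>Basis. \<phi>'' b x h *\<^sub>R (blinfun_inner_left b :: 'a \<Rightarrow>\<^sub>L real)) = blinfun_apply (D2 x) h" .
    qed
    ultimately show ?thesis unfolding D_def[abs_def] by simp
  qed
  moreover have "continuous_on UNIV D2"
    unfolding D2_def[abs_def] by (intro continuous_intros 3)
  ultimately show ?thesis unfolding C2_def by blast
qed

text \<open>Differentiating a Gaussian convolution multiplies the integrand by coordinates, which
  leaves the class of bounded functions; exponential growth is stable under this and still
  integrable against Gaussians.\<close>

definition exp_bounded :: "('a::euclidean_space \<Rightarrow> real) \<Rightarrow> bool" where
  "exp_bounded V \<longleftrightarrow> V \<in> borel_measurable borel \<and> (\<exists>C R. 0 \<le> C \<and> 0 \<le> R \<and> (\<forall>y. \<bar>V y\<bar> \<le> C * exp (R * norm y)))"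

lemma exp_bounded_measurable: "exp_bounded V \<Longrightarrow> V \<in> borel_measurable borel"
  unfolding exp_bounded_def by blast

lemma exp_bounded_of_bounded_borel: "bounded_borel V \<Longrightarrow> exp_bounded V"
  unfolding exp_bounded_def by (metis bounded_borelE bounded_borel_measurable exp_zero mult.right_neutral mult_zero_left order_refl)

lemma exp_bounded_inner:
  assumes "exp_bounded V" "b \<in> Basis" shows "exp_bounded (\<lambda>y. (y \<bullet> b) * V y)"
proof -
  obtain C R where C: "0 \<le> C" "0 \<le> R" "\<And>y. \<bar>V y\<bar> \<le> C * exp (R * norm y)"
    using assms unfolding exp_bounded_def by blast
  have "\<bar>(y \<bullet> b) * V y\<bar> \<le> C * exp ((R + 1) * norm y)" for y
  proof -
    have "\<bar>y \<bullet> b\<bar> \<le> norm y" using assms(2) by (rule Basis_le_norm)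
    also have "\<dots> \<le> exp (norm y)" using exp_ge_add_one_self[of "norm y"] by linarith
    finally have "\<bar>y \<bullet> b\<bar> * \<bar>V y\<bar> \<le> exp (norm y) * (C * exp (R * norm y))"
      using C by (intro mult_mono) auto
    also have "\<dots> = C * exp ((R + 1) * norm y)"
      by (simp add: exp_add[symmetric] algebra_simps)
    finally show ?thesis by (simp add: abs_mult)
  qed
  then show ?thesis
    using C exp_bounded_measurable[OF assms(1)] unfolding exp_bounded_def
    by (intro conjI exI[of _ C] exI[of _ "R + 1"]) auto
qed

definition gauss_conv :: "real \<Rightarrow> ('a::euclidean_space \<Rightarrow> real) \<Rightarrow> 'a \<Rightarrow> real" where
  "gauss_conv e V x = (LBINT y. exp (- (norm (y - x))\<^sup>2 / e) * V y)"

text \<open>The factor \<open>exp (R * norm (y - x))\<close> leaves room for majorants of difference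
  quotients.\<close>

lemma integrable_gauss_conv:
  fixes V :: "'a::euclidean_space \<Rightarrow> real"
  assumes V: "exp_bounded V" and e: "e > 0"
  shows "integrable lborel (\<lambda>y. exp (R * norm (y - x) - (norm (y - x))\<^sup>2 / e) * V y)"
proof -
  note [measurable] = exp_bounded_measurable[OF V]
  obtain C R' where C: "0 \<le> C" "0 \<le> R'" "\<And>y. \<bar>V y\<bar> \<le> C * exp (R' * norm y)"
    using V unfolding exp_bounded_def by blast
  have "integrable lborel (\<lambda>y::'a. exp ((R + R') * norm y - (1 / e) * (norm y)\<^sup>2))"
    using e by (intro integrable_gauss_exp) auto
  from lborel_integrable_affine[OF this, of 1 "- x"]
  have i: "integrable lborel (\<lambda>y. C * exp (R' * norm x) * exp ((R + R') * norm (y - x) - (norm (y - x))\<^sup>2 / e))"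
    by simp
  show ?thesis
  proof (rule Bochner_Integration.integrable_bound[OF i])
    show "AE y in lborel. norm (exp (R * norm (y - x) - (norm (y - x))\<^sup>2 / e) * V y)
      \<le> norm (C * exp (R' * norm x) * exp ((R + R') * norm (y - x) - (norm (y - x))\<^sup>2 / e))" (is "AE y in _. ?P y")
    proof (intro always_eventually allI)
      fix y
      have "norm y \<le> norm (y - x) + norm x" using norm_triangle_ineq[of "y - x" x] by simp
      then have "R' * norm y \<le> R' * norm x + R' * norm (y - x)" using C by (simp add: distrib_left[symmetric] mult_left_mono add.commute)
      then have "\<bar>V y\<bar> \<le> C * (exp (R' * norm x) * exp (R' * norm (y - x)))"
        using C(1) by (intro order_trans[OF C(3)] mult_left_mono) (auto simp: exp_add[symmetric])
      then have "exp (R * norm (y - x) - (norm (y - x))\<^sup>2 / e) * \<bar>V y\<bar> \<le>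
        exp (R * norm (y - x) - (norm (y - x))\<^sup>2 / e) * (C * (exp (R' * norm x) * exp (R' * norm (y - x))))"
        by (intro mult_left_mono) auto
      also have "\<dots> = C * exp (R' * norm x) * (exp (R * norm (y - x) - (norm (y - x))\<^sup>2 / e) * exp (R' * norm (y - x)))"
        by (simp add: mult_ac)
      also have "exp (R * norm (y - x) - (norm (y - x))\<^sup>2 / e) * exp (R' * norm (y - x)) = exp ((R + R') * norm (y - x) - (norm (y - x))\<^sup>2 / e)"
        unfolding exp_add[symmetric] by (simp add: algebra_simps)
      finally show "?P y"
        using C(1) by (simp add: abs_mult)
    qed
  qed measurable
qed

lemma exp_taylor2_le:
  fixes u :: real shows "\<bar>exp u - 1 - u\<bar> \<le> u\<^sup>2 * exp \<bar>u\<bar>"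
proof -
  obtain t where t: "\<bar>t\<bar> \<le> \<bar>u\<bar>" "exp u = (\<Sum>m<2. u ^ m / fact m) + exp t / fact 2 * u ^ 2"
    using Maclaurin_exp_le[of u 2] by blast
  then have "exp u - 1 - u = exp t / 2 * u\<^sup>2" by (simp add: numeral_2_eq_2)
  moreover have "exp t / 2 \<le> exp \<bar>u\<bar>"
  proof -
    have "exp t \<le> exp \<bar>u\<bar>" using t(1) by simp
    then show ?thesis using exp_gt_zero[of "\<bar>u\<bar>"] by linarith
  qed
  then have "exp t / 2 * u\<^sup>2 \<le> exp \<bar>u\<bar> * u\<^sup>2" by (intro mult_right_mono) auto
  moreover have "0 \<le> exp t / 2 * u\<^sup>2" by simp
  ultimately show ?thesis by (simp only: abs_of_nonneg mult.commute[of "u\<^sup>2"])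
qed

text \<open>The derivative is expressed by Gaussian convolutions of \<open>V\<close> and of its
  products with coordinates, so that the lemma applies again to the derivative. The remainder of the
  integrand is at most \<open>(norm h)\<^sup>2 * W y\<close> with an integrable
  \<open>W\<close>.\<close>

lemma gauss_conv_has_derivative:
  fixes V :: "'a::euclidean_space \<Rightarrow> real"
  assumes V: "exp_bounded V" and e: "e > 0"
  shows "(gauss_conv e V has_derivative (\<lambda>h. (2 / e) * ((\<Sum>b\<in>Basis. (h \<bullet> b) * gauss_conv e (\<lambda>y. (y \<bullet> b) * V y) x) - (h \<bullet> x) * gauss_conv e V x))) (at x)"
proof -
  note [measurable] = exp_bounded_measurable[OF V]
  let ?E = "\<lambda>x y. exp (- (norm (y - x))\<^sup>2 / e)"
  let ?D = "\<lambda>h. (2 / e) * ((\<Sum>b\<in>Basis. (h \<bullet> b) * gauss_conv e (\<lambda>y. (y \<bullet> b) * V y) x) - (h \<bullet> x) * gauss_conv e V x)"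
  have i0: "integrable lborel (\<lambda>y. ?E x y * V y)" if "exp_bounded V" for x and V :: "'a \<Rightarrow> real"
    using integrable_gauss_conv[OF that e, of 0 x] by simp
  note ib = i0[OF exp_bounded_inner[OF V]]
  have D: "?D h = (LBINT y. ?E x y * ((2 / e) * ((y - x) \<bullet> h)) * V y)"
    and Di: "integrable lborel (\<lambda>y. ?E x y * ((2 / e) * ((y - x) \<bullet> h)) * V y)" for h
  proof -
    have eq: "?E x y * ((2 / e) * ((y - x) \<bullet> h)) * V y =
      (2 / e) * ((\<Sum>b\<in>Basis. (h \<bullet> b) * (?E x y * ((y \<bullet> b) * V y))) - (h \<bullet> x) * (?E x y * V y))" for y
    proof -
      have yh: "y \<bullet> h = (\<Sum>b\<in>Basis. (y \<bullet> b) * (h \<bullet> b))" by (rule euclidean_inner)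
      have "(\<Sum>b\<in>Basis. (h \<bullet> b) * (?E x y * ((y \<bullet> b) * V y))) = (y \<bullet> h) * (?E x y * V y)"
        unfolding yh sum_distrib_right by (intro sum.cong refl) (simp add: mult_ac)
      then show ?thesis by (simp add: inner_diff_left inner_commute algebra_simps)
    qed
    show "integrable lborel (\<lambda>y. ?E x y * ((2 / e) * ((y - x) \<bullet> h)) * V y)"
      unfolding eq by (intro integrable_mult_right Bochner_Integration.integrable_diff Bochner_Integration.integrable_sum i0[OF V] ib)
    have "(LBINT y. ?E x y * ((2 / e) * ((y - x) \<bullet> h)) * V y) =
      (2 / e) * (LBINT y. (\<Sum>b\<in>Basis. (h \<bullet> b) * (?E x y * ((y \<bullet> b) * V y))) - (h \<bullet> x) * (?E x y * V y))"
      unfolding eq by (rule integral_mult_right_zero)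
    also have "(LBINT y. (\<Sum>b\<in>Basis. (h \<bullet> b) * (?E x y * ((y \<bullet> b) * V y))) - (h \<bullet> x) * (?E x y * V y)) =
      (LBINT y. (\<Sum>b\<in>Basis. (h \<bullet> b) * (?E x y * ((y \<bullet> b) * V y)))) - (LBINT y. (h \<bullet> x) * (?E x y * V y))"
      by (intro Bochner_Integration.integral_diff Bochner_Integration.integrable_sum integrable_mult_right i0[OF V] ib)
    also have "(LBINT y. (\<Sum>b\<in>Basis. (h \<bullet> b) * (?E x y * ((y \<bullet> b) * V y)))) =
      (\<Sum>b\<in>Basis. (LBINT y. (h \<bullet> b) * (?E x y * ((y \<bullet> b) * V y))))"
      by (intro Bochner_Integration.integral_sum integrable_mult_right ib)
    finally show "?D h = (LBINT y. ?E x y * ((2 / e) * ((y - x) \<bullet> h)) * V y)"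
      unfolding gauss_conv_def by (simp only: integral_mult_right_zero)
  qed
  define W where "W y = 2 * exp ((4 / e) * 1) * (exp ((8 / e) * norm (y - x) - (norm (y - x))\<^sup>2 / e) * \<bar>V y\<bar>) + (1 / e) * (?E x y * \<bar>V y\<bar>)" for y
  have Wi: "integrable lborel W"
  proof -
    have "integrable lborel (\<lambda>y. exp ((8 / e) * norm (y - x) - (norm (y - x))\<^sup>2 / e) * \<bar>V y\<bar>)"
      using integrable_norm[OF integrable_gauss_conv[OF V e, of "8 / e" x]] by (simp add: abs_mult)
    moreover have "integrable lborel (\<lambda>y. ?E x y * \<bar>V y\<bar>)"
      using integrable_norm[OF i0[OF V, of x]] by (simp add: abs_mult)
    ultimately show ?thesis unfolding W_def[abs_def]
      by (intro Bochner_Integration.integrable_add integrable_mult_right) auto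
  qed
  have pt: "\<bar>?E (x + h) y * V y - ?E x y * V y - ?E x y * ((2 / e) * ((y - x) \<bullet> h)) * V y\<bar> \<le> (norm h)\<^sup>2 * W y"
    if h: "norm h \<le> 1" for h y
  proof -
    define p where "p = (2 / e) * ((y - x) \<bullet> h)"
    \<comment> \<open>Shifting the centre by \<open>h\<close> multiplies the Gaussian by
      \<open>exp u\<close>. The part \<open>p\<close> is linear in \<open>h\<close> and is the
      factor in the integrand of the derivative.\<close>
    define u where "u = p - (norm h)\<^sup>2 / e"
    \<comment> \<open>The rate for which \<open>abs u \<le> norm h * \<rho>\<close>. The square of
      \<open>\<rho>\<close> is absorbed by \<open>2 * exp \<rho>\<close>, which explains the
      exponential factor in \<open>W\<close>.\<close>
    define \<rho> where "\<rho> = (2 / e) * norm (y - x) + 1 / e"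
    have \<rho>: "\<rho> \<ge> 0" using e by (simp add: \<rho>_def)
    have h2: "(norm h)\<^sup>2 \<le> norm h" using h by (simp add: power2_eq_square mult_left_le)
    have N: "(norm (y - (x + h)))\<^sup>2 = (norm (y - x))\<^sup>2 - 2 * ((y - x) \<bullet> h) + (norm h)\<^sup>2"
      unfolding power2_norm_eq_inner by (simp add: inner_diff inner_add inner_commute algebra_simps)
    have "- (norm (y - (x + h)))\<^sup>2 / e = - (norm (y - x))\<^sup>2 / e + u"
      unfolding N u_def p_def by (simp add: diff_divide_distrib add_divide_distrib)
    then have Eh: "?E (x + h) y = ?E x y * exp u" by (simp only: exp_add)
    have "\<bar>p\<bar> \<le> (2 / e) * (norm (y - x) * norm h)"
      using e Cauchy_Schwarz_ineq2[of "y - x" h] by (simp add: p_def abs_mult divide_right_mono)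
    moreover have "\<bar>(norm h)\<^sup>2 / e\<bar> \<le> norm h / e" using e h2 by (simp add: divide_right_mono)
    ultimately have "\<bar>u\<bar> \<le> (2 / e) * (norm (y - x) * norm h) + norm h / e"
      unfolding u_def using abs_triangle_ineq4[of p "(norm h)\<^sup>2 / e"] by linarith
    also have "\<dots> = norm h * \<rho>" by (simp add: \<rho>_def algebra_simps)
    finally have u: "\<bar>u\<bar> \<le> norm h * \<rho>" .
    also have "norm h * \<rho> \<le> 1 * \<rho>" using h \<rho> by (intro mult_right_mono) auto
    finally have u1: "\<bar>u\<bar> \<le> \<rho>" by simp
    have "u\<^sup>2 \<le> (norm h * \<rho>)\<^sup>2" using u by (metis abs_ge_zero power2_abs power_mono)
    then have "u\<^sup>2 * exp \<bar>u\<bar> \<le> (norm h * \<rho>)\<^sup>2 * exp \<rho>" using u1 by (intro mult_mono) auto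
    also have "\<dots> = (norm h)\<^sup>2 * (\<rho>\<^sup>2 * exp \<rho>)" by (simp add: power_mult_distrib)
    also have "\<rho>\<^sup>2 * exp \<rho> \<le> (2 * exp \<rho>) * exp \<rho>"
      using exp_lower_Taylor_quadratic[OF \<rho>] \<rho> by (intro mult_right_mono) auto
    then have "(norm h)\<^sup>2 * (\<rho>\<^sup>2 * exp \<rho>) \<le> (norm h)\<^sup>2 * ((2 * exp \<rho>) * exp \<rho>)" by (intro mult_left_mono) auto
    also have "\<dots> \<le> (norm h)\<^sup>2 * (2 * exp (4 / e) * exp ((8 / e) * norm (y - x)))"
    proof -
      have "2 * \<rho> \<le> 4 / e + (8 / e) * norm (y - x)"
        using e by (simp add: \<rho>_def divide_simps)
      then have "exp (2 * \<rho>) \<le> exp (4 / e) * exp ((8 / e) * norm (y - x))"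
        unfolding exp_add[symmetric] by simp
      moreover have "exp \<rho> * exp \<rho> = exp (2 * \<rho>)" unfolding exp_add[symmetric] by simp
      ultimately show ?thesis by (intro mult_left_mono) auto
    qed
    finally have 1: "\<bar>exp u - 1 - u\<bar> \<le> (norm h)\<^sup>2 * (2 * exp (4 / e) * exp ((8 / e) * norm (y - x)))"
      using exp_taylor2_le[of u] by linarith
    have "exp u - 1 - p = (exp u - 1 - u) - (norm h)\<^sup>2 / e" by (simp add: u_def)
    then have "\<bar>exp u - 1 - p\<bar> \<le> \<bar>exp u - 1 - u\<bar> + \<bar>(norm h)\<^sup>2 / e\<bar>" by (metis abs_triangle_ineq4)
    also have "\<dots> \<le> (norm h)\<^sup>2 * (2 * exp (4 / e) * exp ((8 / e) * norm (y - x)) + 1 / e)"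
      using 1 e by (simp add: algebra_simps)
    finally have 2: "\<bar>exp u - 1 - p\<bar> \<le> (norm h)\<^sup>2 * (2 * exp (4 / e) * exp ((8 / e) * norm (y - x)) + 1 / e)" .
    have "?E (x + h) y * V y - ?E x y * V y - ?E x y * p * V y = (?E x y * V y) * (exp u - 1 - p)"
      unfolding Eh by (simp add: algebra_simps)
    then have "\<bar>?E (x + h) y * V y - ?E x y * V y - ?E x y * p * V y\<bar> = (?E x y * \<bar>V y\<bar>) * \<bar>exp u - 1 - p\<bar>"
      by (simp add: abs_mult)
    also have "\<dots> \<le> (?E x y * \<bar>V y\<bar>) * ((norm h)\<^sup>2 * (2 * exp (4 / e) * exp ((8 / e) * norm (y - x)) + 1 / e))"
      using 2 by (intro mult_left_mono) auto
    also have "\<dots> = (norm h)\<^sup>2 * W y"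
    proof -
      have "exp ((8 / e) * norm (y - x) - (norm (y - x))\<^sup>2 / e) = exp ((8 / e) * norm (y - x)) * ?E x y"
        unfolding exp_add[symmetric] by simp
      then show ?thesis unfolding W_def by (simp add: algebra_simps)
    qed
    finally show ?thesis unfolding p_def .
  qed
  show ?thesis
  proof (rule has_derivativeI_sandwich[of 1 ?D])
    show "bounded_linear ?D"
      by (intro bounded_linear_const_mult bounded_linear_sub bounded_linear_sum bounded_linear_mult_const bounded_linear_inner_left)
    have "((\<lambda>y. norm (y - x) * integral\<^sup>L lborel W) \<longlongrightarrow> norm (x - x) * integral\<^sup>L lborel W) (at x)"
      by (intro tendsto_intros)
    then show "((\<lambda>y. norm (y - x) * integral\<^sup>L lborel W) \<longlongrightarrow> 0) (at x)" by simp
    fix x' assume "x' \<noteq> x" "dist x' x < 1"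
    define h where "h = x' - x"
    have h: "norm h > 0" "norm h \<le> 1" "x' = x + h" using \<open>x' \<noteq> x\<close> \<open>dist x' x < 1\<close> by (auto simp: h_def dist_norm)
    have R: "gauss_conv e V x' - gauss_conv e V x - ?D h = (LBINT y. ?E (x + h) y * V y - ?E x y * V y - ?E x y * ((2 / e) * ((y - x) \<bullet> h)) * V y)"
      unfolding D[of h] unfolding h(3) gauss_conv_def
      by (subst Bochner_Integration.integral_diff[OF Bochner_Integration.integrable_diff[OF i0[OF V] i0[OF V]] Di],
          subst Bochner_Integration.integral_diff[OF i0[OF V] i0[OF V]]) (rule refl)
    have "\<bar>gauss_conv e V x' - gauss_conv e V x - ?D h\<bar> \<le> (LBINT y. \<bar>?E (x + h) y * V y - ?E x y * V y - ?E x y * ((2 / e) * ((y - x) \<bullet> h)) * V y\<bar>)"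
      unfolding R by (rule integral_abs_bound)
    also have "\<dots> \<le> (LBINT y. (norm h)\<^sup>2 * W y)"
      by (intro integral_mono integrable_abs Bochner_Integration.integrable_diff i0[OF V] Di integrable_mult_right Wi pt h(2))
    also have "\<dots> = norm h * integral\<^sup>L lborel W * norm h"
      by (simp add: power2_eq_square)
    finally have "\<bar>gauss_conv e V x' - gauss_conv e V x - ?D h\<bar> / norm h \<le> norm h * integral\<^sup>L lborel W"
      using h(1) by (simp add: divide_le_eq)
    then show "norm (gauss_conv e V x' - gauss_conv e V x - ?D (x' - x)) / norm (x' - x) \<le> norm (x' - x) * integral\<^sup>L lborel W"
      unfolding h_def real_norm_def .
  qed simp
qed

lemma gauss_conv_continuous:
  assumes "exp_bounded V" "e > 0" shows "continuous_on UNIV (gauss_conv e V)"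
  by (intro continuous_at_imp_continuous_on ballI has_derivative_continuous[OF gauss_conv_has_derivative[OF assms]])

text \<open>The derivative formula is applied twice: partial derivatives are again Gaussian
  convolutions, up to factors that are coordinates of \<open>x\<close>.\<close>

lemma gauss_conv_C2:
  fixes V :: "'a::euclidean_space \<Rightarrow> real"
  assumes V: "exp_bounded V" and e: "e > 0"
  shows "C2 (\<lambda>x. k + k' * gauss_conv e V x)"
proof -
  define D where "D V x h = (2 / e) * ((\<Sum>b\<in>Basis. (h \<bullet> b) * gauss_conv e (\<lambda>y. (y \<bullet> b) * V y) x) - (h \<bullet> x) * gauss_conv e V x)"
    for V :: "'a \<Rightarrow> real" and x h
  have D: "(gauss_conv e V has_derivative D V x) (at x)" if "exp_bounded V" for V :: "'a \<Rightarrow> real" and x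
    using gauss_conv_has_derivative[OF that e, of x] unfolding D_def .
  have Db: "D V x b = (2 / e) * (gauss_conv e (\<lambda>y. (y \<bullet> b) * V y) x - (b \<bullet> x) * gauss_conv e V x)" if "b \<in> Basis" for b x and V :: "'a \<Rightarrow> real"
    using that by (simp add: D_def inner_Basis if_distrib[of "\<lambda>z. z * _"] cong: if_cong)
  show ?thesis
  proof (rule C2I)
    show "((\<lambda>x. k + k' * gauss_conv e V x) has_derivative (\<lambda>h. k' * D V x h)) (at x)" for x
      using has_derivative_add[OF has_derivative_const has_derivative_mult_right[OF D[OF V], of k']] by simp
    fix b :: 'a assume b: "b \<in> Basis"
    note Vb = exp_bounded_inner[OF V b]
    show "((\<lambda>x. k' * D V x b) has_derivative (\<lambda>h. k' * ((2 / e) * (D (\<lambda>y. (y \<bullet> b) * V y) x h - ((b \<bullet> x) * D V x h + (b \<bullet> h) * gauss_conv e V x))))) (at x)" for x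
      unfolding Db[OF b]
      by (intro has_derivative_mult_right has_derivative_diff has_derivative_mult D[OF V] D[OF Vb] has_derivative_inner_right has_derivative_ident)
    fix c :: 'a assume c: "c \<in> Basis"
    show "continuous_on UNIV (\<lambda>x. k' * ((2 / e) * (D (\<lambda>y. (y \<bullet> b) * V y) x c - ((b \<bullet> x) * D V x c + (b \<bullet> c) * gauss_conv e V x))))"
      unfolding Db[OF c]
      by (intro continuous_intros gauss_conv_continuous e exp_bounded_inner V b c)
  qed
qed

text \<open>The constant \<open>k\<close> is the height by which a smoothed barrier is lifted until
  it touches.\<close>

theorem heat_C2:
  fixes \<psi> :: "'a::euclidean_space \<Rightarrow> real"
  assumes bb: "bounded_borel \<psi>" and e: "e > 0"
  shows "C2 (\<lambda>x. k + heat e \<psi> x)"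
proof -
  define k' where "k' = e powr (- real DIM('a) / 2) / (LBINT y. exp (- (norm (y::'a))\<^sup>2))"
  have "heat e \<psi> x = k' * gauss_conv e \<psi> x" for x
  proof -
    have K: "heat_kernel e (y - x) * \<psi> y = k' * (exp (- (norm (y - x))\<^sup>2 / e) * \<psi> y)" for y
    proof -
      have "norm ((y - x) /\<^sub>R sqrt e) = norm (y - x) / sqrt e" using e by (simp add: divide_inverse)
      then have n: "(norm ((y - x) /\<^sub>R sqrt e))\<^sup>2 = (norm (y - x))\<^sup>2 / e" using e by (simp add: power_divide)
      show ?thesis unfolding heat_kernel_def gauss_kernel_def k'_def n by simp
    qed
    show ?thesis
      unfolding heat_density_shift[OF bounded_borel_measurable[OF bb] e, of x] gauss_conv_def K by (rule integral_mult_right_zero)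
  qed
  then show ?thesis
    using gauss_conv_C2[OF exp_bounded_of_bounded_borel[OF bb] e, of k k'] by simp
qed

section \<open>Viscosity solutions\<close>

lemma C2_continuous: "C2 \<phi> \<Longrightarrow> continuous_on S \<phi>"
  unfolding C2_def by (metis continuous_at_imp_continuous_on has_derivative_continuous)

lemma C2_uminus:
  assumes "C2 \<phi>" shows "C2 (\<lambda>x. - \<phi> x)"
proof -
  obtain D D2 where D: "\<And>x. (\<phi> has_derivative blinfun_apply (D x)) (at x)"
    "\<And>x. (D has_derivative blinfun_apply (D2 x)) (at x)" "continuous_on UNIV D2"
    using assms unfolding C2_def by blast
  have "((\<lambda>x. - \<phi> x) has_derivative blinfun_apply (- D x)) (at x)" for x
    using has_derivative_minus[OF D(1)[of x]] by (simp add: uminus_blinfun.rep_eq)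
  moreover have "((\<lambda>x. - D x) has_derivative blinfun_apply (- D2 x)) (at x)" for x
    using has_derivative_minus[OF D(2)[of x]] by (simp add: uminus_blinfun.rep_eq)
  moreover have "continuous_on UNIV (\<lambda>x. - D2 x)" using D(3) by (rule continuous_on_minus)
  ultimately show ?thesis
    unfolding C2_def by (intro exI[of _ "\<lambda>x. - D x"] exI[of _ "\<lambda>x. - D2 x"]) auto
qed

lemma continuous_imp_usc:
  fixes u :: "'a::metric_space \<Rightarrow> real"
  assumes "continuous_on UNIV u" shows "usc u"
proof -
  have "(u \<longlongrightarrow> u x) (nhds x)" for x
    using assms by (simp add: continuous_on_eq_continuous_at isCont_def tendsto_at_iff_tendsto_nhds)
  then show ?thesis unfolding usc_def using order_tendstoD(2) by metis
qed

lemma continuous_of_semicontinuous: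
  fixes u :: "'a::metric_space \<Rightarrow> real"
  assumes "usc u" "lsc u" shows "continuous_on UNIV u"
proof -
  have "(u \<longlongrightarrow> u x) (nhds x)" for x
    using assms unfolding usc_def lsc_def by (intro order_tendstoI) auto
  then show ?thesis
    by (simp add: continuous_on_eq_continuous_at isCont_def tendsto_at_iff_tendsto_nhds)
qed

lemma lsc_iff_usc_uminus: "lsc u \<longleftrightarrow> usc (\<lambda>x. - u x)"
proof
  assume l: "lsc u"
  show "usc (\<lambda>x. - u x)"
    unfolding usc_def
  proof (intro allI impI)
    fix x t assume "- u x < t"
    then have "- t < u x" by simp
    then have "\<forall>\<^sub>F y in nhds x. - t < u y" using l unfolding lsc_def by blast
    then show "\<forall>\<^sub>F y in nhds x. - u y < t" by eventually_elim simp
  qed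
next
  assume l: "usc (\<lambda>x. - u x)"
  show "lsc u"
    unfolding lsc_def
  proof (intro allI impI)
    fix x t assume "t < u x"
    then have "- u x < - t" by simp
    then have "\<forall>\<^sub>F y in nhds x. - u y < - t" using l unfolding usc_def by blast
    then show "\<forall>\<^sub>F y in nhds x. t < u y" by eventually_elim simp
  qed
qed

lemma bounded_borel_of_limit:
  fixes u :: "'a::euclidean_space \<Rightarrow> real"
  assumes u: "continuous_on UNIV u" "(u \<longlongrightarrow> \<gamma>) at_infinity"
  shows "bounded_borel u"
proof -
  have "\<forall>\<^sub>F y in at_infinity. dist (u y) \<gamma> < 1" using u(2) by (intro tendstoD) auto
  then obtain R where R: "\<And>y. norm y \<ge> R \<Longrightarrow> dist (u y) \<gamma> < 1" unfolding eventually_at_infinity by blast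
  have "bounded (u ` cball 0 R)"
    using u(1) by (intro compact_imp_bounded compact_continuous_image) (auto intro: continuous_on_subset)
  then obtain B where "\<forall>y\<in>u ` cball 0 R. norm y \<le> B" unfolding bounded_iff by blast
  then have B: "\<bar>u y\<bar> \<le> B" if "norm y \<le> R" for y using that by simp
  have "\<bar>u y\<bar> \<le> max B (\<bar>\<gamma>\<bar> + 1)" for y
  proof (cases "norm y \<le> R")
    case False
    then have "dist (u y) \<gamma> < 1" by (intro R) simp
    then show ?thesis by (simp add: dist_real_def)
  qed (use B in \<open>auto simp: le_max_iff_disj\<close>)
  then show ?thesis using u(1) by (intro bounded_borelI borel_measurable_continuous_onI)
qed

section \<open>Glued test functions and sign change\<close>

lemma bounded_borel_glue:
  fixes \<phi> v :: "'a::euclidean_space \<Rightarrow> real"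
  assumes U: "open U" "bounded U" and \<phi>: "continuous_on UNIV \<phi>" and v: "bounded_borel v"
  shows "bounded_borel (\<lambda>x. if x \<in> U then \<phi> x else v x)"
proof -
  obtain M where M: "\<And>x. \<bar>v x\<bar> \<le> M" using v by (metis bounded_borelE)
  have "bounded (\<phi> ` closure U)"
    using U \<phi> by (intro compact_imp_bounded compact_continuous_image) (auto intro: continuous_on_subset)
  then obtain B where B: "\<And>y. y \<in> closure U \<Longrightarrow> \<bar>\<phi> y\<bar> \<le> B" unfolding bounded_iff by auto
  have [measurable]: "\<phi> \<in> borel_measurable borel" "v \<in> borel_measurable borel" "U \<in> sets borel"
    using borel_measurable_continuous_onI[OF \<phi>] bounded_borel_measurable[OF v] U by auto
  show ?thesis
  proof (rule bounded_borelI[of _ "max B M"])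
    show "\<bar>if x \<in> U then \<phi> x else v x\<bar> \<le> max B M" for x
      using M B[of x] closure_subset[of U] by (auto simp: le_max_iff_disj)
  qed measurable
qed

lemma bounded_borel_Ls_space:
  fixes u :: "'a::euclidean_space \<Rightarrow> real"
  assumes u: "bounded_borel u" and s: "s > 0"
  shows "u \<in> Ls_space s"
proof -
  note [measurable] = bounded_borel_measurable[OF u]
  obtain M where M: "M \<ge> 0" "\<And>x. \<bar>u x\<bar> \<le> M" using u by (metis bounded_borelE)
  let ?p = "real DIM('a) + 2 * s"
  let ?g = "\<lambda>x. \<bar>u x\<bar> / (1 + norm x powr ?p)"
  have "integrable lborel ?g"
  proof (rule Bochner_Integration.integrable_bound)
    have "integrable lborel (\<lambda>z::'a. indicator (ball 0 1) z :: real)"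
      by (intro integrable_real_indicator) (auto simp: emeasure_ball)
    then show "integrable lborel (\<lambda>z::'a. M * (indicator (ball 0 1) z + indicator (- ball 0 1) z * norm z powr - ?p))"
      using s by (intro integrable_mult_right Bochner_Integration.integrable_add integrable_norm_powr_outside) auto
    show "AE x in lborel. norm (?g x) \<le> norm (M * (indicator (ball 0 1) x + indicator (- ball 0 1) x * norm x powr - ?p))" (is "AE x in _. ?P x")
    proof (intro always_eventually allI)
      fix x :: 'a
      have pos: "0 < 1 + norm x powr ?p" by (simp add: add_pos_nonneg)
      have 1: "?g x \<le> M / (1 + norm x powr ?p)" using M pos by (intro divide_right_mono) auto
      show "?P x"
      proof (cases "norm x < 1")
        case True
        have "M / (1 + norm x powr ?p) \<le> M / 1" using M pos by (intro divide_left_mono) auto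
        with 1 True M show ?thesis by simp
      next
        case False
        then have "norm x powr ?p > 0" by auto
        then have "M / (1 + norm x powr ?p) \<le> M / norm x powr ?p" using M pos by (intro divide_left_mono) auto
        also have "\<dots> = M * norm x powr - ?p" by (simp only: powr_minus divide_inverse)
        finally have "?g x \<le> M * norm x powr - ?p" using 1 by linarith
        moreover have "?g x \<ge> 0" using pos by simp
        ultimately show ?thesis using False M by simp
      qed
    qed
  qed measurable
  then have "integrable lebesgue ?g" by (subst integrable_completion) measurable
  moreover have "u \<in> borel_measurable lebesgue" by (intro measurable_completion) simp
  ultimately show ?thesis unfolding Ls_space_def by simp
qed

text \<open>As \<open>Lim\<close> is total, oddness of \<open>frac_laplacian\<close> is not
  automatic. Both sides are identified through \<open>hlap\<close>, a genuine limit and hence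
  unique.\<close>

lemma frac_laplacian_glue_uminus:
  fixes u \<phi> :: "'a::euclidean_space \<Rightarrow> real"
  assumes u: "bounded_borel u" and s: "0 < s" "s < 1" and \<phi>: "C2 \<phi>" and U: "open U" "bounded U" "x \<in> U"
  shows "frac_laplacian s (\<lambda>x. if x \<in> U then - \<phi> x else - u x) x = - frac_laplacian s (\<lambda>x. if x \<in> U then \<phi> x else u x) x"
proof -
  let ?\<psi> = "\<lambda>x. if x \<in> U then \<phi> x else u x"
  note c = C2_continuous[OF \<phi>, of UNIV]
  have eq: "(\<lambda>x. if x \<in> U then - \<phi> x else - u x) = (\<lambda>x. - ?\<psi> x)" by auto
  have "hlap s ?\<psi> x (frac_laplacian s ?\<psi> x / lap_ratio TYPE('a) s)"
    using U by (intro frac_laplacian_hlap[OF bounded_borel_glue[OF U(1,2) c u] s \<phi>]) auto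
  then have 1: "hlap s (\<lambda>x. - ?\<psi> x) x (- (frac_laplacian s ?\<psi> x / lap_ratio TYPE('a) s))"
    by (rule hlap_uminus)
  have 2: "hlap s (\<lambda>x. - ?\<psi> x) x (frac_laplacian s (\<lambda>x. - ?\<psi> x) x / lap_ratio TYPE('a) s)"
    using U by (intro frac_laplacian_hlap[OF bounded_borel_uminus[OF bounded_borel_glue[OF U(1,2) c u]] s C2_uminus[OF \<phi>]]) auto
  have "frac_laplacian s (\<lambda>x. - ?\<psi> x) x / lap_ratio TYPE('a) s = - (frac_laplacian s ?\<psi> x / lap_ratio TYPE('a) s)"
    using tendsto_unique[OF _ 2[unfolded hlap_def] 1[unfolded hlap_def]] by simp
  then show ?thesis unfolding eq using lap_ratio_pos[OF s, where 'a = 'a] by (simp add: field_simps)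
qed

text \<open>Reduces the rest to subsolutions: in existence and in uniqueness the corresponding lemma
  is applied once to the data with \<open>f\<close> and once to the negated data, with the same
  \<open>a\<close> and \<open>c\<close>.\<close>

lemma supersolution_iff_subsolution_uminus:
  fixes u :: "'a::euclidean_space \<Rightarrow> real"
  assumes u: "bounded_borel u" and s: "0 < s" "s < 1"
  shows "viscosity_supersolution s a c f u \<longleftrightarrow> viscosity_subsolution s a c (\<lambda>x. - f x) (\<lambda>x. - u x)"
proof
  assume sup: "viscosity_supersolution s a c f u"
  show "viscosity_subsolution s a c (\<lambda>x. - f x) (\<lambda>x. - u x)"
    unfolding viscosity_subsolution_def
  proof (intro conjI allI impI)
    show "(\<lambda>x. - u x) \<in> Ls_space s" by (intro bounded_borel_Ls_space bounded_borel_uminus u s)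
    show "usc (\<lambda>x. - u x)" using sup by (simp add: viscosity_supersolution_def lsc_iff_usc_uminus)
    fix U x0 and \<phi> :: "'a \<Rightarrow> real"
    assume U: "open U" "bounded U" "x0 \<in> U" and \<phi>: "C2 \<phi>" and t: "- u x0 = \<phi> x0" "\<forall>x\<in>U. - u x - \<phi> x \<le> - u x0 - \<phi> x0"
    have t': "u x0 = - \<phi> x0" "\<And>x. x \<in> U \<Longrightarrow> u x0 - - \<phi> x0 \<le> u x - - \<phi> x"
      using t by fastforce+
    have "f x0 \<le> a x0 * frac_laplacian s (\<lambda>x. if x \<in> U then - \<phi> x else u x) x0 - c x0 * u x0"
      by (rule sup[unfolded viscosity_supersolution_def, THEN conjunct2, THEN conjunct2, rule_format, OF U C2_uminus[OF \<phi>] t'])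
    moreover have "frac_laplacian s (\<lambda>x. if x \<in> U then \<phi> x else - u x) x0 = - frac_laplacian s (\<lambda>x. if x \<in> U then - \<phi> x else u x) x0"
      using frac_laplacian_glue_uminus[OF u s C2_uminus[OF \<phi>] U] by (simp only: minus_minus)
    ultimately show "a x0 * frac_laplacian s (\<lambda>x. if x \<in> U then \<phi> x else - u x) x0 - c x0 * - u x0 \<le> - f x0"
      by simp
  qed
next
  assume sub: "viscosity_subsolution s a c (\<lambda>x. - f x) (\<lambda>x. - u x)"
  show "viscosity_supersolution s a c f u"
    unfolding viscosity_supersolution_def
  proof (intro conjI allI impI)
    show "u \<in> Ls_space s" by (intro bounded_borel_Ls_space u s)
    show "lsc u" using sub by (simp add: viscosity_subsolution_def lsc_iff_usc_uminus)
    fix U x0 and \<phi> :: "'a \<Rightarrow> real"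
    assume U: "open U" "bounded U" "x0 \<in> U" and \<phi>: "C2 \<phi>" and t: "u x0 = \<phi> x0" "\<forall>x\<in>U. u x0 - \<phi> x0 \<le> u x - \<phi> x"
    have t': "- u x0 = - \<phi> x0" "\<And>x. x \<in> U \<Longrightarrow> - u x - - \<phi> x \<le> - u x0 - - \<phi> x0"
      using t by fastforce+
    have "a x0 * frac_laplacian s (\<lambda>x. if x \<in> U then - \<phi> x else - u x) x0 - c x0 * - u x0 \<le> - f x0"
      by (rule sub[unfolded viscosity_subsolution_def, THEN conjunct2, THEN conjunct2, rule_format, OF U C2_uminus[OF \<phi>] t'])
    then show "f x0 \<le> a x0 * frac_laplacian s (\<lambda>x. if x \<in> U then \<phi> x else u x) x0 - c x0 * u x0"
      using frac_laplacian_glue_uminus[OF u s \<phi> U] by simp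
  qed
qed

context riesz
begin

text \<open>A potential that solves the equation pointwise in the sense of \<^const>\<open>hlap\<close> is a viscosity subsolution:
  a function touching it from above has the smaller \<^const>\<open>hlap\<close>.\<close>

lemma potential_subsolution:
  fixes q a c f w :: "'a \<Rightarrow> real"
  assumes q: "fast_decay \<beta> q M" and a: "\<And>x. a x > 0" and w: "\<And>x. w x = \<gamma> + pot s q x"
    and eq: "\<And>x. lap_ratio TYPE('a) s * marchaud_const s * a x * q x = f x + c x * w x"
  shows "viscosity_subsolution s a c f w"
proof -
  have w': "w = (\<lambda>x. \<gamma> + pot s q x)" using w by auto
  have wb: "bounded_borel w" unfolding w' by (intro bounded_borel_add bounded_borel_const pot_bounded_borel[OF q])
  have wc: "continuous_on UNIV w" unfolding w' by (intro continuous_intros pot_continuous[OF q])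
  note \<kappa> = lap_ratio_pos[OF s, where 'a = 'a]
  show ?thesis
    unfolding viscosity_subsolution_def
  proof (intro conjI allI impI)
    show "w \<in> Ls_space s" using wb s by (intro bounded_borel_Ls_space)
    show "usc w" using wc by (rule continuous_imp_usc)
    fix U x0 and \<phi> :: "'a \<Rightarrow> real"
    assume U: "open U" "bounded U" "x0 \<in> U" and \<phi>: "C2 \<phi>" and t: "w x0 = \<phi> x0" "\<forall>x\<in>U. w x - \<phi> x \<le> w x0 - \<phi> x0"
    let ?\<psi> = "\<lambda>x. if x \<in> U then \<phi> x else w x"
    note \<psi>b = bounded_borel_glue[OF U(1,2) C2_continuous[OF \<phi>] wb]
    have h1: "hlap s ?\<psi> x0 (frac_laplacian s ?\<psi> x0 / lap_ratio TYPE('a) s)"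
      using U by (intro frac_laplacian_hlap[OF \<psi>b s \<phi>]) auto
    have h2: "hlap s w x0 (marchaud_const s * q x0)" unfolding w' by (rule hlap_pot[OF q])
    have h3: "w y - w x0 \<le> ?\<psi> y - ?\<psi> x0" for y using t U by auto
    have "frac_laplacian s ?\<psi> x0 / lap_ratio TYPE('a) s \<le> marchaud_const s * q x0"
      by (rule hlap_mono[OF \<psi>b wb s(1) h3 h1 h2])
    then have "frac_laplacian s ?\<psi> x0 \<le> lap_ratio TYPE('a) s * (marchaud_const s * q x0)"
      unfolding pos_divide_le_eq[OF \<kappa>] by (simp only: mult.commute)
    then have "a x0 * frac_laplacian s ?\<psi> x0 \<le> a x0 * (lap_ratio TYPE('a) s * (marchaud_const s * q x0))"
      using a[of x0] by (intro mult_left_mono) auto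
    also have "\<dots> = f x0 + c x0 * w x0" unfolding eq[symmetric] by (simp add: mult_ac)
    finally show "a x0 * frac_laplacian s ?\<psi> x0 - c x0 * w x0 \<le> f x0" by simp
  qed
qed

text \<open>Only \<open>C\<^sup>2\<close> functions are admissible as test functions; as the potential \<open>w\<close> need not be one, \<open>u\<close> is
  touched by the smooth functions \<open>heat \<epsilon> (w + \<eta> pot s q0)\<close> and \<open>\<epsilon>\<close> tends to 0.\<close>

lemma subsolution_le_potential:
  fixes q a c f w u :: "'a \<Rightarrow> real"
  assumes q: "fast_decay \<beta> q M" and a: "\<And>x. a x > 0" and c: "\<And>x. c x \<le> 0"
    and cont: "continuous_on UNIV a" "continuous_on UNIV c" "continuous_on UNIV f"
    and w: "\<And>x. w x = \<gamma> + pot s q x"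
    and eq: "\<And>x. lap_ratio TYPE('a) s * marchaud_const s * a x * q x = f x + c x * w x"
    and u: "viscosity_subsolution s a c f u" "continuous_on UNIV u" "(u \<longlongrightarrow> \<gamma>) at_infinity"
  shows "u x \<le> w x"
proof (rule ccontr)
  assume "\<not> u x \<le> w x"
  define \<theta> where "\<theta> = u x - w x"
  have \<theta>: "\<theta> > 0" using \<open>\<not> u x \<le> w x\<close> by (simp add: \<theta>_def)
  define P where "P = pot_const + 1"
  \<comment> \<open>The perturbed barrier \<open>W\<close> stays within \<open>\<theta> / 8\<close>
    of \<open>w\<close>. Hence \<open>u - W\<close> still exceeds \<open>\<theta> / 2\<close> at
    \<open>x\<close>, and conversely a gap of \<open>\<theta> / 2\<close> between \<open>u\<close>
    and \<open>W\<close> at the limit point gives \<open>u > w\<close> there.\<close>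
  define \<eta> where "\<eta> = \<theta> / (8 * P)"
  have P: "P > 0" using pot_const_nonneg by (simp add: P_def)
  have \<eta>: "\<eta> > 0" using \<theta> P by (simp add: \<eta>_def)
  define p where "p y = q y + \<eta> * q0 y" for y
  have p: "fast_decay \<beta> p (M + \<bar>\<eta>\<bar> * 1)"
    unfolding p_def[abs_def] by (intro fast_decay_add q fast_decay_cmult q0_fast_decay)
  define W where "W y = \<gamma> + pot s p y" for y
  have W': "W = (\<lambda>y. \<gamma> + pot s p y)" by (auto simp: W_def)
  have Wb: "bounded_borel W" unfolding W' by (intro bounded_borel_add bounded_borel_const pot_bounded_borel[OF p])
  have Wc: "continuous_on UNIV W" unfolding W' by (intro continuous_intros pot_continuous[OF p])
  have Wl: "(W \<longlongrightarrow> \<gamma>) at_infinity" unfolding W' using tendsto_add[OF tendsto_const pot_tendsto[OF p], of \<gamma>] by simp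
  have Ww: "\<bar>W y - w y\<bar> \<le> \<theta> / 8" for y
  proof -
    have "W y - w y = \<eta> * pot s q0 y"
      unfolding W_def w p_def[abs_def] pot_add[OF q fast_decay_cmult[OF q0_fast_decay]] pot_cmult by simp
    moreover have "\<bar>pot s q0 y\<bar> \<le> P" using pot_bound[OF q0_fast_decay, of y] by (simp add: P_def)
    then have "\<eta> * \<bar>pot s q0 y\<bar> \<le> \<eta> * P" using \<eta> by (intro mult_left_mono) auto
    moreover have "\<eta> * P = \<theta> / 8" using P by (simp add: \<eta>_def)
    ultimately show ?thesis using \<eta> by (simp add: abs_mult)
  qed
  have Ww1: "W y - w y \<le> \<theta> / 8" and Ww2: "w y - W y \<le> \<theta> / 8" for y
    using Ww[of y] abs_ge_self[of "W y - w y"] abs_ge_minus_self[of "W y - w y"] by linarith+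
  note ub = bounded_borel_of_limit[OF u(2,3)]
  note \<kappa> = lap_ratio_pos[OF s, where 'a = 'a] and B = marchaud_const_pos[OF s]
  define e where "e n = 1 / real (Suc n)" for n
  have e: "\<And>n. e n > 0" "\<And>n. e n \<le> 1" "e \<longlonglongrightarrow> 0"
    using LIMSEQ_inverse_real_of_nat by (auto simp: e_def[abs_def] inverse_eq_divide)
  have "(\<lambda>n. u x - heat (e n) W x) \<longlonglongrightarrow> u x - heat 0 W x"
    by (intro tendsto_diff tendsto_const heat_tendsto[OF Wb Wc e(3)])
  moreover have "u x - heat 0 W x > \<theta> / 2" using Ww1[of x] \<theta> by (simp add: \<theta>_def field_simps)
  ultimately have "\<forall>\<^sub>F n in sequentially. u x - heat (e n) W x > \<theta> / 2"
    by (rule order_tendstoD(1))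
  then obtain n0 where n0: "\<And>n. n \<ge> n0 \<Longrightarrow> u x - heat (e n) W x > \<theta> / 2" unfolding eventually_sequentially by blast
  \<comment> \<open>Dropping the first \<open>n0\<close> terms makes the gap at \<open>x\<close>
    hold for every index. All times lie in the unit interval, which supplies compactness
    later.\<close>
  define d where "d n = e (n + n0)" for n
  have d: "\<And>n. d n > 0" "\<And>n. d n \<in> {0..1}" "d \<longlonglongrightarrow> 0"
    using e LIMSEQ_ignore_initial_segment[OF e(3), of n0] by (auto simp: d_def[abs_def] less_imp_le)
  have hl: "(heat (d n) W \<longlongrightarrow> \<gamma>) at_infinity" for n
    by (rule tendsto_at_infinity_sequentially) (rule heat_tendsto_at_infinity[OF Wb Wl tendsto_const])
  have "\<exists>z. \<forall>y. u y - heat (d n) W y \<le> u z - heat (d n) W z" for n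
  proof -
    have "continuous_on UNIV (\<lambda>y. u y - heat (d n) W y)"
      by (intro continuous_intros u heat_continuous Wb Wc)
    moreover have "((\<lambda>y. u y - heat (d n) W y) \<longlongrightarrow> 0) at_infinity"
      using tendsto_diff[OF u(3) hl[of n]] by simp
    moreover have "u x - heat (d n) W x > 0" using n0[of "n + n0"] \<theta> by (simp add: d_def)
    ultimately obtain z where "\<And>y. u y - heat (d n) W y \<le> u z - heat (d n) W z"
      by (rule attains_max_at_infinity[of "\<lambda>y. u y - heat (d n) W y" 0 x]) blast
    then show ?thesis by blast
  qed
  then have "\<forall>n. \<exists>z. \<forall>y. u y - heat (d n) W y \<le> u z - heat (d n) W z" by blast
  from choice[OF this] obtain X where X: "\<And>n y. u y - heat (d n) W y \<le> u (X n) - heat (d n) W (X n)" by blast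
  have X2: "u (X n) - heat (d n) W (X n) > \<theta> / 2" for n
    using X[where y = x and n = n] n0[of "n + n0"] by (simp add: d_def)
  have ineq: "lap_ratio TYPE('a) s * marchaud_const s * a (X n) * heat (d n) p (X n) \<le> f (X n) + c (X n) * u (X n)" for n
  proof -
    let ?x = "X n" and ?U = "ball (X n) 1"
    \<comment> \<open>The smoothed barrier lifted by the maximal gap touches \<open>u\<close> from
      above at \<open>?x\<close>, and does so over the whole space; any ball can therefore serve as
      \<open>?U\<close>.\<close>
    define \<phi> where "\<phi> y = (u ?x - heat (d n) W ?x) + heat (d n) W y" for y
    have \<phi>: "C2 \<phi>" unfolding \<phi>_def[abs_def] by (rule heat_C2[OF Wb d(1)])
    let ?\<psi> = "\<lambda>y. if y \<in> ?U then \<phi> y else u y"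
    note \<psi>b = bounded_borel_glue[OF open_ball bounded_ball C2_continuous[OF \<phi>] ub]
    have le: "u y \<le> \<phi> y" for y using X[of y n] by (simp add: \<phi>_def)
    have x: "\<phi> ?x = u ?x" by (simp add: \<phi>_def)
    have 1: "a ?x * frac_laplacian s ?\<psi> ?x - c ?x * u ?x \<le> f ?x"
      by (rule u(1)[unfolded viscosity_subsolution_def, THEN conjunct2, THEN conjunct2, rule_format, OF open_ball bounded_ball _ \<phi> x[symmetric]])
        (use le x in auto)
    have h1: "hlap s ?\<psi> ?x (frac_laplacian s ?\<psi> ?x / lap_ratio TYPE('a) s)"
      by (rule frac_laplacian_hlap[OF \<psi>b s \<phi> open_ball[of "X n" 1]]) auto
    have h2: "hlap s (heat (d n) W) ?x (marchaud_const s * heat (d n) p ?x)"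
      unfolding W' using d(1)[of n] by (intro hlap_heat_pot[OF p]) auto
    \<comment> \<open>Outside \<open>?U\<close> the glued function is \<open>u\<close>, which lies
      below \<open>\<phi>\<close>: gluing only lowers increments, the direction that
      \<open>hlap_mono\<close> needs here.\<close>
    have h3: "?\<psi> y - ?\<psi> ?x \<le> heat (d n) W y - heat (d n) W ?x" for y
      using le[of y] x by (auto simp: \<phi>_def)
    have "marchaud_const s * heat (d n) p ?x \<le> frac_laplacian s ?\<psi> ?x / lap_ratio TYPE('a) s"
      by (rule hlap_mono[OF bounded_borel_heat[OF Wb] \<psi>b s(1) h3 h2 h1])
    then have "lap_ratio TYPE('a) s * (marchaud_const s * heat (d n) p ?x) \<le> frac_laplacian s ?\<psi> ?x"
      unfolding pos_le_divide_eq[OF \<kappa>] by (simp only: mult.commute)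
    then have "a ?x * (lap_ratio TYPE('a) s * (marchaud_const s * heat (d n) p ?x)) \<le> a ?x * frac_laplacian s ?\<psi> ?x"
      using a[of ?x] by (intro mult_left_mono) auto
    then show ?thesis using 1 by (simp add: mult_ac)
  qed
  \<comment> \<open>Both \<open>u\<close> and the smoothed barriers tend to \<open>\<gamma>\<close>
    at infinity, so escaping touching points would contradict the gap. The indices
    \<open>r k\<close> need not be monotone, hence the times \<open>d (r k)\<close> are made
    convergent by compactness.\<close>
  have "\<exists>R. \<forall>n. norm (X n) \<le> R"
  proof (rule ccontr)
    assume "\<not> (\<exists>R. \<forall>n. norm (X n) \<le> R)"
    then have "\<forall>k::nat. \<exists>n. norm (X n) \<ge> real k" by (meson linear)
    from choice[OF this] obtain r where r: "\<And>k::nat. norm (X (r k)) \<ge> real k" by blast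
    obtain t0 \<rho> where \<rho>: "strict_mono \<rho>" "((\<lambda>k. d (r k)) \<circ> \<rho>) \<longlonglongrightarrow> t0"
      using compact_Icc[of 0 "1::real", unfolded compact_def, rule_format, of "\<lambda>k. d (r k)"] d(2) by blast
    have "filterlim (\<lambda>k. norm (X (r k))) at_top sequentially"
      by (rule filterlim_at_top_mono[OF filterlim_real_sequentially]) (use r in auto)
    then have "filterlim (\<lambda>k. norm (X (r (\<rho> k)))) at_top sequentially"
      using filterlim_compose[OF _ filterlim_subseq[OF \<rho>(1)]] by blast
    then have Xi: "filterlim (\<lambda>k. X (r (\<rho> k))) at_infinity sequentially"
      by (simp add: filterlim_at_infinity_conv_norm_at_top)
    have "(\<lambda>k. heat (d (r (\<rho> k))) W (X (r (\<rho> k)))) \<longlonglongrightarrow> \<gamma>"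
      using \<rho>(2) Xi by (intro heat_tendsto_at_infinity[OF Wb Wl]) (auto simp: comp_def)
    then have "(\<lambda>k. u (X (r (\<rho> k))) - heat (d (r (\<rho> k))) W (X (r (\<rho> k)))) \<longlonglongrightarrow> \<gamma> - \<gamma>"
      by (intro tendsto_diff filterlim_compose[OF u(3) Xi])
    then have "\<theta> / 2 \<le> \<gamma> - \<gamma>"
      by (rule LIMSEQ_le_const) (use less_imp_le[OF X2] in blast)
    then show False using \<theta> by simp
  qed
  then obtain R where R: "\<And>n. X n \<in> cball 0 R" by auto
  obtain l \<rho> where l: "strict_mono \<rho>" "(X \<circ> \<rho>) \<longlonglongrightarrow> l"
    using compact_cball[of "0::'a" R, unfolded compact_def, rule_format, of X] R by blast
  have Xl: "(\<lambda>n. X (\<rho> n)) \<longlonglongrightarrow> l" using l(2) by (simp add: comp_def)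
  have dl: "(\<lambda>n. d (\<rho> n)) \<longlonglongrightarrow> 0" using LIMSEQ_subseq_LIMSEQ[OF d(3) l(1)] by (simp add: comp_def)
  have cl: "(\<lambda>n. g (X (\<rho> n))) \<longlonglongrightarrow> g l" if "continuous_on UNIV g" for g :: "'a \<Rightarrow> real"
    using that Xl isCont_tendsto_compose by (metis UNIV_I continuous_on_eq_continuous_at open_UNIV)
  have "(\<lambda>n. u (X (\<rho> n)) - heat (d (\<rho> n)) W (X (\<rho> n))) \<longlonglongrightarrow> u l - heat 0 W l"
    by (intro tendsto_diff cl u heat_tendsto[OF Wb Wc dl Xl])
  then have "\<theta> / 2 \<le> u l - heat 0 W l"
    by (rule LIMSEQ_le_const) (use less_imp_le[OF X2] in blast)
  then have uw: "u l > w l" using Ww2[of l] \<theta> by (simp add: field_simps)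
  have "(\<lambda>n. lap_ratio TYPE('a) s * marchaud_const s * a (X (\<rho> n)) * heat (d (\<rho> n)) p (X (\<rho> n)))
    \<longlonglongrightarrow> lap_ratio TYPE('a) s * marchaud_const s * a l * heat 0 p l"
    using p unfolding fast_decay_def
    by (intro tendsto_mult tendsto_const cl cont heat_tendsto[OF fast_decay_bounded[OF p] _ dl Xl]) auto
  moreover have "(\<lambda>n. f (X (\<rho> n)) + c (X (\<rho> n)) * u (X (\<rho> n))) \<longlonglongrightarrow> f l + c l * u l"
    by (intro tendsto_intros cl cont u)
  ultimately have "lap_ratio TYPE('a) s * marchaud_const s * a l * heat 0 p l \<le> f l + c l * u l"
    using ineq by (intro LIMSEQ_le) auto
  \<comment> \<open>The sign of \<open>c\<close> enters, as \<open>u l > w l\<close>. Comparison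
    with the equation for \<open>w\<close> then leaves \<open>p l \<le> q l\<close>, although
    \<open>p\<close> exceeds \<open>q\<close> by the positive \<open>\<eta> * q0\<close>.\<close>
  also have "\<dots> \<le> f l + c l * w l" using c[of l] uw by (simp add: mult_left_mono_neg)
  also have "\<dots> = lap_ratio TYPE('a) s * marchaud_const s * a l * q l" by (rule eq[symmetric])
  finally have "lap_ratio TYPE('a) s * marchaud_const s * a l * p l \<le> lap_ratio TYPE('a) s * marchaud_const s * a l * q l"
    by simp
  moreover have "lap_ratio TYPE('a) s * marchaud_const s * a l > 0" using \<kappa> B a by simp
  ultimately have "p l \<le> q l" using mult_le_cancel_left_pos by blast
  then show False using \<eta> q0_pos[of l] by (simp add: p_def zero_less_mult_iff mult_le_0_iff)
qed

end

section \<open>Regularity of the coefficients and conclusion\<close>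

lemma locally_holder_continuous:
  fixes g :: "'a::euclidean_space \<Rightarrow> real"
  assumes g: "locally_holder \<sigma> g" and \<sigma>: "\<sigma> > 0"
  shows "continuous_on UNIV g"
proof (rule continuous_on_UNIV_sequentially)
  fix X :: "nat \<Rightarrow> 'a" and x assume X: "X \<longlonglongrightarrow> x"
  obtain L where L: "\<And>y. y \<in> cball x 1 \<Longrightarrow> \<bar>g y - g x\<bar> \<le> L * dist y x powr \<sigma>"
    using g compact_cball[of x 1] unfolding locally_holder_def by (metis centre_in_cball zero_le_one)
  have "\<forall>\<^sub>F n in sequentially. dist (X n) x < 1" using X by (intro tendstoD) auto
  then have ev: "\<forall>\<^sub>F n in sequentially. norm (g (X n) - g x) \<le> L * dist (X n) x powr \<sigma>"
  proof eventually_elim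
    fix n assume "dist (X n) x < 1"
    then have "X n \<in> cball x 1" by (simp add: dist_commute)
    then show "norm (g (X n) - g x) \<le> L * dist (X n) x powr \<sigma>" using L by simp
  qed
  have "(\<lambda>n. dist (X n) x) \<longlonglongrightarrow> 0" using X by (rule tendsto_dist_iff[THEN iffD1])
  then have "(\<lambda>n. dist (X n) x powr \<sigma>) \<longlonglongrightarrow> 0 powr \<sigma>"
    using \<sigma> by (intro tendsto_powr') auto
  then have "(\<lambda>n. L * dist (X n) x powr \<sigma>) \<longlonglongrightarrow> 0" by (simp add: tendsto_mult_right_zero)
  from Lim_null_comparison[OF ev this] show "(\<lambda>n. g (X n)) \<longlonglongrightarrow> g x" by (simp add: LIM_zero_iff)
qed

text \<open>The set where the essential bound is exceeded is open and null, hence empty.\<close>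

lemma L_infty_continuous_bounded:
  fixes g :: "'a::euclidean_space \<Rightarrow> real"
  assumes g: "L_infty g" "continuous_on UNIV g"
  obtains K where "\<And>x. \<bar>g x\<bar> \<le> K"
proof -
  obtain K where K: "AE x in lebesgue. \<bar>g x\<bar> \<le> K" using g(1) unfolding L_infty_def by blast
  have o: "open {x. K < \<bar>g x\<bar>}"
    using g(2) by (intro open_Collect_less continuous_intros)
  moreover have "{x. K < \<bar>g x\<bar>} \<in> sets lebesgue" using o by (intro sets_completionI_sets) auto
  then have "negligible {x. K < \<bar>g x\<bar>}"
    using K by (simp add: negligible_iff_null_sets AE_iff_null_sets not_less)
  ultimately have "{x. K < \<bar>g x\<bar>} = {}" using open_not_negligible by blast
  then have "\<not> K < \<bar>g x\<bar>" for x by blast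
  then have "\<bar>g x\<bar> \<le> K" for x by (simp add: not_less)
  then show ?thesis by (rule that)
qed

theorem theorem2p10:
  fixes s \<sigma> C0 \<alpha> \<gamma> :: real
    and a c f :: "'a::euclidean_space \<Rightarrow> real"
  assumes "0 < s" and "s < 1"
    and "real DIM('a) > 2 * s"
    and "0 < \<sigma>" and "\<sigma> < 1"
    and "locally_holder \<sigma> a" and "\<And>x. a x > 0"
    and "C0 > 0" and "\<alpha> > 2 * s"
    and "\<And>x. a x \<ge> C0 * (1 + (norm x)\<^sup>2) powr (\<alpha> / 2)"
    and "locally_holder \<sigma> c" and "L_infty c"
    and "locally_holder \<sigma> f" and "L_infty f"
    and "\<And>x. c x \<le> 0"
  shows "\<exists>!u. viscosity_solution s a c f u \<and> (u \<longlongrightarrow> \<gamma>) at_infinity"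
proof -
  \<comment> \<open>The midpoint between \<open>s\<close> and the smaller of
    \<open>\<alpha> / 2\<close> and \<open>N / 2\<close>, both of which exceed \<open>s\<close> by
    hypothesis. Being at most \<open>\<alpha> / 2\<close>, it lets the growth of \<open>a\<close>
    yield the decay of \<open>1 / a\<close>.\<close>
  define \<beta> where "\<beta> = (s + min (\<alpha> / 2) (real DIM('a) / 2)) / 2"
  have \<beta>_bounds: "s < \<beta>" "\<beta> < real DIM('a) / 2" "\<beta> \<le> \<alpha> / 2"
    using assms(3,9) by (auto simp: \<beta>_def min_def)
  interpret riesz s \<beta> "TYPE('a)"
    using assms(1,2) \<beta>_bounds by unfold_locales auto
  note a_pos = \<open>\<And>x. a x > 0\<close> and c_le = \<open>\<And>x. c x \<le> 0\<close>
  have cont: "continuous_on UNIV a" "continuous_on UNIV c" "continuous_on UNIV f"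
    using assms(4,6,11,13) by (auto intro: locally_holder_continuous)
  obtain Kc where Kc: "\<And>x. \<bar>c x\<bar> \<le> Kc" using L_infty_continuous_bounded[OF assms(12) cont(2)] by blast
  obtain Kf where Kf: "\<And>x. \<bar>f x\<bar> \<le> Kf" using L_infty_continuous_bounded[OF assms(14) cont(3)] by blast
  \<comment> \<open>The \<open>hlap\<close> of \<open>\<gamma> + pot s q\<close> is
    \<open>marchaud_const s * q\<close>, and \<open>lap_ratio\<close> converts it to the
    normalisation of the fractional Laplacian; the equation thus takes the form
    \<open>k * a * q = f + c * w\<close>.\<close>
  define k where "k = lap_ratio TYPE('a) s * marchaud_const s"
  have k: "k > 0" unfolding k_def using lap_ratio_pos[OF s, where 'a = 'a] marchaud_const_pos[OF s] by simp
  have inv_a: "fast_decay \<beta> (\<lambda>x. 1 / (k * a x)) (2 powr \<beta> / (k * C0))"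
    unfolding fast_decay_def
  proof (intro conjI allI)
    show "continuous_on UNIV (\<lambda>x. 1 / (k * a x))"
      using k a_pos by (intro continuous_intros cont) (auto simp: less_imp_neq[symmetric])
    fix x :: 'a
    \<comment> \<open>Source of the factor \<open>2 powr \<beta>\<close>: \<open>fast_decay\<close>
      is stated with \<open>1 + norm x\<close>, the growth of \<open>a\<close> with
      \<open>1 + (norm x)\<^sup>2\<close>.\<close>
    have "(1 + norm x)\<^sup>2 \<le> 2 * (1 + (norm x)\<^sup>2)"
      using zero_le_power2[of "1 - norm x"] by (simp add: power2_eq_square algebra_simps)
    then have "((1 + norm x)\<^sup>2) powr \<beta> \<le> (2 * (1 + (norm x)\<^sup>2)) powr \<beta>"
      using s \<beta> by (intro powr_mono2) auto
    moreover have "((1 + norm x)\<^sup>2) powr \<beta> = (1 + norm x) powr (2 * \<beta>)"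
    proof -
      have "0 < 1 + norm x" by (simp add: add_pos_nonneg)
      then have "(1 + norm x)\<^sup>2 = (1 + norm x) powr 2" by (simp add: powr_numeral)
      then show ?thesis by (simp only: powr_powr)
    qed
    ultimately have "(1 + norm x) powr (2 * \<beta>) \<le> 2 powr \<beta> * (1 + (norm x)\<^sup>2) powr \<beta>"
      by (simp only: powr_mult)
    also have "\<dots> \<le> 2 powr \<beta> * (1 + (norm x)\<^sup>2) powr (\<alpha> / 2)"
      using \<beta>_bounds by (intro mult_left_mono powr_mono) auto
    finally have "C0 * (1 + norm x) powr (2 * \<beta>) \<le> 2 powr \<beta> * (C0 * (1 + (norm x)\<^sup>2) powr (\<alpha> / 2))"
      using assms(8) by (simp add: mult.left_commute)
    also have "\<dots> \<le> 2 powr \<beta> * a x" using assms(10) by (intro mult_left_mono) auto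
    finally have 1: "C0 * (1 + norm x) powr (2 * \<beta>) \<le> 2 powr \<beta> * a x" .
    have n: "(1 + norm x) powr (2 * \<beta>) > 0" by (simp add: add_nonneg_eq_0_iff)
    have "1 / a x \<le> 2 powr \<beta> / C0 * (1 + norm x) powr (- (2 * \<beta>))"
      using 1 n a_pos[of x] assms(8) by (simp add: powr_minus field_simps)
    then have "1 / a x / k \<le> 2 powr \<beta> / C0 * (1 + norm x) powr (- (2 * \<beta>)) / k"
      using k by (intro divide_right_mono) auto
    then show "\<bar>1 / (k * a x)\<bar> \<le> 2 powr \<beta> / (k * C0) * (1 + norm x) powr (- (2 * \<beta>))"
      using k a_pos[of x] by (simp add: abs_mult field_simps)
  qed
  have b: "fast_decay \<beta> (\<lambda>x. - c x * (1 / (k * a x))) (Kc * (2 powr \<beta> / (k * C0)))"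
    using Kc by (intro fast_decay_mult[OF inv_a] continuous_intros cont) auto
  have g: "fast_decay \<beta> (\<lambda>x. f x * (1 / (k * a x))) (Kf * (2 powr \<beta> / (k * C0)))"
    using Kf by (intro fast_decay_mult[OF inv_a] cont) auto
  \<comment> \<open>The sign of \<open>c\<close> enters the existence part here: it makes the
    zero-order coefficient nonnegative, as the a priori bound requires.\<close>
  have b_nonneg: "- c x * (1 / (k * a x)) \<ge> 0" for x
    using c_le[of x] k a_pos[of x] by (intro mult_nonneg_nonneg) auto
  obtain w M Mq where w: "continuous_on UNIV w" "\<And>x. \<bar>w x\<bar> \<le> M"
    and wq: "fast_decay \<beta> (\<lambda>x. f x * (1 / (k * a x)) - (- c x * (1 / (k * a x))) * w x) Mq"
    and wpot: "\<And>x. w x = \<gamma> + pot s (\<lambda>x. f x * (1 / (k * a x)) - (- c x * (1 / (k * a x))) * w x) x"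
    by (rule schroedinger_solvable[OF b b_nonneg g, of \<gamma>]) blast
  \<comment> \<open>Equal to \<open>(f x + c x * w x) / (k * a x)\<close>, the density that the
    equation dictates.\<close>
  define q where "q = (\<lambda>x. f x * (1 / (k * a x)) - (- c x * (1 / (k * a x))) * w x)"
  have q: "fast_decay \<beta> q Mq" unfolding q_def by (rule wq)
  have weq: "w x = \<gamma> + pot s q x" for x unfolding q_def by (rule wpot)
  have eq: "lap_ratio TYPE('a) s * marchaud_const s * a x * q x = f x + c x * w x" for x
    unfolding k_def[symmetric] q_def using k a_pos[of x] by (simp add: field_simps)
  have "((\<lambda>x. \<gamma> + pot s q x) \<longlongrightarrow> \<gamma>) at_infinity"
    using tendsto_add[OF tendsto_const pot_tendsto[OF q], of \<gamma>] by simp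
  then have wlim: "(w \<longlongrightarrow> \<gamma>) at_infinity"
    unfolding weq[symmetric] .
  have weq': "\<And>x. - w x = - \<gamma> + pot s (\<lambda>x. - q x) x" using weq by (simp add: pot_uminus)
  have eq': "lap_ratio TYPE('a) s * marchaud_const s * a x * - q x = - f x + c x * - w x" for x
    using eq[of x] by simp
  show ?thesis
  proof (rule ex1I[of _ w], intro conjI)
    show "viscosity_solution s a c f w"
      unfolding viscosity_solution_def supersolution_iff_subsolution_uminus[OF bounded_borel_of_limit[OF w(1) wlim] s]
      using potential_subsolution[OF q a_pos weq eq] potential_subsolution[OF fast_decay_uminus[OF q] a_pos weq' eq'] by blast
    show "(w \<longlongrightarrow> \<gamma>) at_infinity" by (rule wlim)
    fix u assume u: "viscosity_solution s a c f u \<and> (u \<longlongrightarrow> \<gamma>) at_infinity"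
    then have sub: "viscosity_subsolution s a c f u" and sup: "viscosity_supersolution s a c f u"
      and ulim: "(u \<longlongrightarrow> \<gamma>) at_infinity" unfolding viscosity_solution_def by auto
    \<comment> \<open>Semicontinuity from both sides gives continuity and, with the limit at
      infinity, boundedness; this puts \<open>u\<close> within reach of the sign change and of the
      comparison.\<close>
    have uc: "continuous_on UNIV u"
      using sub sup continuous_of_semicontinuous unfolding viscosity_subsolution_def viscosity_supersolution_def by blast
    have sub': "viscosity_subsolution s a c (\<lambda>x. - f x) (\<lambda>x. - u x)"
      using sup unfolding supersolution_iff_subsolution_uminus[OF bounded_borel_of_limit[OF uc ulim] s] .
    have "u x \<le> w x" for x
      by (rule subsolution_le_potential[OF q a_pos c_le cont weq eq sub uc ulim])
    moreover have "- u x \<le> - w x" for x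
      by (rule subsolution_le_potential[OF fast_decay_uminus[OF q] a_pos c_le cont(1,2) continuous_on_minus[OF cont(3)] weq' eq' sub'
            continuous_on_minus[OF uc] tendsto_minus[OF ulim]])
    ultimately show "u = w" by (intro ext antisym) auto
  qed
qed

end
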